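(* If for a linear vector field $F(\xi)=F\xi$, $\xi\in\mathfrak g_0$, the matrix $F$ has eigenvalues with both positive and negative real parts, then the quadratic $L$-$F$ system on $TM$ is integrable. Moreover, the invariant tori are common level sets of real-analytic first integrals. Any small perturbation of such a quadratic integrable $L$-$F$ system in the space of all $L$-$F$ systems must be integrable.
   Context: Let $\mathfrak g_0=\mathbb R^n$ with its Euclidean scalar product and let $L:\mathfrak g_0\to\mathfrak g_0$ be an arbitrary linear operator. Let $G=\mathbb R^n\times\mathbb R$ be the Lie group with coordinates $(w,u)$ and multiplication $(w,u)(w',u')=(w+e^{uL}w',u+u')$, with $G_0=\{u=0\}\cong\mathbb R^n$. Its Lie algebra is $\mathfrak g=\mathfrak g_0\oplus\mathbb R b$ with $\mathfrak g_0$ an abelian ideal and $\mathrm{ad}_b|_{\mathfrak g_0}=L$; it carries the scalar product extending that of $\mathfrak g_0$ with $b$ a unit vector orthogonal to $\mathfrak g_0$, and $G$ carries the corresponding left-invariant Riemannian metric. Elements of $\mathfrak g$ are written $(\xi,\eta)=\xi+\eta b$, and $TG$ is identified with $G\times\mathfrak g$ by left translations, with coordinates $(w,u;\xi,\eta)$. Let $\Gamma_0\subset G_0$ be a lattice of rank $n$, and $M=\Gamma_0\backslash G\cong(\Gamma_0\backslash\mathbb R^n)\times\mathbb R$, so that $TM=M\times\mathfrak g$ and the unit sphere bundle is $SM=M\times\{\xi^2+\eta^2=1\}$. For a smooth, in general non-linear, vector field $F:\mathfrak g_0\to\mathfrak g_0$, the $L$-$F$ system is the flow of $$\frac{d\xi}{dt}=\eta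 F(\xi),\quad \frac{d\eta}{dt}=-\langle F(\xi),\xi\rangle,\quad \frac{dw}{dt}=e^{uL}\xi,\quad \frac{du}{dt}=\eta$$ on $TM$; it preserves $\xi^2+\eta^2$ and so restricts to $SM$, and to define an $L$-$F$ system on $SM$ it is enough that $F$ be defined in the closed unit ball of $\mathfrak g_0$. The $L$-$F$ system is called quadratic if $F$ is linear. The class of $L$-$F$ systems is parametrized by the operator $L$ and the vector field $F$. A dynamical system is called integrable if an open and dense subset of its phase space is filled with invariant tori carrying quasi-periodic motions. *)

theory Defs
  imports "HOL-Analysis.Analysis"
begin

section \<open>Regularity classes\<close>

text \<open>Derivatives are taken within \<open>S\<close>, so that on a closed ball one-sided derivatives at the
  boundary are meant. In finite dimension, continuity of all directional derivatives
  \<open>\<lambda>x. f' x v\<close> is continuity of \<open>f'\<close>.\<close>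

primrec C_diff_on ::
    "nat \<Rightarrow> ('a::euclidean_space \<Rightarrow> 'b::real_normed_vector) \<Rightarrow> 'a set \<Rightarrow> bool" where
  "C_diff_on 0 f S \<longleftrightarrow> continuous_on S f"
| "C_diff_on (Suc k) f S \<longleftrightarrow>
     (\<exists>f'. (\<forall>x\<in>S. (f has_derivative f' x) (at x within S)) \<and> (\<forall>v. C_diff_on k (\<lambda>x. f' x v) S))"

definition smooth_on :: "('a::euclidean_space \<Rightarrow> 'b::real_normed_vector) \<Rightarrow> 'a set \<Rightarrow> bool" where
  "smooth_on f S \<longleftrightarrow> (\<forall>k. C_diff_on k f S)"

text \<open>Local expansion in a multivariate power series in the coordinates with respect to the
  standard basis; a multi-index is a function supported on \<open>Basis\<close>.\<close>

definition real_analytic_on ::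
    "('a::euclidean_space \<Rightarrow> 'b::real_normed_vector) \<Rightarrow> 'a set \<Rightarrow> bool" where
  "real_analytic_on f S \<longleftrightarrow> open S \<and>
     (\<forall>x\<in>S. \<exists>r>0. \<exists>c :: ('a \<Rightarrow> nat) \<Rightarrow> 'b. \<forall>h. (\<forall>b\<in>Basis. \<bar>h \<bullet> b\<bar> < r) \<longrightarrow>
        ((\<lambda>\<alpha>. (\<Prod>b\<in>Basis. (h \<bullet> b) ^ \<alpha> b) *\<^sub>R c \<alpha>) has_sum f (x + h)) {\<alpha>. \<forall>b. b \<notin> Basis \<longrightarrow> \<alpha> b = 0})"

text \<open>\<open>C\<^sup>1\<close>-closeness of two vector fields, uniformly on \<open>S\<close>.\<close>

definition C1_close_on ::
    "real \<Rightarrow> 'a::euclidean_space set \<Rightarrow> ('a \<Rightarrow> 'a) \<Rightarrow> ('a \<Rightarrow> 'a) \<Rightarrow> bool" where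
  "C1_close_on \<epsilon> S F F' \<longleftrightarrow>
     (\<forall>x\<in>S. norm (F' x - F x) < \<epsilon> \<and>
        (\<exists>D. ((\<lambda>y. F' y - F y) has_derivative D) (at x within S) \<and> onorm D < \<epsilon>))"

section \<open>Linear algebra\<close>

definition lin_exp :: "('a::euclidean_space \<Rightarrow> 'a) \<Rightarrow> 'a \<Rightarrow> 'a" where
  "lin_exp A v = (\<Sum>k. (A ^^ k) v /\<^sub>R fact k)"

definition complex_eigenvalue :: "real^'n^'n \<Rightarrow> complex \<Rightarrow> bool" where
  "complex_eigenvalue A z \<longleftrightarrow>
     (\<exists>v :: complex^'n. v \<noteq> 0 \<and> (\<chi> i j. complex_of_real (A $ i $ j)) *v v = z *s v)"

definition full_lattice :: "(real^'n) set \<Rightarrow> bool" where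
  "full_lattice \<Gamma> \<longleftrightarrow> (\<exists>b :: 'n \<Rightarrow> real^'n. inj b \<and> independent (range b) \<and>
     \<Gamma> = range (\<lambda>k :: 'n \<Rightarrow> int. \<Sum>i\<in>UNIV. of_int (k i) *\<^sub>R b i))"

section \<open>Integrability\<close>

definition quotient_topology :: "'a topology \<Rightarrow> ('a \<Rightarrow> 'b) \<Rightarrow> 'b topology" where
  "quotient_topology X q =
     topology (\<lambda>V. V \<subseteq> q ` topspace X \<and> openin X {x \<in> topspace X. q x \<in> V})"

lemma openin_quotient_topology:
  "openin (quotient_topology X q) V \<longleftrightarrow>
     V \<subseteq> q ` topspace X \<and> openin X {x \<in> topspace X. q x \<in> V}"
proof -
  have "istopology (\<lambda>V. V \<subseteq> q ` topspace X \<and> openin X {x \<in> topspace X. q x \<in> V})"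
    unfolding istopology_def
  proof (intro conjI allI impI)
    fix S T
    assume S: "S \<subseteq> q ` topspace X \<and> openin X {x \<in> topspace X. q x \<in> S}"
      and T: "T \<subseteq> q ` topspace X \<and> openin X {x \<in> topspace X. q x \<in> T}"
    show "S \<inter> T \<subseteq> q ` topspace X" using S by blast
    have "{x \<in> topspace X. q x \<in> S \<inter> T} = {x \<in> topspace X. q x \<in> S} \<inter> {x \<in> topspace X. q x \<in> T}"
      by blast
    then show "openin X {x \<in> topspace X. q x \<in> S \<inter> T}"
      using S T by (simp add: openin_Int)
  next
    fix K
    assume K: "\<forall>S\<in>K. S \<subseteq> q ` topspace X \<and> openin X {x \<in> topspace X. q x \<in> S}"
    show "\<Union>K \<subseteq> q ` topspace X" using K by blast
    have "{x \<in> topspace X. q x \<in> \<Union>K} = (\<Union>S\<in>K. {x \<in> topspace X. q x \<in> S})" by blast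
    then show "openin X {x \<in> topspace X. q x \<in> \<Union>K}"
      using K by auto
  qed
  then show ?thesis by (simp add: quotient_topology_def)
qed

text \<open>In this section the phase space is the topological space \<open>X\<close>, contained in the image of a
  covering projection \<open>q\<close> from a Euclidean space; the smooth and the real-analytic structure of the
  base are those pushed down by \<open>q\<close>. A dynamical system is given by the set \<open>traj\<close> of its
  complete trajectories.

  \<open>T\<close> is an invariant torus of dimension \<open>DIM('k)\<close> carrying quasi-periodic motions: the torus
  \<open>'k\<close> modulo its integer lattice is smoothly embedded with image \<open>T\<close>, by a map whose lift \<open>H\<close>
  carries the constant vector field \<open>\<omega>\<close> to the dynamics. As usual the components of \<open>\<omega>\<close>
  are not required to be rationally independent.\<close>

definition quasi_periodic_torus ::
    "'k::euclidean_space itself \<Rightarrow> ('c::euclidean_space \<Rightarrow> 'p) \<Rightarrow> (real \<Rightarrow> 'p) set \<Rightarrow> 'p set \<Rightarrow> bool" where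
  "quasi_periodic_torus _ q traj T \<longleftrightarrow>
     (\<forall>\<gamma>\<in>traj. \<gamma> 0 \<in> T \<longrightarrow> (\<forall>t. \<gamma> t \<in> T)) \<and>
     (\<exists>(H :: 'k \<Rightarrow> 'c) \<omega>.
        smooth_on H UNIV \<and>
        (\<forall>\<theta>. inj (frechet_derivative H (at \<theta>))) \<and>
        (\<forall>\<theta> \<theta>'. q (H \<theta>) = q (H \<theta>') \<longleftrightarrow> (\<forall>b\<in>Basis. (\<theta> - \<theta>') \<bullet> b \<in> \<int>)) \<and>
        range (q \<circ> H) = T \<and>
        (\<forall>\<theta>. (\<lambda>t. q (H (\<theta> + t *\<^sub>R \<omega>))) \<in> traj))"

definition integrable_with_tori ::
    "'k::euclidean_space itself \<Rightarrow> 'p topology \<Rightarrow> ('c::euclidean_space \<Rightarrow> 'p) \<Rightarrow> (real \<Rightarrow> 'p) set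
       \<Rightarrow> 'p set set \<Rightarrow> bool" where
  "integrable_with_tori K X q traj \<T> \<longleftrightarrow>
     openin X (\<Union>\<T>) \<and> X closure_of (\<Union>\<T>) = topspace X \<and>
     disjoint \<T> \<and> (\<forall>T\<in>\<T>. quasi_periodic_torus K q traj T)"

definition integrable_system ::
    "'k::euclidean_space itself \<Rightarrow> 'p topology \<Rightarrow> ('c::euclidean_space \<Rightarrow> 'p) \<Rightarrow> (real \<Rightarrow> 'p) set
       \<Rightarrow> bool" where
  "integrable_system K X q traj \<longleftrightarrow> (\<exists>\<T>. integrable_with_tori K X q traj \<T>)"

definition analytic_first_integral_on ::
    "'p set \<Rightarrow> ('c::euclidean_space \<Rightarrow> 'p) \<Rightarrow> (real \<Rightarrow> 'p) set \<Rightarrow> ('p \<Rightarrow> 'b::real_normed_vector) \<Rightarrow> bool"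
  where
  "analytic_first_integral_on U q traj f \<longleftrightarrow>
     real_analytic_on (f \<circ> q) {x. q x \<in> U} \<and>
     (\<forall>\<gamma>\<in>traj. range \<gamma> \<subseteq> U \<longrightarrow> (\<forall>t. f (\<gamma> t) = f (\<gamma> 0)))"

section \<open>L-F systems\<close>

text \<open>A point \<open>(w, u)\<close> of \<open>G\<close> and a vector \<open>(\<xi>, \<eta>) = \<xi> + \<eta> b\<close> of its Lie algebra are elements of
  the same type; its product norm is the one for which \<open>b\<close> is a unit vector orthogonal to the first
  factor. \<open>TG\<close> is \<open>G \<times> \<gg>\<close> via left translations.\<close>

type_synonym 'n grp = "(real^'n) \<times> real"
type_synonym 'n alg = "(real^'n) \<times> real"

fun gmult :: "(real^'n \<Rightarrow> real^'n) \<Rightarrow> 'n grp \<Rightarrow> 'n grp \<Rightarrow> 'n grp" where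
  "gmult L (w, u) (w', u') = (w + lin_exp (\<lambda>v. u *\<^sub>R L v) w', u + u')"

text \<open>Points of \<open>M = \<Gamma>\<^sub>0\G\<close> are the cosets \<open>\<Gamma>\<^sub>0 g\<close>.\<close>

definition M_proj ::
    "(real^'n \<Rightarrow> real^'n) \<Rightarrow> (real^'n) set \<Rightarrow> 'n grp \<Rightarrow> 'n grp set" where
  "M_proj L \<Gamma>\<^sub>0 g = (\<lambda>\<gamma>. gmult L (\<gamma>, 0) g) ` \<Gamma>\<^sub>0"

definition TM_proj ::
    "(real^'n \<Rightarrow> real^'n) \<Rightarrow> (real^'n) set \<Rightarrow> 'n grp \<times> 'n alg \<Rightarrow> 'n grp set \<times> 'n alg" where
  "TM_proj L \<Gamma>\<^sub>0 = (\<lambda>(g, v). (M_proj L \<Gamma>\<^sub>0 g, v))"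

definition TM_space ::
    "(real^'n \<Rightarrow> real^'n) \<Rightarrow> (real^'n) set \<Rightarrow> ('n grp set \<times> 'n alg) topology" where
  "TM_space L \<Gamma>\<^sub>0 = quotient_topology euclidean (TM_proj L \<Gamma>\<^sub>0)"

definition SM_space ::
    "(real^'n \<Rightarrow> real^'n) \<Rightarrow> (real^'n) set \<Rightarrow> ('n grp set \<times> 'n alg) topology" where
  "SM_space L \<Gamma>\<^sub>0 = subtopology (TM_space L \<Gamma>\<^sub>0) {(m, v). norm v = 1}"

fun LF_field ::
    "(real^'n \<Rightarrow> real^'n) \<Rightarrow> (real^'n \<Rightarrow> real^'n) \<Rightarrow> 'n grp \<times> 'n alg \<Rightarrow> 'n grp \<times> 'n alg" where
  "LF_field L F ((w, u), (\<xi>, \<eta>)) =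
     ((lin_exp (\<lambda>v. u *\<^sub>R L v) \<xi>, \<eta>), (\<eta> *\<^sub>R F \<xi>, - (F \<xi> \<bullet> \<xi>)))"

text \<open>The trajectories on a quotient are the projections of those on \<open>TG\<close>. The trajectories on
  \<open>SM\<close> satisfy \<open>norm \<xi> \<le> 1\<close>, so they only depend on \<open>F\<close> in the closed unit ball.\<close>

definition LF_TM ::
    "(real^'n \<Rightarrow> real^'n) \<Rightarrow> (real^'n \<Rightarrow> real^'n) \<Rightarrow> (real^'n) set
       \<Rightarrow> (real \<Rightarrow> 'n grp set \<times> 'n alg) set" where
  "LF_TM L F \<Gamma>\<^sub>0 =
     {TM_proj L \<Gamma>\<^sub>0 \<circ> c | c. \<forall>t. (c has_vector_derivative LF_field L F (c t)) (at t)}"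

definition LF_SM ::
    "(real^'n \<Rightarrow> real^'n) \<Rightarrow> (real^'n \<Rightarrow> real^'n) \<Rightarrow> (real^'n) set
       \<Rightarrow> (real \<Rightarrow> 'n grp set \<times> 'n alg) set" where
  "LF_SM L F \<Gamma>\<^sub>0 = {\<gamma> \<in> LF_TM L F \<Gamma>\<^sub>0. \<forall>t. norm (snd (\<gamma> t)) = 1}"

end

(*
The components (xi, eta) form a closed system that preserves xi^2 + eta^2, and along its trajectories
xi follows the flow of F for the time u. Hence u moves as a particle in the potential
|xi(u)|^2 / 2. As F has eigenvalues in both half planes, generically the potential well is bounded on
both sides and its ends are nondegenerate turning points: eta vanishes there and reverses, so that
(u, xi, eta) is periodic by reflection. Then w is periodic up to a drift, and the w-torus times this
periodic orbit is an invariant torus with a linear flow.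

For the bounded wells only the zeros of eta matter, and these persist under perturbation. Density
uses two facts. The difference of two solutions that starts in an unstable direction grows, for a
quadratic form that solves a Lyapunov equation, so not both of them stay in a ball. The orbits
tangent to a sphere, on which the turning points may degenerate, fill only a null set. Both facts persist
when F is perturbed by a map with a small Lipschitz constant.

In the quadratic case exp(-u F) xi and xi^2 + eta^2 are entire first integrals, and the tori are
components of their common level sets.
*)
theory Submission
  imports Defs
begin

section \<open>Ordinary differential equations with Lipschitz right-hand side\<close>

text \<open>The operator \<open>L\<close> occurs only in the equation for \<open>w\<close>, and
  \<open>w\<close> does not act back on the other variables. So the analysis is done for (\<xi>,
  \<eta>) alone; u and then w are recovered by integration. The field may be given only on a ball,
  and no growth bound is available for the product \<eta> F(\<xi>). Projecting radially onto a ball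
  makes the fields globally Lipschitz, and conservation of the norm keeps trajectories where nothing
  was changed. The obstacle is density. The Lyapunov equation is therefore shifted by \<mu>: its
  form controls one direction only, but with a margin |x|^2 that absorbs the perturbation. The
  truncated perturbed field is only Lipschitz, hence the null set of tangent orbits comes from a
  volume count on thin shells. One common level set of the entire integrals can contain several
  wells, thus several tori. To make each torus an exact level set, an integer label of the well is
  added to the energy, on a smaller open dense set where the label is locally constant.\<close>

lemma continuous_antiderivative:
  fixes f :: "real \<Rightarrow> 'a::euclidean_space"
  assumes "continuous_on UNIV f"
  shows "\<exists>F. F 0 = c \<and> (\<forall>t. (F has_vector_derivative f t) (at t))"
proof -
  obtain F where F: "\<And>t. (F has_vector_derivative f t) (at t)"
    using einterval_antiderivative[of "-\<infinity>" "\<infinity>" f] assms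
    by (auto simp: continuous_on_eq_continuous_at)
  have "((\<lambda>t. F t - F 0 + c) has_vector_derivative f t) (at t)" for t
    using F[of t] by (auto intro!: derivative_eq_intros)
  then show ?thesis by (intro exI[of _ "\<lambda>t. F t - F 0 + c"]) simp
qed

lemma vector_derivative_comp_affine:
  fixes x :: "real \<Rightarrow> 'a::real_normed_vector"
  assumes "(x has_vector_derivative d) (at (a * t + b))"
  shows "((\<lambda>t. x (a * t + b)) has_vector_derivative a *\<^sub>R d) (at t)"
proof -
  have "((\<lambda>t. a * t + b) has_vector_derivative a) (at t)"
    by (auto intro!: derivative_eq_intros simp: has_real_derivative_iff_has_vector_derivative[symmetric])
  from vector_diff_chain_at[OF this assms] show ?thesis by (simp add: o_def)
qed

text \<open>For t > 0 the assumed bound is the derivative of \<open>a * exp (K * t)\<close>, so the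
  mean value inequality applies; negative times follow by time reversal. It drives both the Picard
  iteration and the comparison of heights in \<open>trajectories_close\<close>.\<close>

lemma norm_le_exp_if_derivative_le_exp:
  fixes D :: "real \<Rightarrow> 'a::real_normed_vector"
  assumes der: "\<And>t. (D has_vector_derivative D' t) (at t)"
    and le: "\<And>t. norm (D' t) \<le> a * K * exp (K * \<bar>t\<bar>)"
  shows "norm (D t - D 0) \<le> a * (exp (K * \<bar>t\<bar>) - 1)"
proof -
  have *: "norm (E t - E 0) \<le> a * (exp (K * t) - 1)" if "t > 0"
    and derE: "\<And>t. (E has_vector_derivative E' t) (at t)"
    and leE: "\<And>t. norm (E' t) \<le> a * K * exp (K * \<bar>t\<bar>)"
    for t and E :: "real \<Rightarrow> 'a" and E'
  proof -
    have "norm (E t - E 0) \<le> a * exp (K * t) - a * exp (K * 0)"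
    proof (rule differentiable_bound_general[OF \<open>t > 0\<close>])
      show "continuous_on {0..t} E"
        by (meson derE has_vector_derivative_continuous continuous_at_imp_continuous_on)
      show "continuous_on {0..t} (\<lambda>t. a * exp (K * t))" by (intro continuous_intros)
      show "((\<lambda>t. a * exp (K * t)) has_vector_derivative a * K * exp (K * x)) (at x)" for x
        by (auto intro!: derivative_eq_intros simp: has_real_derivative_iff_has_vector_derivative[symmetric])
      show "norm (E' x) \<le> a * K * exp (K * x)" if "0 < x" for x using leE[of x] that by simp
    qed (use derE in auto)
    then show ?thesis by (simp add: algebra_simps)
  qed
  consider "t > 0" | "t = 0" | "t < 0" by linarith
  then show ?thesis
  proof cases
    case 1 then show ?thesis using *[OF 1 der le] by simp
  next
    case 3
    have "((\<lambda>s. D (-s)) has_vector_derivative - D' (-s)) (at s)" for s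
      using vector_derivative_comp_affine[of D "D' (-s)" "-1" s 0] der by simp
    moreover have "norm (- D' (-s)) \<le> a * K * exp (K * \<bar>s\<bar>)" for s using le[of "-s"] by simp
    ultimately show ?thesis using *[of "-t" "\<lambda>s. D (-s)" "\<lambda>s. - D' (-s)"] 3 by simp
  qed simp
qed

text \<open>Picard iteration on the whole line at once: measured with the weight
  \<open>exp (2 * K * \<bar>t\<bar>)\<close>, each step contracts by 1/2, so no short intervals have
  to be glued together.\<close>

theorem Lipschitz_ode_solution:
  fixes X :: "'a::euclidean_space \<Rightarrow> 'a"
  assumes "\<And>x y. norm (X x - X y) \<le> K0 * norm (x - y)"
  obtains x where "x 0 = x0" "\<And>t. (x has_vector_derivative X (x t)) (at t)"
proof -
  define K where "K = max K0 1"
  have K: "K > 0" by (auto simp: K_def)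
  have lip: "norm (X x - X y) \<le> K * norm (x - y)" for x y
    using assms[of x y] mult_right_mono[of K0 K "norm (x - y)"] by (auto simp: K_def)
  have contX: "continuous_on S X" for S
  proof (rule lipschitz_on_continuous_on)
    show "K-lipschitz_on S X" using lip K by (auto simp: lipschitz_on_def dist_norm)
  qed
  define p where "p = rec_nat (\<lambda>t::real. x0)
    (\<lambda>_ f. SOME F. F 0 = x0 \<and> (\<forall>t. (F has_vector_derivative X (f t)) (at t)))"
  have p0: "p 0 = (\<lambda>t. x0)" by (simp add: p_def)
  have pSuc: "p (Suc k) = (SOME F. F 0 = x0 \<and> (\<forall>t. (F has_vector_derivative X (p k t)) (at t)))" for k
    by (simp add: p_def)
  have pp: "continuous_on UNIV (p k) \<and> p (Suc k) 0 = x0 \<and>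
     (\<forall>t. (p (Suc k) has_vector_derivative X (p k t)) (at t))" for k
  proof (induction k)
    case 0
    show ?case
    proof -
      have "\<exists>F. F 0 = x0 \<and> (\<forall>t. (F has_vector_derivative X (p 0 t)) (at t))"
        using continuous_antiderivative[of "\<lambda>t. X (p 0 t)" x0] p0 by auto
      from someI_ex[OF this] show ?thesis unfolding pSuc[symmetric] by (simp add: p0)
    qed
  next
    case (Suc k)
    have c: "continuous_on UNIV (p (Suc k))"
      using Suc by (meson has_vector_derivative_continuous continuous_at_imp_continuous_on)
    then have "continuous_on UNIV (\<lambda>t. X (p (Suc k) t))"
      by (rule continuous_on_compose2[OF contX]) auto
    then have "\<exists>F. F 0 = x0 \<and> (\<forall>t. (F has_vector_derivative X (p (Suc k) t)) (at t))"
      using continuous_antiderivative[of "\<lambda>t. X (p (Suc k) t)" x0] by blast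
    from someI_ex[OF this] show ?case unfolding pSuc[symmetric] using c by simp
  qed
  have pz: "p k 0 = x0" for k using pp p0 by (cases k) auto
  have pder: "(p (Suc k) has_vector_derivative X (p k t)) (at t)" for k t using pp by blast
  \<comment> \<open>Chosen so that the derivative \<open>X x0\<close> of the first increment
    satisfies the exponential bound with rate \<open>2 * K\<close>.\<close>
  define C where "C = norm (X x0) / (2 * K)"
  have C: "C \<ge> 0" using K by (simp add: C_def)
  have step: "norm (p (Suc k) t - p k t) \<le> C * (1/2) ^ k * exp (2 * K * \<bar>t\<bar>)" for k t
  proof (induction k arbitrary: t)
    case 0
    have "((\<lambda>t. p 1 t - p 0 t) has_vector_derivative X x0) (at t)" for t
      using pder[of 0 t] by (auto simp: p0 intro!: derivative_eq_intros)
    moreover have "norm (X x0) \<le> C * (2 * K) * exp (2 * K * \<bar>t\<bar>)" for t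
    proof -
      have "norm (X x0) * 1 \<le> norm (X x0) * exp (2 * K * \<bar>t\<bar>)" 
        using K by (intro mult_left_mono) auto
      then show ?thesis using K by (simp add: C_def)
    qed
    ultimately have "norm ((p 1 t - p 0 t) - (p 1 0 - p 0 0)) \<le> C * (exp (2 * K * \<bar>t\<bar>) - 1)"
      by (rule norm_le_exp_if_derivative_le_exp)
    then show ?case using C by (simp add: pz algebra_simps)
  next
    case (Suc k)
    have "((\<lambda>t. p (Suc (Suc k)) t - p (Suc k) t) has_vector_derivative X (p (Suc k) t) - X (p k t)) (at t)" for t
      by (intro derivative_intros pder)
    moreover have "norm (X (p (Suc k) t) - X (p k t)) \<le> C * (1/2)^Suc k * (2 * K) * exp (2 * K * \<bar>t\<bar>)" for t
      using order_trans[OF lip mult_left_mono[OF Suc[of t], of K]] K by (simp add: algebra_simps)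
    ultimately have "norm ((p (Suc (Suc k)) t - p (Suc k) t) - (p (Suc (Suc k)) 0 - p (Suc k) 0))
       \<le> C * (1/2)^Suc k * (exp (2 * K * \<bar>t\<bar>) - 1)"
      by (rule norm_le_exp_if_derivative_le_exp)
    moreover have "C * (1/2)^Suc k * (exp (2 * K * \<bar>t\<bar>) - 1) \<le> C * (1/2)^Suc k * exp (2 * K * \<bar>t\<bar>)"
      using C by (intro mult_left_mono) auto
    ultimately show ?case by (simp add: pz)
  qed
  have far: "norm (p (k + m) t - p k t) \<le> C * (1/2) ^ k * exp (2 * K * \<bar>t\<bar>) * (2 * (1 - (1/2)^m))" for k m t
  proof (induction m)
    case (Suc m)
    have "norm (p (k + Suc m) t - p k t) \<le> norm (p (Suc (k + m)) t - p (k+m) t) + norm (p (k + m) t - p k t)"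
      using norm_triangle_ineq[of "p (Suc (k + m)) t - p (k+m) t" "p (k + m) t - p k t"] by simp
    then show ?case using Suc step[of "k+m" t] by (simp add: algebra_simps power_add)
  qed simp
  have far2: "norm (p n t - p k t) \<le> 2 * C * (1/2) ^ k * exp (2 * K * \<bar>t\<bar>)" if "k \<le> n" for k n t
  proof -
    obtain m where "n = k + m" using \<open>k \<le> n\<close> le_Suc_ex by blast
    have "C * (1/2) ^ k * exp (2 * K * \<bar>t\<bar>) * (2 * (1 - (1/2)^m)) \<le> C * (1/2) ^ k * exp (2 * K * \<bar>t\<bar>) * 2"
      using C by (intro mult_left_mono) auto
    then show ?thesis using far[of k m t] \<open>n = k + m\<close> by simp
  qed
  have lim0: "(\<lambda>k. 2 * C * (1/2) ^ k * A) \<longlonglongrightarrow> 0" for A :: real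
    by (intro tendsto_mult_left_zero tendsto_mult_right_zero LIMSEQ_power_zero) auto
  have "Cauchy (\<lambda>k. p k t)" for t
  proof (rule CauchyI')
    fix e :: real assume "e > 0"
    from lim0[of "exp (2 * K * \<bar>t\<bar>)"] this obtain N where
      N: "\<forall>k\<ge>N. \<bar>2 * C * (1/2) ^ k * exp (2 * K * \<bar>t\<bar>) - 0\<bar> < e" unfolding LIMSEQ_def dist_real_def by blast
    have "norm (p m t - p n t) < e" if "N \<le> m" "m < n" for m n
      using far2[of m n t] N that by (force simp: norm_minus_commute)
    then show "\<exists>M. \<forall>m\<ge>M. \<forall>n>m. dist (p m t) (p n t) < e" unfolding dist_norm by blast
  qed
  then have "\<forall>t. \<exists>l. (\<lambda>k. p k t) \<longlonglongrightarrow> l"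
    using Cauchy_convergent_iff convergent_def by blast
  then have "\<exists>x. \<forall>t. (\<lambda>k. p k t) \<longlonglongrightarrow> x t" by (rule choice)
  then obtain x where x: "\<And>t. (\<lambda>k. p k t) \<longlonglongrightarrow> x t" by blast
  have xb: "norm (x t - p k t) \<le> 2 * C * (1/2) ^ k * exp (2 * K * \<bar>t\<bar>)" for k t
  proof (rule LIMSEQ_le_const2)
    show "(\<lambda>n. norm (p n t - p k t)) \<longlonglongrightarrow> norm (x t - p k t)" by (intro tendsto_intros x)
    show "\<exists>N. \<forall>n\<ge>N. norm (p n t - p k t) \<le> 2 * C * (1/2) ^ k * exp (2 * K * \<bar>t\<bar>)"
      using far2 by blast
  qed
  show thesis
  proof (rule that)
    show "x 0 = x0" using x[of 0] by (simp add: pz LIMSEQ_const_iff)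
    fix t :: real
    \<comment> \<open>On a bounded interval the exponential weight is bounded, so the derivatives
      \<open>X (p n s)\<close> converge uniformly and the limit may be differentiated term by
      term.\<close>
    define T :: real where "T = \<bar>t\<bar> + 1"
    have "\<exists>g. \<forall>s\<in>ball 0 T. (\<lambda>n. p (Suc n) s) \<longlonglongrightarrow> g s \<and>
       (g has_derivative (\<lambda>h. h *\<^sub>R X (x s))) (at s within ball 0 T)"
    proof (rule has_derivative_sequence[where f' = "\<lambda>n s h. h *\<^sub>R X (p n s)"])
      show "(p (Suc n) has_derivative (\<lambda>h. h *\<^sub>R X (p n s))) (at s within ball 0 T)" for n s
        using pder has_derivative_at_withinI unfolding has_vector_derivative_def by blast
      show "0 \<in> ball 0 T" by (simp add: T_def)
      show "(\<lambda>n. p (Suc n) 0) \<longlonglongrightarrow> x0" by (simp add: pz)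
      fix e :: real assume "e > 0"
      have "eventually (\<lambda>k. 2 * C * (1/2) ^ k * (K * exp (2 * K * T)) < e) sequentially"
        using lim0[of "K * exp (2 * K * T)"] \<open>e > 0\<close> by (rule order_tendstoD)
      then show "\<forall>\<^sub>F n in sequentially. \<forall>s\<in>ball 0 T. \<forall>h. norm (h *\<^sub>R X (p n s) - h *\<^sub>R X (x s)) \<le> e * norm h"
      proof (rule eventually_mono, intro ballI allI)
        fix k s h assume k: "2 * C * (1/2) ^ k * (K * exp (2 * K * T)) < e" and s: "s \<in> ball (0::real) T"
        have "norm (X (p k s) - X (x s)) \<le> K * (2 * C * (1/2) ^ k * exp (2 * K * \<bar>s\<bar>))"
          using order_trans[OF lip mult_left_mono[OF xb[of s k], of K]] K by (simp add: norm_minus_commute)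
        also have "\<dots> \<le> K * (2 * C * (1/2) ^ k * exp (2 * K * T))"
          using s K C by (intro mult_left_mono) auto
        also have "\<dots> \<le> e" using k by (simp add: algebra_simps)
        finally show "norm (h *\<^sub>R X (p k s) - h *\<^sub>R X (x s)) \<le> e * norm h"
          by (simp add: scaleR_diff_right[symmetric] mult.commute[of e] mult_left_mono)
      qed
    qed simp
    then obtain g where g: "\<And>s. s \<in> ball 0 T \<Longrightarrow> (\<lambda>n. p (Suc n) s) \<longlonglongrightarrow> g s"
      "\<And>s. s \<in> ball 0 T \<Longrightarrow> (g has_derivative (\<lambda>h. h *\<^sub>R X (x s))) (at s within ball 0 T)" by blast
    have gx: "g s = x s" if "s \<in> ball 0 T" for s
      using LIMSEQ_unique[OF g(1)[OF that] LIMSEQ_Suc[OF x]] .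
    have t: "t \<in> ball 0 T" by (simp add: T_def)
    have "(g has_derivative (\<lambda>h. h *\<^sub>R X (x t))) (at t)"
      using g(2)[OF t] t by (simp add: at_within_open[OF t])
    from has_derivative_transform_within_open[OF this open_ball t gx]
    show "(x has_vector_derivative X (x t)) (at t)" by (simp add: has_vector_derivative_def)
  qed
qed

text \<open>With d the difference, \<open>exp (- 2 * K * s) * (d s \<bullet> d s)\<close> does not
  increase. The estimate is assumed along the two curves only, so it serves fields that are
  Lipschitz merely on a ball, and nonautonomous equations.\<close>

lemma ode_dist_le:
  fixes x y :: "real \<Rightarrow> 'a::real_inner"
  assumes x: "\<And>s. (x has_vector_derivative x' s) (at s)"
    and y: "\<And>s. (y has_vector_derivative y' s) (at s)"
    and lip: "\<And>s. norm (x' s - y' s) \<le> K * norm (x s - y s)"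
  shows "norm (x t - y t) \<le> exp (K * \<bar>t\<bar>) * norm (x 0 - y 0)"
proof -
  have *: "norm (d t) \<le> exp (K * t) * norm (d 0)" if "t \<ge> 0"
    and d: "\<And>s. (d has_vector_derivative d' s) (at s)" and le: "\<And>s. norm (d' s) \<le> K * norm (d s)"
    for t d' and d :: "real \<Rightarrow> 'a"
  proof -
    define g where "g s = exp (- 2 * K * s) * (d s \<bullet> d s)" for s
    have dg: "(g has_real_derivative exp (- 2 * K * s) * (2 * (d s \<bullet> d' s) - 2 * K * (d s \<bullet> d s))) (at s)" for s
      unfolding g_def has_real_derivative_iff_has_vector_derivative
      using d[of s] unfolding has_vector_derivative_def
      by (auto intro!: derivative_eq_intros simp: fun_eq_iff algebra_simps inner_commute)
    have "g t \<le> g 0"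
    proof (rule DERIV_nonpos_imp_nonincreasing[OF \<open>t \<ge> 0\<close>])
      fix s
      have "d s \<bullet> d' s \<le> norm (d s) * (K * norm (d s))"
        using norm_cauchy_schwarz[of "d s" "d' s"] mult_left_mono[OF le[of s], of "norm (d s)"] by simp
      then have "exp (- 2 * K * s) * (2 * (d s \<bullet> d' s) - 2 * K * (d s \<bullet> d s)) \<le> 0"
        by (intro mult_nonneg_nonpos) (auto simp: power2_norm_eq_inner[symmetric] power2_eq_square algebra_simps)
      then show "\<exists>y. (g has_real_derivative y) (at s) \<and> y \<le> 0" using dg by blast
    qed
    then have "exp (2 * K * t) * g t \<le> exp (2 * K * t) * (d 0 \<bullet> d 0)" by (simp add: g_def)
    then have "(norm (d t))\<^sup>2 \<le> (exp (K * t) * norm (d 0))\<^sup>2"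
      by (simp add: g_def mult.assoc[symmetric] exp_add[symmetric] power_mult_distrib power2_norm_eq_inner
          exp_double[symmetric])
    then show ?thesis by (rule power2_le_imp_le) simp
  qed
  have d: "((\<lambda>s. x s - y s) has_vector_derivative x' s - y' s) (at s)" for s
    by (intro derivative_intros x y)
  show ?thesis
  proof (cases "t \<ge> 0")
    case True then show ?thesis using *[OF True d lip] by simp
  next
    case False
    have "((\<lambda>s. (\<lambda>s. x s - y s) (-1 * s + 0)) has_vector_derivative (-1) *\<^sub>R (x' (-s) - y' (-s))) (at s)" for s
      using vector_derivative_comp_affine[of "\<lambda>s. x s - y s" "x' (-s) - y' (-s)" "-1" s 0] d[of "-s"] by simp
    moreover have "norm ((-1) *\<^sub>R (x' (-s) - y' (-s))) \<le> K * norm (x (-1 * s + 0) - y (-1 * s + 0))" for s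
      using lip[of "-s"] by (simp add: norm_minus_commute)
    ultimately show ?thesis using *[of "-t" "\<lambda>s. x (-1 * s + 0) - y (-1 * s + 0)" "\<lambda>s. (-1) *\<^sub>R (x' (-s) - y' (-s))"] False by simp
  qed
qed

theorem Lipschitz_flow:
  fixes X :: "'a::euclidean_space \<Rightarrow> 'a"
  assumes lip: "\<And>x y. norm (X x - X y) \<le> K * norm (x - y)"
  obtains \<phi> :: "real \<Rightarrow> 'a \<Rightarrow> 'a" where "\<And>x. \<phi> 0 x = x"
    "\<And>x t. ((\<lambda>t. \<phi> t x) has_vector_derivative X (\<phi> t x)) (at t)"
    "\<And>s t x. \<phi> (s + t) x = \<phi> s (\<phi> t x)"
    "\<And>t x y. norm (\<phi> t x - \<phi> t y) \<le> exp (K * \<bar>t\<bar>) * norm (x - y)"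
proof -
  have "\<forall>x0. \<exists>x. x 0 = x0 \<and> (\<forall>t. (x has_vector_derivative X (x t)) (at t))"
    using Lipschitz_ode_solution[OF lip] by metis
  then obtain f where f: "\<And>x. f x 0 = x" "\<And>x t. (f x has_vector_derivative X (f x t)) (at t)" by metis
  have d: "norm (f x t - f y t) \<le> exp (K * \<bar>t\<bar>) * norm (x - y)" for x y t
    using ode_dist_le[of "f x" "\<lambda>t. X (f x t)" "f y" "\<lambda>t. X (f y t)" K t] lip f by simp
  have "f x (s + t) = f (f x t) s" for x s t
  proof -
    have "((\<lambda>s. f x (1 * s + t)) has_vector_derivative 1 *\<^sub>R X (f x (1 * s + t))) (at s)" for s
      by (rule vector_derivative_comp_affine) (use f in auto)
    then have "((\<lambda>s. f x (s + t)) has_vector_derivative X (f x (s + t))) (at s)" for s by simp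
    from ode_dist_le[OF this f(2)[of "f x t"], of K s] lip f(1)
    show ?thesis by simp
  qed
  then show thesis using that[of "\<lambda>t x. f x t"] f d by simp
qed

section \<open>Smooth functions and the exponential of a linear operator\<close>

lemma C_diff_on_SucD: "C_diff_on (Suc k) f S \<Longrightarrow> C_diff_on k f S"
proof (induction k arbitrary: f)
  case 0
  then obtain f' where "\<forall>x\<in>S. (f has_derivative f' x) (at x within S)" by auto
  then show ?case by (auto simp: continuous_on_eq_continuous_within intro: has_derivative_continuous)
next
  case (Suc k)
  from Suc.prems obtain f' where f': "\<forall>x\<in>S. (f has_derivative f' x) (at x within S)"
    "\<forall>v. C_diff_on (Suc k) (\<lambda>x. f' x v) S" by auto
  then have "\<forall>v. C_diff_on k (\<lambda>x. f' x v) S" using Suc.IH by blast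
  with f'(1) show ?case by auto
qed

lemma C_diff_on_const: "C_diff_on k (\<lambda>x. c) S"
proof (induction k arbitrary: c)
  case (Suc k)
  show ?case unfolding C_diff_on.simps using Suc by (intro exI[of _ "\<lambda>_ _. 0"]) auto
qed (auto intro: continuous_intros)

lemma C_diff_on_bounded_linear:
  assumes "bounded_linear f" shows "C_diff_on k f S"
proof (cases k)
  case 0 then show ?thesis using assms by (simp add: linear_continuous_on)
next
  case (Suc k')
  have "\<forall>x\<in>S. (f has_derivative f) (at x within S)"
    using assms bounded_linear_imp_has_derivative by blast
  then show ?thesis unfolding Suc C_diff_on.simps
    by (intro exI[of _ "\<lambda>_. f"]) (auto intro: C_diff_on_const)
qed

lemma C_diff_on_add: "C_diff_on k f S \<Longrightarrow> C_diff_on k g S \<Longrightarrow> C_diff_on k (\<lambda>x. f x + g x) S"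
proof (induction k arbitrary: f g)
  case 0 then show ?case by (auto intro: continuous_intros)
next
  case (Suc k)
  from Suc.prems obtain f' g' where "\<forall>x\<in>S. (f has_derivative f' x) (at x within S)"
    "\<forall>v. C_diff_on k (\<lambda>x. f' x v) S" "\<forall>x\<in>S. (g has_derivative g' x) (at x within S)"
    "\<forall>v. C_diff_on k (\<lambda>x. g' x v) S" by auto
  then show ?case unfolding C_diff_on.simps
    by (intro exI[of _ "\<lambda>x v. f' x v + g' x v"]) (auto intro!: Suc.IH has_derivative_add)
qed

lemma C_diff_on_sum:
  "(\<And>i. i \<in> I \<Longrightarrow> C_diff_on k (f i) S) \<Longrightarrow> C_diff_on k (\<lambda>x. \<Sum>i\<in>I. f i x) S"
  by (induction I rule: infinite_finite_induct) (auto intro: C_diff_on_const C_diff_on_add)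

lemma (in bounded_bilinear) C_diff_on_prod:
  "C_diff_on k f S \<Longrightarrow> C_diff_on k g S \<Longrightarrow> C_diff_on k (\<lambda>x. prod (f x) (g x)) S"
proof (induction k arbitrary: f g)
  case 0 then show ?case by (auto intro: continuous_on)
next
  case (Suc k)
  from Suc.prems obtain f' g' where *: "\<forall>x\<in>S. (f has_derivative f' x) (at x within S)"
    "\<forall>v. C_diff_on k (\<lambda>x. f' x v) S" "\<forall>x\<in>S. (g has_derivative g' x) (at x within S)"
    "\<forall>v. C_diff_on k (\<lambda>x. g' x v) S" by auto
  have "C_diff_on k f S" "C_diff_on k g S" using Suc.prems C_diff_on_SucD by blast+
  with * show ?case unfolding C_diff_on.simps
    by (intro exI[of _ "\<lambda>x v. prod (f x) (g' x v) + prod (f' x v) (g x)"])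
      (auto intro!: Suc.IH FDERIV C_diff_on_add)
qed

text \<open>\<open>C_diff_on\<close> controls \<open>f' x v\<close> for fixed v, while in the chain
  rule the argument of \<open>f'\<close> moves with x. Expanding that argument in
  \<open>Basis\<close> makes the derivative a finite sum of products covered by the induction
  hypothesis.\<close>

lemma C_diff_on_compose:
  fixes g :: "'a::euclidean_space \<Rightarrow> 'b::euclidean_space" and f :: "'b \<Rightarrow> 'c::real_normed_vector"
  shows "C_diff_on k f T \<Longrightarrow> C_diff_on k g S \<Longrightarrow> g ` S \<subseteq> T \<Longrightarrow> C_diff_on k (\<lambda>x. f (g x)) S"
proof (induction k arbitrary: f)
  case 0 then show ?case by (auto intro: continuous_on_compose2)
next
  case (Suc k)
  from Suc.prems obtain f' g' where *: "\<forall>x\<in>T. (f has_derivative f' x) (at x within T)"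
    "\<forall>v. C_diff_on k (\<lambda>x. f' x v) T" "\<forall>x\<in>S. (g has_derivative g' x) (at x within S)"
    "\<forall>v. C_diff_on k (\<lambda>x. g' x v) S" by auto
  have gk: "C_diff_on k g S" using Suc.prems C_diff_on_SucD by blast
  have "((\<lambda>x. f (g x)) has_derivative (\<lambda>v. \<Sum>b\<in>Basis. (g' x v \<bullet> b) *\<^sub>R f' (g x) b)) (at x within S)"
    if "x \<in> S" for x
  proof -
    have f: "(f has_derivative f' (g x)) (at (g x) within T)" using * Suc.prems that by auto
    have "linear (f' (g x))" using f has_derivative_linear by blast
    then have eq: "f' (g x) v = (\<Sum>b\<in>Basis. (v \<bullet> b) *\<^sub>R f' (g x) b)" for v
      by (subst euclidean_representation[of v, symmetric]) (simp add: linear_sum linear_scale)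
    have "(\<lambda>v. f' (g x) (g' x v)) = (\<lambda>v. \<Sum>b\<in>Basis. (g' x v \<bullet> b) *\<^sub>R f' (g x) b)"
      by (intro ext) (rule eq)
    moreover have "((\<lambda>x. f (g x)) has_derivative (\<lambda>v. f' (g x) (g' x v))) (at x within S)"
      by (rule has_derivative_in_compose2[of T f f']) (use * Suc.prems that in auto)
    ultimately show ?thesis by (simp only:)
  qed
  moreover have "C_diff_on k (\<lambda>x. \<Sum>b\<in>Basis. (g' x v \<bullet> b) *\<^sub>R f' (g x) b) S" for v
    by (intro C_diff_on_sum bounded_bilinear.C_diff_on_prod[OF bounded_bilinear_scaleR]
        bounded_bilinear.C_diff_on_prod[OF bounded_bilinear_inner] C_diff_on_const Suc.IH)
      (use * gk Suc.prems in auto)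
  ultimately show ?case unfolding C_diff_on.simps
    by (intro exI[of _ "\<lambda>x v. \<Sum>b\<in>Basis. (g' x v \<bullet> b) *\<^sub>R f' (g x) b"]) auto
qed

lemma C_diff_on_vector_derivative:
  fixes x :: "real \<Rightarrow> 'a::real_normed_vector"
  assumes "\<And>t. (x has_vector_derivative x' t) (at t)" "C_diff_on k x' UNIV"
  shows "C_diff_on (Suc k) x UNIV"
  using assms unfolding C_diff_on.simps has_vector_derivative_def
  by (intro exI[of _ "\<lambda>t h. h *\<^sub>R x' t"])
    (auto intro!: bounded_bilinear.C_diff_on_prod[OF bounded_bilinear_scaleR] C_diff_on_const)

lemma C_diff_on_SucE_real:
  fixes x :: "real \<Rightarrow> 'a::real_normed_vector"
  assumes "C_diff_on (Suc k) x UNIV"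
  obtains x' where "\<And>t. (x has_vector_derivative x' t) (at t)" "C_diff_on k x' UNIV"
proof -
  from assms obtain f' where f: "\<forall>t. (x has_derivative f' t) (at t)" "\<forall>v. C_diff_on k (\<lambda>t. f' t v) UNIV"
    by auto
  have "(x has_vector_derivative f' t 1) (at t)" for t
  proof -
    have "f' t h = h *\<^sub>R f' t 1" for h
      using linear_scale[OF has_derivative_linear[OF f(1)[rule_format, of t]], of h 1] by simp
    then have eq: "f' t = (\<lambda>h. h *\<^sub>R f' t 1)" by (rule ext)
    show ?thesis using f(1)[rule_format, of t] by (simp only: has_vector_derivative_def eq[symmetric])
  qed
  then show thesis by (rule that) (use f(2) in blast)
qed

text \<open>Bootstrapping: if x is of class k, so is \<open>X (x t)\<close>, which is the derivative
  of x.\<close>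

lemma ode_solution_C_diff_on:
  fixes x :: "real \<Rightarrow> 'a::euclidean_space"
  assumes x: "\<And>t. (x has_vector_derivative X (x t)) (at t)" "\<And>t. x t \<in> T"
    and X: "\<And>k. C_diff_on k X T"
  shows "C_diff_on k x UNIV"
proof (induction k)
  case 0
  show ?case using x(1) by (auto simp: continuous_on_eq_continuous_at intro: has_vector_derivative_continuous)
next
  case (Suc k)
  show ?case
    by (rule C_diff_on_vector_derivative[OF x(1) C_diff_on_compose[OF X Suc]]) (use x in auto)
qed

section \<open>The exponential of a linear operator\<close>

context
  fixes L :: "'a::euclidean_space \<Rightarrow> 'a"
  assumes L: "linear L"
begin

abbreviation lexp :: "real \<Rightarrow> 'a \<Rightarrow> 'a" where "lexp u \<equiv> lin_exp (\<lambda>v. u *\<^sub>R L v)"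

lemma summable_norm_lin_exp: "summable (\<lambda>k. norm (u ^ k *\<^sub>R ((L ^^ k) x /\<^sub>R fact k)))"
proof (rule summable_comparison_test')
  have *: "norm ((L ^^ k) x) \<le> onorm L ^ k * norm x" for k
  proof (induction k)
    case (Suc k)
    have "norm (L ((L ^^ k) x)) \<le> onorm L * norm ((L ^^ k) x)"
      using L by (intro onorm) (simp add: linear_conv_bounded_linear)
    then show ?case
      using Suc mult_left_mono[OF Suc, of "onorm L"] onorm_pos_le[of L] L
      by (simp add: linear_conv_bounded_linear mult.assoc)
  qed simp
  show "summable (\<lambda>k. norm x * ((onorm L * \<bar>u\<bar>) ^ k /\<^sub>R fact k))"
    by (intro summable_mult summable_exp_generic)
  show "norm (norm (u ^ k *\<^sub>R ((L ^^ k) x /\<^sub>R fact k))) \<le> norm x * ((onorm L * \<bar>u\<bar>) ^ k /\<^sub>R fact k)" for k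
    using mult_left_mono[OF *[of k], of "\<bar>u\<bar> ^ k / fact k"]
    by (simp add: power_abs power_mult_distrib field_simps)
qed

lemma lin_exp_scaled: "lexp u x = (\<Sum>k. u ^ k *\<^sub>R ((L ^^ k) x /\<^sub>R fact k))"
proof -
  have "((\<lambda>v. u *\<^sub>R L v) ^^ k) x = u ^ k *\<^sub>R (L ^^ k) x" for k
    by (induction k) (auto simp: linear_scale[OF L])
  then show ?thesis by (simp add: lin_exp_def mult.commute)
qed

lemma lin_exp_sums: "(\<lambda>k. u ^ k *\<^sub>R ((L ^^ k) x /\<^sub>R fact k)) sums lexp u x"
  unfolding lin_exp_scaled by (rule summable_sums[OF summable_norm_cancel[OF summable_norm_lin_exp]])

lemma lin_exp_0: "lexp 0 x = x"
proof -
  have "(\<lambda>k. 0 ^ k *\<^sub>R ((L ^^ k) x /\<^sub>R fact k)) sums (0 ^ 0 *\<^sub>R ((L ^^ 0) x /\<^sub>R fact 0))"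
    using sums_finite[of "{0}" "\<lambda>k. 0 ^ k *\<^sub>R ((L ^^ k) x /\<^sub>R fact k)"] by (simp add: power_0_left)
  then show ?thesis using sums_unique2[OF lin_exp_sums] by fastforce
qed

lemma linear_funpow: "linear (L ^^ k)"
  by (induction k) (auto simp: linear_compose[OF _ L, unfolded o_def] comp_def linear_id[unfolded id_def])

lemma linear_lin_exp: "linear (lexp u)"
proof (rule linearI)
  fix x y and c :: real
  show "lexp u (x + y) = lexp u x + lexp u y"
    using sums_unique2[OF lin_exp_sums[of u "x + y"]] sums_add[OF lin_exp_sums[of u x] lin_exp_sums[of u y]]
    by (simp add: linear_add[OF linear_funpow] scaleR_add_right)
  show "lexp u (c *\<^sub>R x) = c *\<^sub>R lexp u x"
    using sums_unique2[OF lin_exp_sums[of u "c *\<^sub>R x"]] sums_scaleR_right[OF lin_exp_sums[of u x], of c]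
    by (simp add: linear_scale[OF linear_funpow] mult_ac)
qed

lemma lin_exp_commute: "L (lexp u x) = lexp u (L x)"
proof -
  have "(\<lambda>k. L (u ^ k *\<^sub>R ((L ^^ k) x /\<^sub>R fact k))) sums L (lexp u x)"
    using L by (intro bounded_linear.sums[OF _ lin_exp_sums]) (simp add: linear_conv_bounded_linear)
  then show ?thesis
    using sums_unique2[OF lin_exp_sums[of u "L x"]]
    by (simp add: linear_scale[OF L] funpow_swap1)
qed

text \<open>Each component is a scalar power series in u that converges everywhere, so termwise
  differentiation applies.\<close>

lemma has_vector_derivative_lin_exp:
  "((\<lambda>u. lexp u x) has_vector_derivative lexp u (L x)) (at u)"
  unfolding has_vector_derivative_def
proof (subst has_derivative_componentwise_within, intro ballI)
  fix b :: 'a assume "b \<in> Basis"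
  define c where "c k = ((L ^^ k) x \<bullet> b) / fact k" for k
  have sums: "(\<lambda>k. c k * u ^ k) sums (lexp u x \<bullet> b)" for u
    using bounded_linear.sums[OF bounded_linear_inner_left lin_exp_sums[of u x], of b]
    by (simp add: c_def field_simps)
  have "(\<lambda>k. diffs c k * u ^ k) sums (lexp u (L x) \<bullet> b)"
    using bounded_linear.sums[OF bounded_linear_inner_left lin_exp_sums[of u "L x"], of b]
    by (simp add: c_def diffs_def field_simps funpow_swap1 del: of_nat_Suc)
  then have deq: "(\<Sum>k. diffs c k * u ^ k) = lexp u (L x) \<bullet> b" by (rule sums_unique[symmetric])
  have "DERIV (\<lambda>u. \<Sum>k. c k * u ^ k) u :> (\<Sum>k. diffs c k * u ^ k)"
    by (rule termdiffs_strong_converges_everywhere) (use sums sums_summable in blast)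
  moreover have "(\<lambda>u. \<Sum>k. c k * u ^ k) = (\<lambda>u. lexp u x \<bullet> b)"
    using sums_unique[OF sums] by (simp add: fun_eq_iff)
  ultimately have "DERIV (\<lambda>u. lexp u x \<bullet> b) u :> lexp u (L x) \<bullet> b" by (simp add: deq)
  then show "((\<lambda>u. lexp u x \<bullet> b) has_derivative (\<lambda>h. (h *\<^sub>R lexp u (L x)) \<bullet> b)) (at u)"
    by (simp add: has_field_derivative_def mult.commute[of _ "lexp u (L x) \<bullet> b"])
qed

text \<open>Separates the time from the vector, so that rules for curves u(t) and x(t) reduce to
  products of scalar functions with curves \<open>lexp (u t) b\<close>.\<close>

lemma lin_exp_expand: "lexp u x = (\<Sum>b\<in>Basis. (x \<bullet> b) *\<^sub>R lexp u b)"
  by (subst euclidean_representation[of x, symmetric])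
    (simp only: linear_sum[OF linear_lin_exp] linear_scale[OF linear_lin_exp])

lemma has_vector_derivative_lin_exp_comp:
  fixes u :: "real \<Rightarrow> real"
  assumes "(u has_vector_derivative u') (at t)" "(x has_vector_derivative x') (at t)"
  shows "((\<lambda>t. lexp (u t) (x t)) has_vector_derivative u' *\<^sub>R lexp (u t) (L (x t)) + lexp (u t) x') (at t)"
proof -
  have "((\<lambda>t. lexp (u t) b) has_vector_derivative u' *\<^sub>R lexp (u t) (L b)) (at t)" for b
    using vector_diff_chain_at[OF assms(1) has_vector_derivative_lin_exp] by (simp add: o_def)
  moreover have "((\<lambda>t. x t \<bullet> b) has_real_derivative x' \<bullet> b) (at t)" for b
    unfolding has_real_derivative_iff_has_vector_derivative
    using assms(2) by (rule bounded_linear.has_vector_derivative[OF bounded_linear_inner_left])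
  ultimately have "((\<lambda>t. \<Sum>b\<in>Basis. (x t \<bullet> b) *\<^sub>R lexp (u t) b) has_vector_derivative
     (\<Sum>b\<in>Basis. (x t \<bullet> b) *\<^sub>R (u' *\<^sub>R lexp (u t) (L b)) + (x' \<bullet> b) *\<^sub>R lexp (u t) b)) (at t)"
    by (intro has_vector_derivative_sum has_vector_derivative_scaleR) auto
  moreover have "(\<Sum>b\<in>Basis. (x t \<bullet> b) *\<^sub>R (u' *\<^sub>R lexp (u t) (L b))) = u' *\<^sub>R lexp (u t) (L (x t))"
  proof -
    have "(\<Sum>b\<in>Basis. (x t \<bullet> b) *\<^sub>R (u' *\<^sub>R lexp (u t) (L b))) = u' *\<^sub>R L (\<Sum>b\<in>Basis. (x t \<bullet> b) *\<^sub>R lexp (u t) b)"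
      by (simp add: linear_sum[OF L] linear_scale[OF L] lin_exp_commute scaleR_sum_right mult.commute)
    then show ?thesis by (simp add: lin_exp_expand[symmetric] lin_exp_commute)
  qed
  ultimately show ?thesis
    by (simp add: sum.distrib lin_exp_expand[symmetric])
qed

text \<open>The derivative is a combination of curves of the same shape, with \<open>L (x t)\<close>
  and \<open>x' t\<close> in place of \<open>x t\<close>; hence the induction over k for arbitrary
  x.\<close>

lemma C_diff_on_lin_exp:
  fixes u :: "real \<Rightarrow> real"
  shows "C_diff_on k u UNIV \<Longrightarrow> C_diff_on k x UNIV \<Longrightarrow> C_diff_on k (\<lambda>t. lexp (u t) (x t)) UNIV"
proof (induction k arbitrary: x)
  case 0
  have "continuous_on UNIV (\<lambda>u. lexp u b)" for b
    using has_vector_derivative_lin_exp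
    by (auto simp: continuous_on_eq_continuous_at intro: has_vector_derivative_continuous)
  then have "continuous_on UNIV (\<lambda>t. lexp (u t) b)" for b
    using continuous_on_compose2[of UNIV "\<lambda>u. lexp u b" UNIV u] 0 by simp
  then have "continuous_on UNIV (\<lambda>t. \<Sum>b\<in>Basis. (x t \<bullet> b) *\<^sub>R lexp (u t) b)"
    using 0 by (intro continuous_intros) auto
  then show ?case by (simp add: lin_exp_expand[symmetric])
next
  case (Suc k)
  from Suc.prems obtain u' x' where *: "\<And>t. (u has_vector_derivative u' t) (at t)" "C_diff_on k u' UNIV"
    "\<And>t. (x has_vector_derivative x' t) (at t)" "C_diff_on k x' UNIV"
    using C_diff_on_SucE_real by metis
  have uk: "C_diff_on k u UNIV" and xk: "C_diff_on k x UNIV" using Suc.prems C_diff_on_SucD by blast+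
  have "C_diff_on k (\<lambda>t. L (x t)) UNIV"
    by (rule C_diff_on_compose[OF C_diff_on_bounded_linear xk]) (use L in \<open>auto simp: linear_conv_bounded_linear\<close>)
  then have "C_diff_on k (\<lambda>t. u' t *\<^sub>R lexp (u t) (L (x t)) + lexp (u t) (x' t)) UNIV"
    by (intro C_diff_on_add bounded_bilinear.C_diff_on_prod[OF bounded_bilinear_scaleR] Suc.IH * uk)
  from C_diff_on_vector_derivative[OF has_vector_derivative_lin_exp_comp[OF *(1) *(3)] this]
  show ?case .
qed

end

section \<open>Expansion along an unstable direction\<close>

text \<open>One direction v serves all starting points and all h > 0. Consequently the set of points
  whose forward orbits stay in a bounded part of \<open>\<Omega>\<close> has no interior: a ball
  inside it would contain two points that differ by a multiple of v.\<close>

definition expanding :: "('a::real_normed_vector \<Rightarrow> 'a) \<Rightarrow> 'a set \<Rightarrow> bool" where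
  "expanding G \<Omega> \<longleftrightarrow> (\<exists>v. \<forall>h>0. \<forall>y z :: real \<Rightarrow> 'a.
     (\<forall>s\<ge>0. (y has_vector_derivative G (y s)) (at s) \<and> y s \<in> \<Omega>) \<longrightarrow>
     (\<forall>s\<ge>0. (z has_vector_derivative G (z s)) (at s) \<and> z s \<in> \<Omega>) \<longrightarrow>
     y 0 - z 0 = h *\<^sub>R v \<longrightarrow> bounded (y ` {0..}) \<longrightarrow> bounded (z ` {0..}) \<longrightarrow> False)"

lemma eigenvectors_distinct_independent:
  fixes A :: "'a::real_vector \<Rightarrow> 'a"
  assumes A: "linear A" and "finite S"
    and v: "\<And>m. m \<in> S \<Longrightarrow> v m \<noteq> 0 \<and> A (v m) = m *\<^sub>R v m"
  shows "(\<Sum>m\<in>S. c m *\<^sub>R v m) = 0 \<Longrightarrow> \<forall>m\<in>S. c m = 0"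
  using \<open>finite S\<close> v
proof (induction S arbitrary: c rule: finite_induct)
  case (insert k S)
  have 0: "c k *\<^sub>R v k + (\<Sum>m\<in>S. c m *\<^sub>R v m) = 0" using insert by simp
  then have "A (c k *\<^sub>R v k + (\<Sum>m\<in>S. c m *\<^sub>R v m)) = 0" by (simp add: linear_0[OF A])
  then have "(c k * k) *\<^sub>R v k + (\<Sum>m\<in>S. (c m * m) *\<^sub>R v m) = 0"
    using insert.prems by (simp add: linear_add[OF A] linear_sum[OF A] linear_scale[OF A])
  moreover have "(c k * k) *\<^sub>R v k + (\<Sum>m\<in>S. (c m * k) *\<^sub>R v m) = 0"
    using arg_cong[OF 0, of "\<lambda>x. k *\<^sub>R x"] by (simp add: scaleR_add_right scaleR_sum_right mult.commute)
  ultimately have "(\<Sum>m\<in>S. (c m * m) *\<^sub>R v m) - (\<Sum>m\<in>S. (c m * k) *\<^sub>R v m) = 0"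
    by (simp add: add_eq_0_iff)
  moreover have "(\<Sum>m\<in>S. (c m * (m - k)) *\<^sub>R v m)
      = (\<Sum>m\<in>S. (c m * m) *\<^sub>R v m) - (\<Sum>m\<in>S. (c m * k) *\<^sub>R v m)"
    by (simp add: sum_subtractf scaleR_diff_left right_diff_distrib)
  ultimately have "(\<Sum>m\<in>S. (c m * (m - k)) *\<^sub>R v m) = 0" by simp
  then have "\<forall>m\<in>S. c m * (m - k) = 0"
    by (intro insert.IH[of "\<lambda>m. c m * (m - k)"]) (use insert.prems in auto)
  then have *: "\<forall>m\<in>S. c m = 0" using insert.hyps by auto
  with 0 have "c k *\<^sub>R v k = 0" by simp
  with * insert.prems show ?case by auto
qed simp

text \<open>Otherwise \<open>DIM('a) + 1\<close> numbers of the interval would be eigenvalues, with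
  independent eigenvectors.\<close>

lemma ex_non_eigenvalue:
  fixes A :: "'a::euclidean_space \<Rightarrow> 'a"
  assumes A: "linear A" and "a < b"
  obtains m where "a < m" "m < b" "inj (\<lambda>x. A x - m *\<^sub>R x)"
proof -
  have "\<exists>m. a < m \<and> m < b \<and> inj (\<lambda>x. A x - m *\<^sub>R x)"
  proof (rule ccontr)
    assume contra: "\<not> ?thesis"
    have "\<exists>v. v \<noteq> 0 \<and> A v = m *\<^sub>R v" if m: "a < m" "m < b" for m
    proof -
      have "linear (\<lambda>x. A x - m *\<^sub>R x)" by (intro linear_compose_sub A linear_scaleR)
      moreover have "\<not> inj (\<lambda>x. A x - m *\<^sub>R x)" using contra m by blast
      ultimately show ?thesis by (auto simp: linear_injective_0)
    qed
    then obtain v where v: "\<And>m. a < m \<Longrightarrow> m < b \<Longrightarrow> v m \<noteq> 0 \<and> A (v m) = m *\<^sub>R v m" by metis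
    obtain S where S: "finite S" "card S = Suc DIM('a)" "S \<subseteq> {a<..<b}"
      using infinite_arbitrarily_large[OF infinite_Ioo[OF \<open>a < b\<close>]] by blast
    have vS: "v m \<noteq> 0 \<and> A (v m) = m *\<^sub>R v m" if "m \<in> S" for m using v that S by auto
    have inj: "inj_on v S"
    proof (rule inj_onI)
      fix m k assume mk: "m \<in> S" "k \<in> S" "v m = v k"
      then have "m *\<^sub>R v m = k *\<^sub>R v m" using vS by metis
      then show "m = k" using vS mk by simp
    qed
    have "independent (v ` S)"
    proof
      assume "dependent (v ` S)"
      then obtain u where u: "\<exists>x\<in>v ` S. u x \<noteq> 0" "(\<Sum>x\<in>v ` S. u x *\<^sub>R x) = 0"
        using dependent_finite[of "v ` S"] S by auto
      then have "(\<Sum>m\<in>S. u (v m) *\<^sub>R v m) = 0" by (simp add: sum.reindex[OF inj])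
      from eigenvectors_distinct_independent[OF A S(1) vS this] u(1) show False by auto
    qed
    from independent_bound[OF this] S inj show False by (simp add: card_image)
  qed
  then show thesis using that by blast
qed

text \<open>Solves the Lyapunov equation \<open>P (F - \<mu>) + (F - \<mu>)\<^sup>T P = 1\<close>, which is possible unless \<open>2 \<mu>\<close> is one of
  the finitely many real eigenvalues of \<open>P \<mapsto> P F + F\<^sup>T P\<close>. Testing it on an eigenvector
  shows that the quadratic form of \<open>P\<close> takes positive values.\<close>
lemma unstable_eigenvalue_quadratic_form:
  fixes F :: "real^'n^'n"
  assumes "complex_eigenvalue F z" "Re z > 0"
  obtains \<mu> P v where "\<mu> > 0" "(P *v v) \<bullet> v > 0"
    "\<And>x. (P *v (F *v x)) \<bullet> x + (P *v x) \<bullet> (F *v x) = x \<bullet> x + 2 * \<mu> * ((P *v x) \<bullet> x)"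
proof -
  define A where "A P = P ** F + transpose F ** P" for P :: "real^'n^'n"
  have A: "linear A" unfolding A_def
    by (rule linearI) (simp_all add: vec_eq_iff matrix_matrix_mult_def sum.distrib sum_distrib_left
        algebra_simps)
  \<comment> \<open>Here m is 2 \<mu>. That it is positive gives exponential growth; that it is
    below \<open>2 * Re z\<close> makes the eigenvector test at the end come out positive.\<close>
  obtain m where m: "0 < m" "m < 2 * Re z" "inj (\<lambda>P. A P - m *\<^sub>R P)"
    using ex_non_eigenvalue[OF A, of 0 "2 * Re z"] assms by auto
  have "surj (\<lambda>P. A P - m *\<^sub>R P)"
    by (rule linear_inj_imp_surj[OF linear_compose_sub[OF A linear_scaleR] m(3)])
  then obtain P where "mat 1 = A P - m *\<^sub>R P" by (rule surjE)
  then have P: "A P - m *\<^sub>R P = mat 1" by (rule sym)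
  have eq: "(P *v (F *v x)) \<bullet> x + (P *v x) \<bullet> (F *v x) = x \<bullet> x + 2 * (m / 2) * ((P *v x) \<bullet> x)" for x
  proof -
    have "(A P - m *\<^sub>R P) *v x = x" by (simp add: P)
    then have "A P *v x - m *\<^sub>R (P *v x) = x"
      by (simp add: matrix_vector_mult_diff_rdistrib scaleR_matrix_vector_assoc[symmetric])
    from arg_cong[OF this, of "\<lambda>y. y \<bullet> x"]
    have "(A P *v x) \<bullet> x - m * ((P *v x) \<bullet> x) = x \<bullet> x" by (simp add: inner_diff_left)
    moreover have "(A P *v x) \<bullet> x = (P *v (F *v x)) \<bullet> x + (P *v x) \<bullet> (F *v x)"
      by (simp add: A_def matrix_vector_mult_add_rdistrib inner_add_left matrix_vector_mul_assoc[symmetric]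
          dot_lmul_matrix)
    ultimately show ?thesis by simp
  qed
  from assms(1) obtain w :: "complex^'n" where w: "w \<noteq> 0"
    "(\<chi> i j. complex_of_real (F $ i $ j)) *v w = z *s w" unfolding complex_eigenvalue_def by blast
  define a where "a = (\<chi> i. Re (w $ i))"
  define b where "b = (\<chi> i. Im (w $ i))"
  have wi: "(\<Sum>j\<in>UNIV. complex_of_real (F $ i $ j) * w $ j) = z * w $ i" for i
    using arg_cong[OF w(2), of "\<lambda>v. v $ i"] by (simp add: matrix_vector_mult_def)
  have Fa: "F *v a = Re z *\<^sub>R a - Im z *\<^sub>R b"
  proof (rule vec_eq_iff[THEN iffD2], rule allI)
    fix i show "(F *v a) $ i = (Re z *\<^sub>R a - Im z *\<^sub>R b) $ i"
      using arg_cong[OF wi[of i], of Re] by (simp add: matrix_vector_mult_def a_def b_def)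
  qed
  have Fb: "F *v b = Re z *\<^sub>R b + Im z *\<^sub>R a"
  proof (rule vec_eq_iff[THEN iffD2], rule allI)
    fix i show "(F *v b) $ i = (Re z *\<^sub>R b + Im z *\<^sub>R a) $ i"
      using arg_cong[OF wi[of i], of Im] by (simp add: matrix_vector_mult_def a_def b_def)
  qed
  have "a \<noteq> 0 \<or> b \<noteq> 0"
    using w(1) by (auto simp: a_def b_def vec_eq_iff complex_eq_iff)
  then have pos: "a \<bullet> a + b \<bullet> b > 0" by (auto simp: add_pos_nonneg add_nonneg_pos)
  \<comment> \<open>Adding the identities for the real part a and the imaginary part b of the
    eigenvector cancels the mixed terms with \<open>Im z\<close>.\<close>
  have "2 * Re z * ((P *v a) \<bullet> a + (P *v b) \<bullet> b) =
     (a \<bullet> a + m * ((P *v a) \<bullet> a)) + (b \<bullet> b + m * ((P *v b) \<bullet> b))"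
    using eq[of a] eq[of b]
    by (simp add: Fa Fb matrix_vector_mult_diff_distrib matrix_vector_right_distrib
        matrix_vector_mult_scaleR inner_diff_left inner_diff_right inner_add_left inner_add_right algebra_simps)
  then have "(2 * Re z - m) * ((P *v a) \<bullet> a + (P *v b) \<bullet> b) = a \<bullet> a + b \<bullet> b"
    by (simp add: algebra_simps)
  then have "(P *v a) \<bullet> a + (P *v b) \<bullet> b > 0"
    using pos m(2) by (metis diff_gt_0_iff_gt zero_less_mult_pos)
  then have "\<exists>v. (P *v v) \<bullet> v > 0" by (metis add_nonpos_nonpos not_less)
  then show thesis using that[of "m / 2" P] eq m(1) by auto
qed

text \<open>The perturbation adds at most |d|^2 to the derivative of the form along a difference d,
  and the right-hand side of the Lyapunov equation contains exactly this term to spare. What remains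
  is Q' \<ge> 2 \<mu> Q. The bound \<open>\<epsilon>\<close> depends on F only and is uniform in G
  and \<open>\<Omega>\<close>.\<close>

lemma unstable_eigenvalue_expanding:
  fixes F :: "real^'n^'n"
  assumes "complex_eigenvalue F z" "Re z > 0"
  shows "\<exists>\<epsilon>>0. \<forall>G \<Omega>. (\<forall>x\<in>\<Omega>. \<forall>y\<in>\<Omega>. norm ((G x - F *v x) - (G y - F *v y)) \<le> \<epsilon> * norm (x - y))
      \<longrightarrow> expanding G \<Omega>"
proof -
  obtain \<mu> P v where \<mu>: "\<mu> > 0" and v: "(P *v v) \<bullet> v > 0"
    and P: "\<And>x. (P *v (F *v x)) \<bullet> x + (P *v x) \<bullet> (F *v x) = x \<bullet> x + 2 * \<mu> * ((P *v x) \<bullet> x)"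
    using unstable_eigenvalue_quadratic_form[OF assms] by blast
  define p where "p = onorm ((*v) P)"
  have p: "norm (P *v x) \<le> p * norm x" for x
    unfolding p_def by (rule onorm) (simp add: matrix_vector_mul_bounded_linear)
  have p0: "p \<ge> 0" unfolding p_def by (rule onorm_pos_le) (simp add: matrix_vector_mul_bounded_linear)
  \<comment> \<open>The two perturbation terms are at most \<open>p * \<epsilon>\<close> |d|^2 each,
    so \<open>2 * p * \<epsilon>\<close> must not exceed 1; the summand 1 keeps the denominator
    positive.\<close>
  define \<epsilon> where "\<epsilon> = 1 / (2 * p + 1)"
  have \<epsilon>: "\<epsilon> > 0" "2 * p * \<epsilon> \<le> 1" using p0 by (auto simp: \<epsilon>_def field_simps)
  show ?thesis
  proof (intro exI[of _ \<epsilon>] conjI \<epsilon>(1) allI impI)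
    fix G \<Omega> assume G: "\<forall>x\<in>\<Omega>. \<forall>y\<in>\<Omega>. norm ((G x - F *v x) - (G y - F *v y)) \<le> \<epsilon> * norm (x - y)"
    show "expanding G \<Omega>" unfolding expanding_def
    proof (intro exI[of _ v] allI impI)
      fix h :: real and y z :: "real \<Rightarrow> real^'n"
      assume "h > 0" and y: "\<forall>s\<ge>0. (y has_vector_derivative G (y s)) (at s) \<and> y s \<in> \<Omega>"
        and z: "\<forall>s\<ge>0. (z has_vector_derivative G (z s)) (at s) \<and> z s \<in> \<Omega>"
        and yz: "y 0 - z 0 = h *\<^sub>R v" and bdy: "bounded (y ` {0..})" and bz: "bounded (z ` {0..})"
      define d where "d s = y s - z s" for s
      define d' where "d' s = G (y s) - G (z s)" for s
      define Q where "Q s = (P *v d s) \<bullet> d s" for s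
      have dd: "(d has_vector_derivative d' s) (at s)" if "s \<ge> 0" for s
        unfolding d_def d'_def using y z that by (intro derivative_intros) auto
      have dQ: "(Q has_real_derivative (P *v d' s) \<bullet> d s + (P *v d s) \<bullet> d' s) (at s)" if "s \<ge> 0" for s
      proof -
        have "((\<lambda>s. P *v d s) has_vector_derivative P *v d' s) (at s)"
          by (rule bounded_linear.has_vector_derivative[OF _ dd[OF that]]) (simp add: matrix_vector_mul_bounded_linear)
        from bounded_bilinear.has_vector_derivative[OF bounded_bilinear_inner this dd[OF that]]
        show ?thesis unfolding Q_def has_real_derivative_iff_has_vector_derivative by (simp add: add.commute)
      qed
      have Q': "(P *v d' s) \<bullet> d s + (P *v d s) \<bullet> d' s \<ge> 2 * \<mu> * Q s" if "s \<ge> 0" for s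
      proof -
        define g where "g = d' s - F *v d s"
        have g: "norm g \<le> \<epsilon> * norm (d s)"
          using G[rule_format, of "y s" "z s"] y z that
          by (simp add: g_def d'_def d_def matrix_vector_mult_diff_distrib algebra_simps)
        have "(P *v d' s) \<bullet> d s + (P *v d s) \<bullet> d' s =
           (P *v (F *v d s)) \<bullet> d s + (P *v d s) \<bullet> (F *v d s) + ((P *v g) \<bullet> d s + (P *v d s) \<bullet> g)"
          by (simp add: g_def matrix_vector_mult_diff_distrib inner_diff_left inner_diff_right)
        also have "\<dots> = d s \<bullet> d s + 2 * \<mu> * Q s + ((P *v g) \<bullet> d s + (P *v d s) \<bullet> g)"
          using P[of "d s"] by (simp add: Q_def)
        finally have *: "(P *v d' s) \<bullet> d s + (P *v d s) \<bullet> d' s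
          = d s \<bullet> d s + 2 * \<mu> * Q s + ((P *v g) \<bullet> d s + (P *v d s) \<bullet> g)" .
        have pg: "p * norm g \<le> p * (\<epsilon> * norm (d s))" using g p0 by (intro mult_left_mono)
        have "\<bar>(P *v g) \<bullet> d s\<bar> \<le> norm (P *v g) * norm (d s)" by (rule Cauchy_Schwarz_ineq2)
        also have "\<dots> \<le> (p * (\<epsilon> * norm (d s))) * norm (d s)"
          using order_trans[OF p pg] by (intro mult_right_mono) auto
        finally have 1: "\<bar>(P *v g) \<bullet> d s\<bar> \<le> p * \<epsilon> * (d s \<bullet> d s)"
          by (simp add: power2_norm_eq_inner[symmetric] power2_eq_square mult_ac)
        have "\<bar>(P *v d s) \<bullet> g\<bar> \<le> norm (P *v d s) * norm g" by (rule Cauchy_Schwarz_ineq2)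
        also have "\<dots> \<le> (p * norm (d s)) * (\<epsilon> * norm (d s))"
          using p p0 g by (intro mult_mono) auto
        finally have 2: "\<bar>(P *v d s) \<bullet> g\<bar> \<le> p * \<epsilon> * (d s \<bullet> d s)"
          by (simp add: power2_norm_eq_inner[symmetric] power2_eq_square mult_ac)
        have "2 * p * \<epsilon> * (d s \<bullet> d s) \<le> 1 * (d s \<bullet> d s)" by (rule mult_right_mono[OF \<epsilon>(2)]) simp
        with 1 2 * show ?thesis by linarith
      qed
      have grow: "exp (- 2 * \<mu> * s) * Q s \<ge> Q 0" if "s \<ge> 0" for s
      proof -
        have "exp (- 2 * \<mu> * 0) * Q 0 \<le> exp (- 2 * \<mu> * s) * Q s"
        proof (rule DERIV_nonneg_imp_nondecreasing[OF that])
          fix r :: real assume "0 \<le> r"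
          have "((\<lambda>s. exp (- 2 * \<mu> * s) * Q s) has_real_derivative
             exp (- 2 * \<mu> * r) * (((P *v d' r) \<bullet> d r + (P *v d r) \<bullet> d' r) - 2 * \<mu> * Q r)) (at r)"
            using dQ[OF \<open>0 \<le> r\<close>] by (auto intro!: derivative_eq_intros simp: algebra_simps)
          then show "\<exists>D. ((\<lambda>s. exp (- 2 * \<mu> * s) * Q s) has_real_derivative D) (at r) \<and> 0 \<le> D"
            using Q'[OF \<open>0 \<le> r\<close>] by (intro exI conjI) auto
        qed
        then show ?thesis by simp
      qed
      obtain B1 where B1: "\<And>s. s \<ge> 0 \<Longrightarrow> norm (y s) \<le> B1" using bdy unfolding bounded_iff by auto
      obtain B2 where B2: "\<And>s. s \<ge> 0 \<Longrightarrow> norm (z s) \<le> B2" using bz unfolding bounded_iff by auto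
      have dB: "norm (d s) \<le> B1 + B2" if "s \<ge> 0" for s
        using norm_triangle_ineq4[of "y s" "z s"] B1[OF that] B2[OF that] by (simp add: d_def)
      have QB: "Q s \<le> p * (B1 + B2)\<^sup>2" if "s \<ge> 0" for s
      proof -
        have "Q s \<le> norm (P *v d s) * norm (d s)" unfolding Q_def by (rule norm_cauchy_schwarz)
        also have "\<dots> \<le> (p * norm (d s)) * norm (d s)" using p by (intro mult_right_mono) auto
        also have "\<dots> \<le> (p * (B1 + B2)) * (B1 + B2)"
          using dB[OF that] p0 order_trans[OF norm_ge_zero dB[OF that]] by (intro mult_mono) auto
        finally show ?thesis by (simp add: power2_eq_square)
      qed
      have Q0: "Q 0 > 0"
        using v \<open>h > 0\<close> yz by (simp add: Q_def d_def matrix_vector_mult_scaleR)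
      \<comment> \<open>At this time already the linear lower bound 1 + x of the exponential carries
        Q beyond its upper bound.\<close>
      define s where "s = p * (B1 + B2)\<^sup>2 / (2 * \<mu> * Q 0)"
      have s: "s \<ge> 0" using p0 \<mu> Q0 by (simp add: s_def)
      have "Q 0 * (1 + 2 * \<mu> * s) \<le> Q 0 * exp (2 * \<mu> * s)"
        using exp_ge_add_one_self[of "2 * \<mu> * s"] Q0 by (intro mult_left_mono) auto
      also have "\<dots> \<le> (exp (- 2 * \<mu> * s) * Q s) * exp (2 * \<mu> * s)"
        using grow[OF s] by (intro mult_right_mono) auto
      also have "\<dots> = Q s" by (simp add: mult.commute mult.left_commute exp_add[symmetric] mult.assoc[symmetric])
      finally have "Q 0 + Q 0 * 2 * \<mu> * s \<le> p * (B1 + B2)\<^sup>2" using QB[OF s] by (simp add: algebra_simps)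
      moreover have "Q 0 * 2 * \<mu> * s = p * (B1 + B2)\<^sup>2" using Q0 \<mu> by (simp add: s_def)
      ultimately show False using Q0 by simp
    qed
  qed
qed

lemma complex_eigenvalue_uminus: "complex_eigenvalue F z \<Longrightarrow> complex_eigenvalue (- F) (- z)"
proof -
  assume "complex_eigenvalue F z"
  then obtain w where w: "w \<noteq> 0" "(\<chi> i j. complex_of_real (F $ i $ j)) *v w = z *s w"
    unfolding complex_eigenvalue_def by blast
  have "(\<chi> i j. complex_of_real ((- F) $ i $ j)) *v w = (- z) *s w"
    using w(2) by (simp add: vec_eq_iff matrix_vector_mult_def sum_negf)
  with w(1) show ?thesis unfolding complex_eigenvalue_def by blast
qed

section \<open>Orbits tangent to a sphere\<close>

lemma power_diff_le:
  fixes a b :: real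
  assumes "0 \<le> b" "b \<le> a"
  shows "a ^ Suc n - b ^ Suc n \<le> real (Suc n) * a ^ n * (a - b)"
proof (induction n)
  case (Suc n)
  have "a ^ Suc (Suc n) - b ^ Suc (Suc n) = a * (a ^ Suc n - b ^ Suc n) + b ^ Suc n * (a - b)"
    by (simp add: algebra_simps)
  also have "\<dots> \<le> a * (real (Suc n) * a ^ n * (a - b)) + a ^ Suc n * (a - b)"
    using assms by (intro add_mono mult_left_mono Suc mult_right_mono power_mono) auto
  also have "\<dots> = real (Suc (Suc n)) * a ^ Suc n * (a - b)" by (simp add: algebra_simps)
  finally show ?case .
qed simp

text \<open>By Vitali, disjoint balls fill S up to a null set. The image of a ball lies in a ball of
  C times the radius, and the image of the null set is null. The measurable superset T stands in for
  the image itself.\<close>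

lemma Lipschitz_image_outer_measure:
  fixes f :: "'a::euclidean_space \<Rightarrow> 'a"
  assumes "open S" and S: "S \<in> lmeasurable" and "C > 0"
    and lip: "\<And>x y. norm (f x - f y) \<le> C * norm (x - y)"
  obtains T where "f ` S \<subseteq> T" "T \<in> lmeasurable" "measure lebesgue T \<le> C ^ DIM('a) * measure lebesgue S"
proof -
  define K where "K = {i. fst i \<in> S \<and> 0 < snd i \<and> ball (fst i) (snd i) \<subseteq> S}"
  obtain I where I: "countable I" "I \<subseteq> K"
    and pw: "pairwise (\<lambda>i j. disjnt (ball (fst i) (snd i)) (ball (fst j) (snd j))) I"
    and neg: "negligible (S - (\<Union>i\<in>I. ball (fst i) (snd i)))"
  proof (rule Vitali_covering_theorem_balls[of S K fst snd])
    fix x d :: "'a" and e :: real assume x: "x \<in> S" "0 < e"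
    obtain r where r: "r > 0" "ball x r \<subseteq> S" using \<open>open S\<close> x(1) by (meson openE)
    show "\<exists>i. i \<in> K \<and> x \<in> ball (fst i) (snd i) \<and> snd i < e"
      using x r by (intro exI[of _ "(x, min r (e / 2))"]) (auto simp: K_def)
  qed
  define g where "g i = ball (f (fst i)) (C * snd i)" for i :: "'a \<times> real"
  have gb: "measure lebesgue (\<Union>i\<in>J. g i) \<le> C ^ DIM('a) * measure lebesgue S"
    if J: "J \<subseteq> I" "finite J" for J
  proof -
    have "measure lebesgue (\<Union>i\<in>J. g i) \<le> (\<Sum>i\<in>J. measure lebesgue (g i))"
      using J by (intro measure_UNION_le) (auto simp: g_def)
    also have "\<dots> = (\<Sum>i\<in>J. C ^ DIM('a) * measure lebesgue (ball (fst i) (snd i)))"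
    proof (rule sum.cong[OF refl])
      fix i assume "i \<in> J"
      then have "snd i > 0" using J I by (auto simp: K_def)
      then show "measure lebesgue (g i) = C ^ DIM('a) * measure lebesgue (ball (fst i) (snd i))"
        using \<open>C > 0\<close> by (simp add: g_def content_ball power_mult_distrib)
    qed
    also have "\<dots> = C ^ DIM('a) * (\<Sum>i\<in>J. measure lebesgue (ball (fst i) (snd i)))"
      by (simp add: sum_distrib_left)
    also have "(\<Sum>i\<in>J. measure lebesgue (ball (fst i) (snd i)))
        = measure lebesgue (\<Union>i\<in>J. ball (fst i) (snd i))"
    proof (rule measure_UNION'[symmetric])
      show "finite J" by fact
      show "pairwise (\<lambda>i j. disjnt (ball (fst i) (snd i)) (ball (fst j) (snd j))) J"
        using pw J(1) by (rule pairwise_subset)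
    qed auto
    also have "\<dots> \<le> measure lebesgue S"
    proof (rule measure_mono_fmeasurable)
      show "(\<Union>i\<in>J. ball (fst i) (snd i)) \<subseteq> S" using J I unfolding K_def by blast
    qed (use J S in auto)
    finally show ?thesis using \<open>C > 0\<close> by (simp add: mult_left_mono)
  qed
  have gm: "g i \<in> lmeasurable" for i by (simp add: g_def)
  have neg': "negligible (f ` (S - (\<Union>i\<in>I. ball (fst i) (snd i))))"
  proof (rule negligible_locally_Lipschitz_image[OF _ neg])
    fix x show "\<exists>T B. open T \<and> x \<in> T \<and> (\<forall>y \<in> (S - (\<Union>i\<in>I. ball (fst i) (snd i))) \<inter> T. norm (f y - f x) \<le> B * norm (y - x))"
      using lip by (intro exI[of _ UNIV] exI[of _ C]) auto
  qed simp
  let ?U = "\<Union>i\<in>I. g i" and ?N = "f ` (S - (\<Union>i\<in>I. ball (fst i) (snd i)))"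
  have U: "?U \<in> lmeasurable" "measure lebesgue ?U \<le> C ^ DIM('a) * measure lebesgue S"
    using fmeasurable_UN_bound[OF I(1) gm gb] measure_UN_bound[OF I(1) gm gb] by auto
  have N: "?N \<in> lmeasurable" "measure lebesgue ?N = 0"
    using neg' by (auto simp: negligible_iff_measure)
  show thesis
  proof (rule that)
    show "f ` S \<subseteq> ?U \<union> ?N"
    proof
      fix y assume "y \<in> f ` S"
      then obtain x where x: "x \<in> S" "y = f x" by blast
      show "y \<in> ?U \<union> ?N"
      proof (cases "x \<in> (\<Union>i\<in>I. ball (fst i) (snd i))")
        case True
        then obtain i where i: "i \<in> I" "dist (fst i) x < snd i" by auto
        have "dist (f (fst i)) (f x) \<le> C * dist (fst i) x" using lip by (simp add: dist_norm)
        also have "\<dots> < C * snd i" using i \<open>C > 0\<close> by simp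
        finally have "y \<in> g i" using x by (simp add: g_def)
        then show ?thesis using i by blast
      qed (use x in auto)
    qed
    show "?U \<union> ?N \<in> lmeasurable" using U N by (intro fmeasurable.Un)
    show "measure lebesgue (?U \<union> ?N) \<le> C ^ DIM('a) * measure lebesgue S"
      using measure_Un_le[of ?U lebesgue ?N] U N by (auto simp: fmeasurableD)
  qed
qed

text \<open>A weak form of Sard's theorem for the map \<open>(z, s) \<mapsto> \<phi> s z\<close> on the sphere times the line: for
  a time \<open>1 / N\<close> the orbits starting at tangency points stay in a shell of width \<open>O(1 / N\<^sup>2)\<close>, and
  \<open>N\<close> Lipschitz images of this shell cover the orbit segments of length \<open>1\<close>.\<close>
lemma negligible_orbits_tangent_to_sphere:
  fixes X :: "'a::euclidean_space \<Rightarrow> 'a" and \<phi> :: "real \<Rightarrow> 'a \<Rightarrow> 'a"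
  assumes lip: "\<And>x y. norm (X x - X y) \<le> K * norm (x - y)" and "K \<ge> 0" and "R > 0"
    and \<phi>0: "\<And>x. \<phi> 0 x = x"
    and der: "\<And>x t. ((\<lambda>t. \<phi> t x) has_vector_derivative X (\<phi> t x)) (at t)"
    and grp: "\<And>s t x. \<phi> (s + t) x = \<phi> s (\<phi> t x)"
    and dst: "\<And>t x y. norm (\<phi> t x - \<phi> t y) \<le> exp (K * \<bar>t\<bar>) * norm (x - y)"
  shows "negligible (\<Union>s. \<phi> s ` {z. norm z = R \<and> X z \<bullet> z = 0})"
proof -
  define Z where "Z = {z. norm z = R \<and> X z \<bullet> z = 0}"
  have "compact ((\<lambda>s. \<phi> s 0) ` {0..1})"
    using der by (intro compact_continuous_image continuous_at_imp_continuous_on)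
      (auto intro: has_vector_derivative_continuous)
  then obtain B0 where B0: "\<And>s. 0 \<le> s \<Longrightarrow> s \<le> 1 \<Longrightarrow> norm (\<phi> s 0) \<le> B0"
    using compact_imp_bounded bounded_iff by (metis (no_types, lifting) atLeastAtMost_iff image_eqI)
  define B where "B = exp K * R + B0"
  have B: "norm (\<phi> s z) \<le> B" if "norm z = R" "0 \<le> s" "s \<le> 1" for z s
  proof -
    have "norm (\<phi> s z) \<le> norm (\<phi> s z - \<phi> s 0) + norm (\<phi> s 0)"
      using norm_triangle_sub[of "\<phi> s z" "\<phi> s 0"] by simp
    also have "norm (\<phi> s z - \<phi> s 0) \<le> exp (K * \<bar>s\<bar>) * R" using dst[of s z 0] that by simp
    also have "\<dots> \<le> exp K * R"
      using that \<open>K \<ge> 0\<close> \<open>R > 0\<close> mult_left_mono[of s 1 K] by (intro mult_right_mono) auto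
    finally show ?thesis using B0[of s] that by (simp add: B_def)
  qed
  have "B0 \<ge> 0" using B0[of 0] norm_ge_zero[of "\<phi> 0 0"] by linarith
  then have Bpos: "B \<ge> 0" using \<open>R > 0\<close> by (simp add: B_def)
  define M where "M = norm (X 0) + K * B"
  have XM: "norm (X x) \<le> M" if "norm x \<le> B" for x
  proof -
    have "norm (X x) \<le> norm (X 0) + K * norm x"
      using norm_triangle_sub[of "X x" "X 0"] lip[of x 0] by simp
    also have "\<dots> \<le> M" using that \<open>K \<ge> 0\<close> by (simp add: M_def mult_left_mono)
    finally show ?thesis .
  qed
  have Mpos: "M \<ge> 0" using Bpos \<open>K \<ge> 0\<close> by (simp add: M_def)
  define C where "C = 2 * ((K * B + M) * M)"
  have Cpos: "C \<ge> 0" using Bpos Mpos \<open>K \<ge> 0\<close> by (simp add: C_def)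
  have move: "norm (\<phi> s z - z) \<le> M * s" if z: "norm z = R" and s: "0 \<le> s" "s \<le> 1" for z s
  proof (cases "s = 0")
    case False
    have "norm (\<phi> s z - \<phi> 0 z) \<le> M * s - M * 0"
    proof (rule differentiable_bound_general)
      show "continuous_on {0..s} (\<lambda>s. \<phi> s z)"
        using der by (intro continuous_at_imp_continuous_on) (auto intro: has_vector_derivative_continuous)
      show "continuous_on {0..s} ((*) M)" by (intro continuous_intros)
      show "((*) M has_vector_derivative M) (at x)" for x
        by (auto intro!: derivative_eq_intros simp: has_real_derivative_iff_has_vector_derivative[symmetric])
      show "norm (X (\<phi> x z)) \<le> M" if "0 < x" "x < s" for x using XM B z s that by simp
    qed (use der s False in auto)
    then show ?thesis by (simp add: \<phi>0)
  qed (simp add: \<phi>0)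
  \<comment> \<open>The derivative of the squared norm along the orbit is twice
    \<open>X (\<phi> r z) \<bullet> \<phi> r z\<close>. This vanishes at r = 0 by tangency and is at
    most \<open>(K * B + M) * (M * r)\<close>, so the deviation from the sphere is quadratic in
    time.\<close>
  have shell: "\<bar>norm (\<phi> s z) - R\<bar> \<le> C * s\<^sup>2 / R" if zZ: "z \<in> Z" and s: "0 \<le> s" "s \<le> 1" for z s
  proof -
    have z: "norm z = R" and Xz: "X z \<bullet> z = 0" using zZ by (auto simp: Z_def)
    have tang: "\<bar>X (\<phi> r z) \<bullet> \<phi> r z\<bar> \<le> (K * B + M) * (M * r)" if r: "0 \<le> r" "r \<le> s" for r
    proof -
      have r1: "r \<le> 1" using r s by simp
      have "X (\<phi> r z) \<bullet> \<phi> r z = (X (\<phi> r z) - X z) \<bullet> \<phi> r z + X z \<bullet> (\<phi> r z - z)"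
        using Xz by (simp add: inner_diff_left inner_diff_right)
      also have "\<bar>\<dots>\<bar> \<le> norm (X (\<phi> r z) - X z) * norm (\<phi> r z) + norm (X z) * norm (\<phi> r z - z)"
        by (rule order_trans[OF abs_triangle_ineq add_mono[OF Cauchy_Schwarz_ineq2 Cauchy_Schwarz_ineq2]])
      also have "\<dots> \<le> (K * (M * r)) * B + M * (M * r)"
      proof (intro add_mono mult_mono)
        show "norm (X (\<phi> r z) - X z) \<le> K * (M * r)"
          using order_trans[OF lip mult_left_mono[OF move[OF z r(1) r1] \<open>K \<ge> 0\<close>]] .
        show "norm (X z) \<le> M" using XM B[OF z, of 0] by (simp add: \<phi>0)
      qed (use B[OF z r(1) r1] move[OF z r(1) r1] r Mpos \<open>K \<ge> 0\<close> in auto)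
      finally show ?thesis by (simp add: algebra_simps)
    qed
    have "\<bar>(norm (\<phi> s z))\<^sup>2 - R\<^sup>2\<bar> \<le> C * s\<^sup>2"
    proof (cases "s = 0")
      case False
      then have "s > 0" using s by simp
      have d: "((\<lambda>r. \<phi> r z \<bullet> \<phi> r z) has_real_derivative 2 * (X (\<phi> r z) \<bullet> \<phi> r z)) (at r)" for r
        using bounded_bilinear.has_vector_derivative[OF bounded_bilinear_inner der[of z r] der[of z r]]
        by (simp add: has_real_derivative_iff_has_vector_derivative inner_commute)
      obtain r where r: "0 < r" "r < s"
        "\<phi> s z \<bullet> \<phi> s z - \<phi> 0 z \<bullet> \<phi> 0 z = (s - 0) * (2 * (X (\<phi> r z) \<bullet> \<phi> r z))"
        using MVT2[OF \<open>s > 0\<close>, of "\<lambda>r. \<phi> r z \<bullet> \<phi> r z" "\<lambda>r. 2 * (X (\<phi> r z) \<bullet> \<phi> r z)"] d by blast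
      then have "(norm (\<phi> s z))\<^sup>2 - R\<^sup>2 = s * (2 * (X (\<phi> r z) \<bullet> \<phi> r z))"
        by (simp add: \<phi>0 power2_norm_eq_inner[symmetric] z)
      also have "\<bar>\<dots>\<bar> = s * (2 * \<bar>X (\<phi> r z) \<bullet> \<phi> r z\<bar>)" using s by (simp add: abs_mult)
      also have "\<dots> \<le> s * (2 * ((K * B + M) * (M * r)))" using tang[of r] r s by (intro mult_left_mono) auto
      also have "\<dots> \<le> s * (2 * ((K * B + M) * (M * s)))"
        using r s Mpos Bpos \<open>K \<ge> 0\<close> by (intro mult_left_mono) auto
      finally show ?thesis by (simp add: C_def power2_eq_square mult_ac)
    qed (simp add: \<phi>0 z)
    moreover have "(norm (\<phi> s z))\<^sup>2 - R\<^sup>2 = (norm (\<phi> s z) - R) * (norm (\<phi> s z) + R)"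
      by (simp add: power2_eq_square algebra_simps)
    ultimately have "\<bar>norm (\<phi> s z) - R\<bar> * (norm (\<phi> s z) + R) \<le> C * s\<^sup>2"
      using \<open>R > 0\<close> by (simp add: abs_mult)
    moreover have "\<bar>norm (\<phi> s z) - R\<bar> * R \<le> \<bar>norm (\<phi> s z) - R\<bar> * (norm (\<phi> s z) + R)"
      by (intro mult_left_mono) auto
    ultimately have "\<bar>norm (\<phi> s z) - R\<bar> * R \<le> C * s\<^sup>2" by linarith
    then show ?thesis using \<open>R > 0\<close> by (simp add: pos_le_divide_eq)
  qed
  define A where "A = (\<Union>s\<in>{0..1}. \<phi> s ` Z)"
  \<comment> \<open>The added 1 makes the shell of half-width \<open>D / (real N)\<^sup>2\<close>
    strictly wider than the bound in \<open>shell\<close>, so the open shell contains the orbit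
    points.\<close>
  define D where "D = C / R + 1"
  have D: "D > 0" using Cpos \<open>R > 0\<close> by (simp add: D_def add_nonneg_pos)
  define V where "V = unit_ball_vol (real DIM('a))"
  define Cl where "Cl = exp K"
  obtain n where n: "DIM('a) = Suc n" using DIM_positive[where 'a='a] gr0_implies_Suc by blast
  \<comment> \<open>N images, each of volume proportional to the width
    \<open>2 * D / (real N)\<^sup>2\<close> of the shell, give a total of
    \<open>W / real N\<close>.\<close>
  define W where "W = Cl ^ DIM('a) * (V * (real (Suc n) * (R + D) ^ n * (2 * D)))"
  have cover: "\<exists>T. A \<subseteq> T \<and> T \<in> lmeasurable \<and> measure lebesgue T \<le> W / real N"
    if N: "N > 0" "D / (real N)\<^sup>2 < R" for N :: nat
  proof -
    define \<delta> where "\<delta> = D / (real N)\<^sup>2"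
    have \<delta>: "\<delta> > 0" "\<delta> < R" "\<delta> \<le> D"
      using D N by (auto simp: \<delta>_def field_simps intro: order_trans[OF _ mult_left_mono[of 1]])
    define S where "S = ball (0::'a) (R + \<delta>) - cball 0 (R - \<delta>)"
    have S: "open S" "S \<in> lmeasurable" by (auto simp: S_def intro: fmeasurable.Diff)
    have "measure lebesgue S = measure lebesgue (ball (0::'a) (R + \<delta>)) - measure lebesgue (cball (0::'a) (R - \<delta>))"
      unfolding S_def using \<delta> by (intro measurable_measure_Diff) auto
    also have "\<dots> = V * ((R + \<delta>) ^ Suc n - (R - \<delta>) ^ Suc n)"
      using \<delta> \<open>R > 0\<close> by (simp add: content_ball content_cball V_def n right_diff_distrib)
    also have "\<dots> \<le> V * (real (Suc n) * (R + \<delta>) ^ n * ((R + \<delta>) - (R - \<delta>)))"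
      using \<delta> by (intro mult_left_mono power_diff_le) (auto simp: V_def)
    also have "\<dots> \<le> V * (real (Suc n) * (R + D) ^ n * (2 * \<delta>))"
      using \<delta> \<open>R > 0\<close> by (intro mult_left_mono mult_mono power_mono) (auto simp: V_def)
    finally have mS: "measure lebesgue S \<le> V * (real (Suc n) * (R + D) ^ n * (2 * \<delta>))" .
    have "\<exists>T. \<phi> (real k / real N) ` S \<subseteq> T \<and> T \<in> lmeasurable \<and>
       measure lebesgue T \<le> Cl ^ DIM('a) * measure lebesgue S" if "k < N" for k
    proof -
      have kN: "real k / real N \<le> 1" using that by simp
      have lipk: "norm (\<phi> (real k / real N) x - \<phi> (real k / real N) y) \<le> Cl * norm (x - y)" for x y
      proof -
        have "exp (K * \<bar>real k / real N\<bar>) \<le> Cl"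
          using kN \<open>K \<ge> 0\<close> mult_left_mono[OF kN, of K] by (simp add: Cl_def)
        from mult_right_mono[OF this norm_ge_zero[of "x - y"]] show ?thesis
          using dst[of "real k / real N" x y] by linarith
      qed
      have "Cl > 0" by (simp add: Cl_def)
      from Lipschitz_image_outer_measure[OF S this lipk] obtain T where
        "\<phi> (real k / real N) ` S \<subseteq> T" "T \<in> lmeasurable" "measure lebesgue T \<le> Cl ^ DIM('a) * measure lebesgue S" .
      then show ?thesis by (intro exI[of _ T] conjI)
    qed
    then have "\<forall>k\<in>{..<N}. \<exists>T. \<phi> (real k / real N) ` S \<subseteq> T \<and> T \<in> lmeasurable \<and>
       measure lebesgue T \<le> Cl ^ DIM('a) * measure lebesgue S" by blast
    from bchoice[OF this] obtain T where T: "\<And>k. k < N \<Longrightarrow> \<phi> (real k / real N) ` S \<subseteq> T k"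
      "\<And>k. k < N \<Longrightarrow> T k \<in> lmeasurable"
      "\<And>k. k < N \<Longrightarrow> measure lebesgue (T k) \<le> Cl ^ DIM('a) * measure lebesgue S" by auto
    have sub: "A \<subseteq> (\<Union>k<N. T k)"
    proof
      fix y assume "y \<in> A"
      then obtain s z where s: "0 \<le> s" "s \<le> 1" and z: "z \<in> Z" and y: "y = \<phi> s z" by (auto simp: A_def)
      have "\<exists>k<N. real k / real N \<le> s \<and> s \<le> real k / real N + 1 / real N"
      \<comment> \<open>Rounding down \<open>s * real N\<close> would give the index N for s = 1,
        which is out of range; this endpoint belongs to the last segment.\<close>
      proof (cases "s = 1")
        case True
        then show ?thesis using N by (intro exI[of _ "N - 1"]) (auto simp: field_simps of_nat_diff)
      next
        case False
        define k where "k = nat \<lfloor>s * real N\<rfloor>"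
        have k: "real k \<le> s * real N" "s * real N < real k + 1" using s by (auto simp: k_def)
        moreover have "real k < real N" using k(1) s False N
          by (smt (verit) mult_less_cancel_right2 of_nat_0_less_iff)
        ultimately show ?thesis using N by (intro exI[of _ k]) (auto simp: field_simps)
      qed
      then obtain k where k: "k < N" "real k / real N \<le> s" "s \<le> real k / real N + 1 / real N" by blast
      define r where "r = s - real k / real N"
      have r: "0 \<le> r" "r \<le> 1 / real N" using k by (auto simp: r_def)
      have r1: "r \<le> 1" using r N by (auto intro: order_trans)
      have "\<bar>norm (\<phi> r z) - R\<bar> \<le> C * r\<^sup>2 / R" by (rule shell[OF z r(1) r1])
      also have "\<dots> \<le> C * (1 / real N)\<^sup>2 / R"
        using r Cpos \<open>R > 0\<close> by (intro divide_right_mono mult_left_mono power_mono) auto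
      also have "\<dots> < \<delta>" using N \<open>R > 0\<close> by (simp add: \<delta>_def D_def field_simps)
      finally have "\<phi> r z \<in> S" by (auto simp: S_def)
      moreover have "y = \<phi> (real k / real N) (\<phi> r z)" unfolding y grp[symmetric] by (simp add: r_def)
      ultimately show "y \<in> (\<Union>k<N. T k)" using T(1) k(1) by blast
    qed
    have "measure lebesgue (\<Union>k<N. T k) \<le> (\<Sum>k<N. measure lebesgue (T k))"
      using T(2) by (intro measure_UNION_le) (auto simp: fmeasurableD)
    also have "\<dots> \<le> (\<Sum>k<N. Cl ^ DIM('a) * measure lebesgue S)" using T(3) by (intro sum_mono) auto
    also have "\<dots> = real N * (Cl ^ DIM('a) * measure lebesgue S)" by simp
    also have "\<dots> \<le> real N * (Cl ^ DIM('a) * (V * (real (Suc n) * (R + D) ^ n * (2 * \<delta>))))"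
      using mS by (intro mult_left_mono) (auto simp: Cl_def)
    also have "\<dots> = W / real N" using N by (simp add: W_def \<delta>_def field_simps power2_eq_square)
    finally have "measure lebesgue (\<Union>k<N. T k) \<le> W / real N" .
    moreover have "(\<Union>k<N. T k) \<in> lmeasurable" using T(2) by (intro fmeasurable.finite_UN) auto
    ultimately show ?thesis using sub by blast
  qed
  have negA: "negligible A"
    unfolding negligible_outer_le
  proof (intro allI impI)
    fix e :: real assume "e > 0"
    have "(\<lambda>N. W / real N) \<longlonglongrightarrow> 0" by (rule lim_const_over_n)
    then have 1: "eventually (\<lambda>N. W / real N < e) sequentially" using \<open>e > 0\<close> by (rule order_tendstoD)
    have "(\<lambda>N. (D / real N) * (1 / real N)) \<longlonglongrightarrow> 0 * 0" by (intro tendsto_mult lim_const_over_n)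
    then have "(\<lambda>N. D / (real N)\<^sup>2) \<longlonglongrightarrow> 0" by (simp add: power2_eq_square)
    then have 2: "eventually (\<lambda>N. D / (real N)\<^sup>2 < R) sequentially" using \<open>R > 0\<close> by (rule order_tendstoD)
    from eventually_happens[OF eventually_conj[OF 1 eventually_conj[OF 2 eventually_gt_at_top[of "0::nat"]]]]
    obtain N :: nat where N: "W / real N < e" "D / (real N)\<^sup>2 < R" "N > 0" by auto
    from cover[OF N(3,2)] obtain T where "A \<subseteq> T" "T \<in> lmeasurable" "measure lebesgue T \<le> W / real N" by blast
    then show "\<exists>T. A \<subseteq> T \<and> T \<in> lmeasurable \<and> measure lebesgue T \<le> e" using N(1) by (intro exI[of _ T]) auto
  qed
  \<comment> \<open>Every time is an integer plus a fractional part, so countably many Lipschitz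
    images of A cover the orbits for all times.\<close>
  have "negligible (\<phi> (real_of_int k) ` A)" for k
  proof (rule negligible_locally_Lipschitz_image[OF _ negA])
    fix x show "\<exists>T B. open T \<and> x \<in> T \<and> (\<forall>y\<in>A \<inter> T. norm (\<phi> (real_of_int k) y - \<phi> (real_of_int k) x) \<le> B * norm (y - x))"
      using dst by (intro exI[of _ UNIV] exI[of _ "exp (K * \<bar>real_of_int k\<bar>)"]) auto
  qed simp
  then have "negligible (\<Union>k\<in>(UNIV::int set). \<phi> (real_of_int k) ` A)"
    by (intro negligible_countable_Union) auto
  moreover have "(\<Union>s. \<phi> s ` Z) \<subseteq> (\<Union>k\<in>(UNIV::int set). \<phi> (real_of_int k) ` A)"
  proof
    fix y assume "y \<in> (\<Union>s. \<phi> s ` Z)"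
    then obtain s z where y: "y = \<phi> s z" "z \<in> Z" by blast
    have "y = \<phi> (real_of_int \<lfloor>s\<rfloor>) (\<phi> (frac s) z)" unfolding y(1) grp[symmetric] by (simp add: frac_def)
    moreover have "\<phi> (frac s) z \<in> A" using y(2) frac_lt_1[of s] by (auto simp: A_def intro!: bexI[of _ "frac s"])
    ultimately show "y \<in> (\<Union>k\<in>(UNIV::int set). \<phi> (real_of_int k) ` A)" by blast
  qed
  ultimately show ?thesis unfolding Z_def by (rule negligible_subset)
qed

section \<open>The reduced system\<close>

lemma same_vector_derivative_diff_eq:
  fixes f g :: "real \<Rightarrow> 'a::real_normed_vector"
  assumes "\<And>t. (f has_vector_derivative d t) (at t)" "\<And>t. (g has_vector_derivative d t) (at t)"
  shows "f t - g t = f s - g s"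
proof -
  have "((\<lambda>t. f t - g t) has_vector_derivative 0) (at t)" for t
    using has_vector_derivative_diff[OF assms(1)[of t] assms(2)[of t]] by simp
  then show ?thesis
    using has_vector_derivative_zero_constant[of UNIV "\<lambda>t. f t - g t"] by (metis UNIV_I convex_UNIV)
qed

lemma closest_point_cball_0:
  fixes x :: "'a::euclidean_space"
  assumes "R \<ge> 0" "norm x > R"
  shows "closest_point (cball 0 R) x = (R / norm x) *\<^sub>R x"
proof (rule closest_point_unique[symmetric])
  have nx: "norm x > 0" using assms by linarith
  have "norm (x - (R / norm x) *\<^sub>R x) = norm x - R"
  proof -
    have "x - (R / norm x) *\<^sub>R x = ((norm x - R) / norm x) *\<^sub>R x"
      using nx by (simp add: diff_divide_distrib scaleR_diff_left)
    then show ?thesis using assms nx by simp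
  qed
  then show "\<forall>z\<in>cball 0 R. dist x ((R / norm x) *\<^sub>R x) \<le> dist x z"
    using norm_triangle_ineq2[of x] by (force simp: dist_norm intro: order_trans[rotated])
  show "(R / norm x) *\<^sub>R x \<in> cball 0 R" using assms nx by simp
qed auto

text \<open>The projection onto the ball is nonexpansive. Composing with it extends a Lipschitz map
  from the ball to the whole space with the same constant, so that global solutions and flows become
  available.\<close>

lemma closest_point_cball_Lipschitz:
  fixes f :: "'a::euclidean_space \<Rightarrow> 'b::real_normed_vector"
  assumes "R \<ge> 0" "K \<ge> 0" "\<And>x y. norm x \<le> R \<Longrightarrow> norm y \<le> R \<Longrightarrow> norm (f x - f y) \<le> K * norm (x - y)"
  shows "norm (f (closest_point (cball 0 R) x) - f (closest_point (cball 0 R) y)) \<le> K * norm (x - y)"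
proof -
  have "closest_point (cball 0 R) z \<in> cball 0 R" for z :: 'a
    using closest_point_in_set[of "cball 0 R" z] \<open>R \<ge> 0\<close> by auto
  then have "norm (f (closest_point (cball 0 R) x) - f (closest_point (cball 0 R) y))
     \<le> K * norm (closest_point (cball 0 R) x - closest_point (cball 0 R) y)"
    by (intro assms) auto
  also have "\<dots> \<le> K * norm (x - y)"
    using closest_point_lipschitz[of "cball (0::'a) R" x y] \<open>R \<ge> 0\<close> \<open>K \<ge> 0\<close>
    by (intro mult_left_mono) (auto simp: dist_norm)
  finally show ?thesis .
qed

definition LF_red :: "('a::real_inner \<Rightarrow> 'a) \<Rightarrow> 'a \<times> real \<Rightarrow> 'a \<times> real" where
  "LF_red G v = (snd v *\<^sub>R G (fst v), - (G (fst v) \<bullet> fst v))"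

lemma LF_red_orthogonal: "v \<bullet> LF_red G v = 0"
  by (simp add: LF_red_def inner_prod_def inner_commute)

lemma LF_red_norm:
  fixes x :: "real \<Rightarrow> 'a::euclidean_space \<times> real"
  assumes x: "\<And>t. (x has_vector_derivative LF_red G (x t)) (at t)"
  shows "norm (x t) = norm (x 0)"
proof -
  have "((\<lambda>t. x t \<bullet> x t) has_vector_derivative 0) (at t)" for t
    using bounded_bilinear.has_vector_derivative[OF bounded_bilinear_inner x[of t] x[of t]]
    by (simp add: LF_red_orthogonal inner_commute)
  from same_vector_derivative_diff_eq[OF this, of "\<lambda>_. 0" t 0] show ?thesis
    by (simp add: norm_eq)
qed

text \<open>\<open>S\<close> is a union of spheres of the total \<open>(\<xi>, \<eta>)\<close>-space, and \<open>\<Omega>\<close> contains the \<open>\<xi>\<close> that occur.\<close>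
locale LF_reduced =
  fixes G :: "'a::euclidean_space \<Rightarrow> 'a" and \<Omega> :: "'a set" and S :: "('a \<times> real) set" and K :: real
  assumes K_nonneg: "K \<ge> 0"
    and G_lip: "\<And>x y. x \<in> \<Omega> \<Longrightarrow> y \<in> \<Omega> \<Longrightarrow> norm (G x - G y) \<le> K * norm (x - y)"
    and S_sphere: "\<And>v v'. v \<in> S \<Longrightarrow> norm v' = norm v \<Longrightarrow> v' \<in> S"
    and S_subset: "\<And>v. v \<in> S \<Longrightarrow> cball 0 (norm v) \<subseteq> \<Omega>"
begin

abbreviation X :: "'a \<times> real \<Rightarrow> 'a \<times> real" where "X \<equiv> LF_red G"

text \<open>Lipschitz constant of \<open>X\<close> on the ball of radius r. By the product rule each
  of the two components contributes \<open>K * r\<close>, from varying G, and the bound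
  \<open>norm (G 0) + K * r\<close> of G on the ball.\<close>

definition KX :: "real \<Rightarrow> real" where "KX r = 2 * (K * r + (norm (G 0) + K * r))"

lemma KX_mono: "r \<le> s \<Longrightarrow> KX r \<le> KX s"
  using K_nonneg by (auto simp: KX_def intro!: add_mono mult_left_mono)

lemma KX_nonneg: "r \<ge> 0 \<Longrightarrow> KX r \<ge> 0"
  using K_nonneg by (simp add: KX_def)

lemma X_lip:
  assumes r: "cball 0 r \<subseteq> \<Omega>" and x: "norm x \<le> r" and y: "norm y \<le> r"
  shows "norm (X x - X y) \<le> KX r * norm (x - y)"
proof -
  have r0: "r \<ge> 0" using x norm_ge_zero order_trans by blast
  define M where "M = norm (G 0) + K * r"
  have fx: "norm (fst x) \<le> r" "\<bar>snd x\<bar> \<le> r" "norm (fst y) \<le> r"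
    using norm_fst_le[of "fst x" "snd x"] norm_snd_le[of "snd x" "fst x"] norm_fst_le[of "fst y" "snd y"] x y by auto
  have d: "norm (fst x - fst y) \<le> norm (x - y)" "\<bar>snd x - snd y\<bar> \<le> norm (x - y)"
    using norm_fst_le[of "fst (x - y)" "snd (x - y)"] norm_snd_le[of "snd (x - y)" "fst (x - y)"]
    unfolding prod.collapse by auto
  have Om: "fst x \<in> \<Omega>" "fst y \<in> \<Omega>" "0 \<in> \<Omega>" using fx r r0 by auto
  have GM: "norm (G (fst y)) \<le> M"
  proof -
    have "norm (G (fst y)) \<le> norm (G 0) + K * norm (fst y)"
      using norm_triangle_sub[of "G (fst y)" "G 0"] G_lip[OF Om(2,3)] by simp
    then show ?thesis using mult_left_mono[OF fx(3) K_nonneg] by (simp add: M_def)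
  qed
  have GD: "norm (G (fst x) - G (fst y)) \<le> K * norm (x - y)"
    using order_trans[OF G_lip[OF Om(1,2)] mult_left_mono[OF d(1) K_nonneg]] .
  have "snd x *\<^sub>R G (fst x) - snd y *\<^sub>R G (fst y)
      = snd x *\<^sub>R (G (fst x) - G (fst y)) + (snd x - snd y) *\<^sub>R G (fst y)"
    by (simp add: algebra_simps)
  also have "norm \<dots> \<le> \<bar>snd x\<bar> * norm (G (fst x) - G (fst y)) + \<bar>snd x - snd y\<bar> * norm (G (fst y))"
    using norm_triangle_ineq by (metis norm_scaleR)
  also have "\<dots> \<le> r * (K * norm (x - y)) + norm (x - y) * M"
    using fx d GD GM r0 by (intro add_mono mult_mono) auto
  finally have 1: "norm (snd x *\<^sub>R G (fst x) - snd y *\<^sub>R G (fst y)) \<le> (K * r + M) * norm (x - y)"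
    by (simp add: algebra_simps)
  have "G (fst x) \<bullet> fst x - G (fst y) \<bullet> fst y
      = (G (fst x) - G (fst y)) \<bullet> fst x + G (fst y) \<bullet> (fst x - fst y)"
    by (simp add: inner_diff_left inner_diff_right)
  also have "\<bar>\<dots>\<bar> \<le> norm (G (fst x) - G (fst y)) * norm (fst x) + norm (G (fst y)) * norm (fst x - fst y)"
    by (rule order_trans[OF abs_triangle_ineq add_mono[OF Cauchy_Schwarz_ineq2 Cauchy_Schwarz_ineq2]])
  also have "\<dots> \<le> (K * norm (x - y)) * r + M * norm (x - y)"
    using fx d GD GM r0 K_nonneg by (intro add_mono mult_mono) (auto intro: order_trans[OF norm_ge_zero])
  finally have 2: "\<bar>G (fst x) \<bullet> fst x - G (fst y) \<bullet> fst y\<bar> \<le> (K * r + M) * norm (x - y)"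
    by (simp add: algebra_simps)
  have "norm (X x - X y) \<le> norm (fst (X x - X y)) + norm (snd (X x - X y))"
    using norm_Pair_le[of "fst (X x - X y)" "snd (X x - X y)"] unfolding prod.collapse by simp
  also have "\<dots> = norm (snd x *\<^sub>R G (fst x) - snd y *\<^sub>R G (fst y)) + \<bar>G (fst x) \<bullet> fst x - G (fst y) \<bullet> fst y\<bar>"
    by (simp add: LF_red_def abs_minus_commute)
  also have "\<dots> \<le> (K * r + M) * norm (x - y) + (K * r + M) * norm (x - y)" by (rule add_mono[OF 1 2])
  also have "\<dots> = KX r * norm (x - y)" by (simp add: KX_def M_def algebra_simps)
  finally show ?thesis .
qed

text \<open>The field is precomposed with the projection p onto the ball through v. Since p is
  radial, the truncated field remains orthogonal to the position. The norm of the solution is then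
  constant, and the truncation is never active along it.\<close>

lemma ex_trajectory:
  assumes "v \<in> S"
  shows "\<exists>x. x 0 = v \<and> (\<forall>t. (x has_vector_derivative X (x t)) (at t))"
proof -
  define R where "R = norm v"
  define p where "p = closest_point (cball (0::'a \<times> real) R)"
  have R: "R \<ge> 0" "cball 0 R \<subseteq> \<Omega>" using S_subset[OF assms] by (auto simp: R_def)
  have "norm (X (p x) - X (p y)) \<le> KX R * norm (x - y)" for x y
    unfolding p_def by (rule closest_point_cball_Lipschitz) (use R KX_nonneg X_lip in auto)
  from Lipschitz_ode_solution[OF this, of v] obtain x where
    x: "x 0 = v" "\<And>t. (x has_vector_derivative X (p (x t))) (at t)" by blast
  have orth: "y \<bullet> X (p y) = 0" for y
  proof (cases "norm y \<le> R")
    case True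
    then have "p y = y" unfolding p_def by (intro closest_point_self) simp
    then show ?thesis by (simp add: LF_red_orthogonal)
  next
    case False
    then have py: "p y = (R / norm y) *\<^sub>R y" unfolding p_def using R by (intro closest_point_cball_0) auto
    show ?thesis
    proof (cases "R = 0")
      case True
      then have "X (p y) = 0" using py by (simp add: LF_red_def zero_prod_def)
      then show ?thesis by simp
    next
      case F: False
      have "p y \<bullet> X (p y) = 0" by (rule LF_red_orthogonal)
      then have "(R / norm y) * (y \<bullet> X (p y)) = 0" unfolding py by simp
      then show ?thesis using F False R by auto
    qed
  qed
  have "((\<lambda>t. x t \<bullet> x t) has_vector_derivative 0) (at t)" for t
    using bounded_bilinear.has_vector_derivative[OF bounded_bilinear_inner x(2)[of t] x(2)[of t]] orth
    by (simp add: inner_commute)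
  from same_vector_derivative_diff_eq[OF this, of "\<lambda>_. 0" _ 0] have "x t \<bullet> x t = x 0 \<bullet> x 0" for t by simp
  then have "norm (x t) = R" for t by (simp add: norm_eq R_def x(1))
  then have "p (x t) = x t" for t unfolding p_def by (intro closest_point_self) simp
  then show ?thesis using x by auto
qed

lemma solution_dist:
  assumes x: "\<And>t. (x has_vector_derivative X (x t)) (at t)" and y: "\<And>t. (y has_vector_derivative X (y t)) (at t)"
    and S: "x 0 \<in> S" "y 0 \<in> S" and r: "norm (x 0) \<le> r" "norm (y 0) \<le> r"
  shows "norm (x t - y t) \<le> exp (KX r * \<bar>t\<bar>) * norm (x 0 - y 0)"
proof (rule ode_dist_le[OF x y])
  fix s
  \<comment> \<open>The ball of radius r need not lie in \<open>\<Omega>\<close>; the Lipschitz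
    estimate is made on the ball of radius m, and only its constant is enlarged afterwards.\<close>
  define m where "m = max (norm (x 0)) (norm (y 0))"
  have "cball 0 m \<subseteq> \<Omega>" using S_subset[OF S(1)] S_subset[OF S(2)] by (auto simp: m_def max_def)
  moreover have "norm (x s) \<le> m" "norm (y s) \<le> m" using LF_red_norm[OF x, of s] LF_red_norm[OF y, of s] by (auto simp: m_def)
  ultimately have "norm (X (x s) - X (y s)) \<le> KX m * norm (x s - y s)" by (rule X_lip)
  also have "\<dots> \<le> KX r * norm (x s - y s)" using r by (intro mult_right_mono KX_mono) (auto simp: m_def)
  finally show "norm (X (x s) - X (y s)) \<le> KX r * norm (x s - y s)" .
qed

section \<open>Trajectories on the spheres and the height gained along them\<close>

definition trj :: "'a \<times> real \<Rightarrow> real \<Rightarrow> 'a \<times> real" where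
  "trj v = (SOME x. x 0 = v \<and> (\<forall>t. (x has_vector_derivative X (x t)) (at t)))"

lemma trj_0: "v \<in> S \<Longrightarrow> trj v 0 = v"
  and trj_der: "v \<in> S \<Longrightarrow> (trj v has_vector_derivative X (trj v t)) (at t)"
  unfolding trj_def using someI_ex[OF ex_trajectory] by blast+

lemma trj_norm: "v \<in> S \<Longrightarrow> norm (trj v t) = norm v"
  using LF_red_norm[of "trj v" G t] trj_der trj_0 by metis

lemma trj_S: "v \<in> S \<Longrightarrow> trj v t \<in> S"
  using S_sphere trj_norm by blast

lemma trj_dist: "v \<in> S \<Longrightarrow> v' \<in> S \<Longrightarrow> norm v \<le> r \<Longrightarrow> norm v' \<le> r \<Longrightarrow>
    norm (trj v t - trj v' t) \<le> exp (KX r * \<bar>t\<bar>) * norm (v - v')"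
  using solution_dist[of "trj v" "trj v'" r t] trj_der trj_0 by simp

lemma trj_unique:
  assumes x: "\<And>t. (x has_vector_derivative X (x t)) (at t)" and "x 0 \<in> S"
  shows "x t = trj (x 0) t"
  using solution_dist[OF x trj_der[of "x 0"], of "norm (x 0)" t] assms(2) trj_0 by simp

lemma trj_add:
  assumes "v \<in> S" shows "trj (trj v s) t = trj v (t + s)"
proof -
  have "((\<lambda>t. trj v (t + s)) has_vector_derivative X (trj v (t + s))) (at t)" for t
    using vector_derivative_comp_affine[of "trj v" _ 1 t s] trj_der[OF assms] by simp
  from trj_unique[OF this] show ?thesis using trj_S[OF assms] by simp
qed

lemma trj_cont: "v \<in> S \<Longrightarrow> continuous_on A (trj v)"
  using trj_der by (meson has_vector_derivative_continuous continuous_at_imp_continuous_on)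

text \<open>The reduced field does not involve u, so u is its initial value plus this integral of
  \<eta>.\<close>

definition hgt :: "'a \<times> real \<Rightarrow> real \<Rightarrow> real" where
  "hgt v = (SOME h. h 0 = 0 \<and> (\<forall>t. (h has_vector_derivative snd (trj v t)) (at t)))"

lemma hgt_0: "v \<in> S \<Longrightarrow> hgt v 0 = 0"
  and hgt_vder: "v \<in> S \<Longrightarrow> (hgt v has_vector_derivative snd (trj v t)) (at t)"
proof -
  assume v: "v \<in> S"
  have "continuous_on UNIV (\<lambda>t. snd (trj v t))" using trj_cont[OF v] by (intro continuous_intros)
  from someI_ex[OF continuous_antiderivative[OF this, of 0]]
  show "hgt v 0 = 0" "(hgt v has_vector_derivative snd (trj v t)) (at t)" unfolding hgt_def by blast+
qed

lemma hgt_der: "v \<in> S \<Longrightarrow> (hgt v has_real_derivative snd (trj v t)) (at t)"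
  using hgt_vder by (simp add: has_real_derivative_iff_has_vector_derivative)

lemma hgt_cont: "v \<in> S \<Longrightarrow> continuous_on A (hgt v)"
  using hgt_vder by (meson has_vector_derivative_continuous continuous_at_imp_continuous_on)

lemma hgt_unique:
  assumes "v \<in> S" "\<And>t. (h has_vector_derivative snd (trj v t)) (at t)"
  shows "h t = h 0 + hgt v t"
  using same_vector_derivative_diff_eq[OF assms(2) hgt_vder[OF assms(1)], of t 0] hgt_0[OF assms(1)] by simp

lemma hgt_add:
  assumes "v \<in> S" shows "hgt v (t + s) = hgt v s + hgt (trj v s) t"
proof -
  have "((\<lambda>t. hgt v (t + s)) has_vector_derivative snd (trj (trj v s) t)) (at t)" for t
    using vector_derivative_comp_affine[of "hgt v" _ 1 t s] hgt_vder[OF assms] trj_add[OF assms] by simp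
  from hgt_unique[OF trj_S[OF assms] this] show ?thesis by simp
qed

text \<open>The system is reversible: changing the signs of t and \<eta> maps solutions to
  solutions. A state with \<eta> = 0 is fixed by this involution, so uniqueness identifies the
  trajectory with its mirror image.\<close>

lemma trj_reflect_0:
  assumes v: "v \<in> S" "snd v = 0"
  shows "trj v (- t) = (fst (trj v t), - snd (trj v t))" "hgt v (- t) = hgt v t"
proof -
  define x where "x t = (fst (trj v (- t)), - snd (trj v (- t)))" for t
  have d: "((\<lambda>t. trj v (- t)) has_vector_derivative - X (trj v (- t))) (at t)" for t
    using vector_derivative_comp_affine[of "trj v" _ "-1" t 0] trj_der[OF v(1)] by simp
  have xd: "(x has_vector_derivative X (x t)) (at t)" for t
  proof -
    have "(x has_vector_derivative (fst (- X (trj v (- t))), - snd (- X (trj v (- t))))) (at t)"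
      unfolding x_def
      by (intro has_vector_derivative_Pair has_vector_derivative_minus
          bounded_linear.has_vector_derivative[OF bounded_linear_fst d]
          bounded_linear.has_vector_derivative[OF bounded_linear_snd d])
    then show ?thesis by (simp add: LF_red_def x_def)
  qed
  have x0: "x 0 = v" using v by (simp add: x_def trj_0 prod_eq_iff)
  have x: "trj v t = x t" for t using trj_unique[OF xd, of t] v(1) unfolding x0 by simp
  have 1: "trj v (- t) = (fst (trj v t), - snd (trj v t))" for t
    by (subst x) (simp add: x_def)
  then show "trj v (- t) = (fst (trj v t), - snd (trj v t))" .
  have "((\<lambda>t. hgt v (- t)) has_vector_derivative snd (trj v t)) (at t)" for t
    using vector_derivative_comp_affine[of "hgt v" "snd (trj v (- t))" "-1" t 0] hgt_vder[OF v(1), of "- t"] 1[of t] by simp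
  from hgt_unique[OF v(1) this, of t] show "hgt v (- t) = hgt v t" by (simp add: hgt_0 v)
qed

lemma trj_reflect:
  assumes v: "v \<in> S" "snd (trj v a) = 0"
  shows "trj v (a - s) = (fst (trj v (a + s)), - snd (trj v (a + s)))" "hgt v (a - s) = hgt v (a + s)"
proof -
  note * = trj_reflect_0[OF trj_S[OF v(1)] v(2), of s]
  have e: "- s + a = a - s" "s + a = a + s" by simp_all
  show "trj v (a - s) = (fst (trj v (a + s)), - snd (trj v (a + s)))"
    using *(1) unfolding trj_add[OF v(1)] e .
  show "hgt v (a - s) = hgt v (a + s)"
    using *(2) hgt_add[OF v(1), of s a] hgt_add[OF v(1), of "- s" a] unfolding e by simp
qed

text \<open>The reflections about the times a and b compose to the translation by
  \<open>2 * (b - a)\<close>.\<close>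

lemma trj_period:
  assumes v: "v \<in> S" "snd (trj v a) = 0" "snd (trj v b) = 0"
  shows "trj v (t + 2 * (b - a)) = trj v t" "hgt v (t + 2 * (b - a)) = hgt v t"
proof -
  have e: "a - (a - t) = t" "a + (a - t) = 2 * a - t"
    "b - (2 * a - b - t) = t + 2 * (b - a)" "b + (2 * a - b - t) = 2 * a - t" by simp_all
  show "trj v (t + 2 * (b - a)) = trj v t" "hgt v (t + 2 * (b - a)) = hgt v t"
    using trj_reflect[OF v(1,2), of "a - t"] trj_reflect[OF v(1,3), of "2 * a - b - t"]
    unfolding e by simp_all
qed

lemma trj_period_int:
  assumes v: "v \<in> S" "snd (trj v a) = 0" "snd (trj v b) = 0"
  shows "trj v (t + of_int k * (2 * (b - a))) = trj v t \<and> hgt v (t + of_int k * (2 * (b - a))) = hgt v t"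
proof (induction k rule: int_induct[where k = 0])
  case (step1 i)
  then show ?case using trj_period[OF v, of "t + of_int i * (2 * (b - a))"] by (simp add: algebra_simps)
next
  case (step2 i)
  then show ?case using trj_period[OF v, of "t + of_int (i - 1) * (2 * (b - a))"] by (simp add: algebra_simps)
qed simp

lemma X_trj_nonzero:
  assumes v: "v \<in> S" and "X v \<noteq> 0" shows "X (trj v t) \<noteq> 0"
proof
  assume 0: "X (trj v t) = 0"
  have "((\<lambda>_. trj v t) has_vector_derivative X (trj v t)) (at s)" for s by (simp add: 0)
  from trj_unique[OF this, of "- t"] have "trj v t = trj (trj v t) (- t)" using trj_S[OF v] by simp
  also have "\<dots> = v" by (simp add: trj_add[OF v] trj_0[OF v])
  finally show False using 0 \<open>X v \<noteq> 0\<close> by simp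
qed

section \<open>Turning points and the minimal period\<close>

lemma snd_trj_der: "v \<in> S \<Longrightarrow>
    ((\<lambda>t. snd (trj v t)) has_real_derivative - (G (fst (trj v t)) \<bullet> fst (trj v t))) (at t)"
  using bounded_linear.has_vector_derivative[OF bounded_linear_snd trj_der]
  by (simp add: has_real_derivative_iff_has_vector_derivative LF_red_def)

text \<open>Where \<eta> = 0 the first component of \<open>X\<close> vanishes, so away from
  equilibria the second one, the derivative of \<eta>, does not.\<close>

lemma turning_point_nondegenerate:
  assumes "v \<in> S" "X v \<noteq> 0" "snd (trj v t) = 0"
  shows "G (fst (trj v t)) \<bullet> fst (trj v t) \<noteq> 0"
  using X_trj_nonzero[OF assms(1,2), of t] assms(3) by (auto simp: LF_red_def zero_prod_def)

text \<open>Two zeros of \<eta> already make the trajectory periodic by reflection. The condition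
  \<open>X v \<noteq> 0\<close> excludes equilibria, which also satisfy \<eta> = 0 at two times, and
  makes all zeros of \<eta> simple.\<close>

definition good :: "'a \<times> real \<Rightarrow> bool" where
  "good v \<longleftrightarrow> v \<in> S \<and> X v \<noteq> 0 \<and> (\<exists>a b. a < b \<and> snd (trj v a) = 0 \<and> snd (trj v b) = 0)"

text \<open>The zero a is simple, hence isolated on the right. The zeros between
  \<open>a + d / 2\<close> and c form a nonempty compact set, whose minimum is the next
  zero.\<close>

lemma good_turning_points:
  assumes "good v"
  obtains a b where "a < b" "snd (trj v a) = 0" "snd (trj v b) = 0" "\<And>t. a < t \<Longrightarrow> t < b \<Longrightarrow> snd (trj v t) \<noteq> 0"
proof -
  from assms obtain a c where v: "v \<in> S" "X v \<noteq> 0" and ac: "a < c" "snd (trj v a) = 0" "snd (trj v c) = 0"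
    unfolding good_def by blast
  define D where "D = - (G (fst (trj v a)) \<bullet> fst (trj v a))"
  have D: "D \<noteq> 0" using turning_point_nondegenerate[OF v ac(2)] by (simp add: D_def)
  have der: "((\<lambda>t. snd (trj v t)) has_real_derivative D) (at a)" unfolding D_def by (rule snd_trj_der[OF v(1)])
  obtain d where d: "d > 0" "\<And>h. 0 < h \<Longrightarrow> h < d \<Longrightarrow> snd (trj v (a + h)) \<noteq> 0"
  proof (cases "D > 0")
    case True
    from DERIV_pos_inc_right[OF der this] show ?thesis using that ac(2) by (metis less_irrefl)
  next
    case False
    then have "D < 0" using D by simp
    from DERIV_neg_dec_right[OF der this] show ?thesis using that ac(2) by (metis less_irrefl)
  qed
  define Z where "Z = {a + d / 2..c} \<inter> {t. snd (trj v t) = 0}"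
  have cont: "continuous_on UNIV (\<lambda>t. snd (trj v t))" using trj_cont[OF v(1)] by (intro continuous_intros)
  have "closed {t. snd (trj v t) = 0}" using continuous_closed_preimage_constant[OF cont closed_UNIV, of 0] by simp
  then have "compact Z" unfolding Z_def by (intro compact_Int_closed) auto
  moreover have "c \<in> Z"
  proof -
    have "\<not> (c - a < d)" using d(2)[of "c - a"] ac by auto
    then show ?thesis using ac d(1) by (auto simp: Z_def)
  qed
  ultimately obtain b where b: "b \<in> Z" "\<And>t. t \<in> Z \<Longrightarrow> b \<le> t"
    using compact_attains_inf[of Z] by blast
  show thesis
  proof (rule that)
    show "a < b" "snd (trj v b) = 0" using b(1) d(1) by (auto simp: Z_def)
    fix t assume t: "a < t" "t < b"
    show "snd (trj v t) \<noteq> 0"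
    proof (cases "t < a + d / 2")
      case True then show ?thesis using d(2)[of "t - a"] d(1) t by simp
    next
      case False
      moreover have "b \<le> c" using b(1) by (simp add: Z_def)
      ultimately show ?thesis using b(2)[of t] t by (auto simp: Z_def)
    qed
  qed fact
qed

lemma hgt_inj_on_monotone:
  assumes v: "v \<in> S" and nz: "\<And>t. a < t \<Longrightarrow> t < b \<Longrightarrow> snd (trj v t) \<noteq> 0"
    and st: "a \<le> s" "s \<le> b" "a \<le> t" "t \<le> b" and eq: "hgt v s = hgt v t"
  shows "s = t"
proof -
  have *: False if st: "a \<le> s" "s < t" "t \<le> b" "hgt v s = hgt v t" for s t
  proof -
    have "\<exists>z. s < z \<and> z < t \<and> hgt v t - hgt v s = (t - s) * snd (trj v z)"
      by (rule MVT2[OF st(2) hgt_der[OF v]])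
    then obtain z where "s < z" "z < t" "snd (trj v z) = 0" using st by auto
    then show False using nz[of z] st by simp
  qed
  show ?thesis using *[of s t] *[of t s] st eq by (metis linorder_neqE_linordered_idom)
qed

text \<open>Within one period the height is strictly monotone on \<open>{a..b}\<close> and on
  \<open>{b..a + P}\<close>, and the sign of \<eta> tells the two branches apart. This gives the
  injectivity of the torus embedding modulo the integers.\<close>

lemma trj_minimal_period:
  assumes v: "v \<in> S" and ab: "a < b" "snd (trj v a) = 0" "snd (trj v b) = 0"
    and nz: "\<And>t. a < t \<Longrightarrow> t < b \<Longrightarrow> snd (trj v t) \<noteq> 0"
    and eq: "hgt v s = hgt v t" "trj v s = trj v t"
  obtains k :: int where "s - t = of_int k * (2 * (b - a))"
proof -
  define P where "P = 2 * (b - a)"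
  have P: "P > 0" using ab by (simp add: P_def)
  define m where "m x = \<lfloor>(x - a) / P\<rfloor>" for x
  \<comment> \<open>The representative of x modulo P in the half-open interval from a to
    \<open>a + P\<close>.\<close>
  define r where "r x = x - of_int (m x) * P" for x
  have r: "a \<le> r x" "r x < a + P" for x
  proof -
    have "of_int (m x) \<le> (x - a) / P" "(x - a) / P < of_int (m x) + 1" unfolding m_def by linarith+
    then show "a \<le> r x" "r x < a + P" using P by (auto simp: r_def field_simps)
  qed
  have rx: "trj v (r x) = trj v x" "hgt v (r x) = hgt v x" for x
    using trj_period_int[OF v ab(2,3), of x "- m x"] by (auto simp: r_def P_def)
  have nz2: "snd (trj v x) \<noteq> 0" if "b < x" "x < a + P" for x
  proof -
    have "snd (trj v (b - (x - b))) \<noteq> 0" using that by (intro nz) (auto simp: P_def)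
    then show ?thesis using trj_reflect(1)[OF v ab(3), of "x - b"] by simp
  qed
  have aP: "snd (trj v (a + P)) = 0" using trj_period(1)[OF v ab(2,3), of a] ab by (simp add: P_def)
  have req: "hgt v (r s) = hgt v (r t)" "trj v (r s) = trj v (r t)" using eq rx by auto
  \<comment> \<open>Reflection about b carries the second branch to the first and reverses \<eta>.
    Equal signs would thus force a sign change, and a zero, between a and b.\<close>
  have opp: "sgn (snd (trj v y)) \<noteq> sgn (snd (trj v x))" if x: "a < x" "x < b" and y: "b < y" "y < a + P" for x y
  proof
    assume sg: "sgn (snd (trj v y)) = sgn (snd (trj v x))"
    define y' where "y' = 2 * b - y"
    have y': "a < y'" "y' < b" using y by (auto simp: y'_def P_def)
    have ys: "snd (trj v y') = - snd (trj v y)"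
      using trj_reflect(1)[OF v ab(3), of "y - b"] by (simp add: y'_def)
    have "\<exists>z. min x y' \<le> z \<and> z \<le> max x y' \<and> snd (trj v z) = 0"
    proof -
      have c: "continuous_on A (\<lambda>t. snd (trj v t))" for A using trj_cont[OF v] by (intro continuous_intros)
      have s: "snd (trj v x) > 0 \<and> snd (trj v y') < 0 \<or> snd (trj v x) < 0 \<and> snd (trj v y') > 0"
        using sg ys nz[OF x] by (auto simp: sgn_if split: if_splits)
      show ?thesis
        using s IVT'[of "\<lambda>t. snd (trj v t)" x 0 y'] IVT2'[of "\<lambda>t. snd (trj v t)" y' 0 x]
          IVT'[of "\<lambda>t. snd (trj v t)" y' 0 x] IVT2'[of "\<lambda>t. snd (trj v t)" x 0 y'] c
        by (smt (verit, best) linorder_le_cases max.absorb1 max.absorb2 min.absorb1 min.absorb2)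
    qed
    then show False using nz x y' by (auto simp: min_def max_def split: if_splits)
  qed
  have "r s = r t"
  proof -
    let ?A = "{a..b}" and ?B = "{b..a + P}"
    have A: "x = y" if "x \<in> ?A" "y \<in> ?A" "hgt v x = hgt v y" for x y
      using hgt_inj_on_monotone[OF v nz, where s=x and t=y] that by auto
    have B: "x = y" if "x \<in> ?B" "y \<in> ?B" "hgt v x = hgt v y" for x y
      using hgt_inj_on_monotone[OF v nz2, where s=x and t=y] that by auto
    have AB: False if "x \<in> ?A" "y \<in> ?B" "x \<noteq> b" "y \<noteq> b" "y < a + P" "hgt v x = hgt v y" "trj v x = trj v y" for x y
    proof (cases "x = a")
      case True
      then have "snd (trj v y) = 0" using that ab by simp
      then show False using nz2[of y] that by auto
    next
      case False then show False using opp[of x y] that by auto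
    qed
    consider "r s \<in> ?A" "r t \<in> ?A" | "r s \<in> ?B" "r t \<in> ?B" | "r s \<in> ?A" "r t \<in> ?B" "r s \<noteq> b" "r t \<noteq> b"
      | "r s \<in> ?B" "r t \<in> ?A" "r s \<noteq> b" "r t \<noteq> b"
      using r[of s] r[of t] by fastforce
    then show ?thesis
    proof cases
      case 3 then show ?thesis using AB[of "r s" "r t"] r req by auto
    next
      case 4 then show ?thesis using AB[of "r t" "r s"] r req by auto
    qed (use A B req in auto)
  qed
  then have "s - t = of_int (m s - m t) * P" by (simp add: r_def algebra_simps)
  then show thesis using that[of "m s - m t"] unfolding P_def by blast
qed

lemma good_trj: "good v \<Longrightarrow> good (trj v t)"
proof -
  assume "good v"
  then obtain a b where v: "v \<in> S" "X v \<noteq> 0" "a < b" "snd (trj v a) = 0" "snd (trj v b) = 0"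
    unfolding good_def by blast
  then have "a - t < b - t" "snd (trj (trj v t) (a - t)) = 0" "snd (trj (trj v t) (b - t)) = 0"
    by (auto simp: trj_add)
  then show ?thesis unfolding good_def using v X_trj_nonzero trj_S by blast
qed

end

section \<open>Good trajectories are open and dense\<close>

lemma mono_bounded_tendsto_at_top:
  fixes h :: "real \<Rightarrow> real"
  assumes mono: "\<And>s t. T \<le> s \<Longrightarrow> s \<le> t \<Longrightarrow> h s \<le> h t" and B: "\<And>t. T \<le> t \<Longrightarrow> h t \<le> B"
  shows "\<exists>l. (h \<longlongrightarrow> l) at_top"
proof -
  define l where "l = Sup (h ` {T..})"
  have bdd: "bdd_above (h ` {T..})" using B by (intro bdd_aboveI[of _ B]) auto
  have le: "h t \<le> l" if "T \<le> t" for t unfolding l_def using that by (intro cSup_upper bdd) auto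
  have "(h \<longlongrightarrow> l) at_top"
  proof (rule order_tendstoI)
    fix a assume "a < l"
    then obtain s where s: "T \<le> s" "a < h s"
      unfolding l_def by (subst (asm) less_cSup_iff) (use bdd in auto)
    show "eventually (\<lambda>t. a < h t) at_top"
      using eventually_ge_at_top[of s] by eventually_elim (use s mono in force)
  next
    fix a assume "l < a"
    show "eventually (\<lambda>t. h t < a) at_top"
      using eventually_ge_at_top[of T] by eventually_elim (use le \<open>l < a\<close> in force)
  qed
  then show ?thesis by blast
qed

text \<open>A derivative that stays away from 0 makes the function leave every bound. Applied to u
  it shows that \<eta> tends to 0, applied to \<eta> that the limit point is a tangency.\<close>

lemma derivative_limit_of_bounded_eq_0:
  fixes g :: "real \<Rightarrow> real"
  assumes der: "\<And>t. (g has_real_derivative g' t) (at t)" and lim: "(g' \<longlongrightarrow> l) at_top"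
    and B: "\<And>t. T \<le> t \<Longrightarrow> \<bar>g t\<bar> \<le> B"
  shows "l = 0"
proof -
  have *: "\<not> l > 0" if der: "\<And>t. (g has_real_derivative g' t) (at t)" and lim: "(g' \<longlongrightarrow> l) at_top"
    and B: "\<And>t. T \<le> t \<Longrightarrow> \<bar>g t\<bar> \<le> B" for g g' :: "real \<Rightarrow> real" and l
  proof
    assume "l > 0"
    then have "eventually (\<lambda>t. l / 2 < g' t) at_top" by (intro order_tendstoD(1)[OF lim]) simp
    then obtain T1 where T1: "\<And>t. t \<ge> T1 \<Longrightarrow> l / 2 < g' t" unfolding eventually_at_top_linorder by blast
    define A where "A = max T T1"
    \<comment> \<open>With slope at least \<open>l / 2\<close> the function grows by
      \<open>2 * B + 1\<close> up to this time, more than the bound B on its absolute value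
      permits.\<close>
    define t where "t = A + (2 * B + 1) * 2 / l"
    have "B \<ge> 0" using B[of T] by linarith
    then have "t > A" using \<open>l > 0\<close> by (simp add: t_def)
    from MVT2[OF this der] obtain z where z: "A < z" "z < t" "g t - g A = (t - A) * g' z" by blast
    have "(t - A) * (l / 2) \<le> g t - g A"
      unfolding z(3) using T1[of z] z by (intro mult_left_mono) (auto simp: A_def)
    moreover have "(t - A) * (l / 2) = 2 * B + 1" using \<open>l > 0\<close> by (simp add: t_def)
    moreover have "\<bar>g t\<bar> \<le> B" "\<bar>g A\<bar> \<le> B" using B[of t] B[of A] \<open>t > A\<close> by (auto simp: A_def)
    ultimately show False by linarith
  qed
  have "\<not> l > 0" by (rule *[OF der lim B])
  moreover have "\<not> - l > 0"
    by (rule *[of "\<lambda>t. - g t" "\<lambda>t. - g' t"]) (use der lim B in \<open>auto intro!: derivative_eq_intros tendsto_intros\<close>)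
  ultimately show ?thesis by simp
qed

context LF_reduced
begin

lemma trajectories_close:
  assumes v: "v \<in> S" and "e > 0"
  obtains d where "d > 0" "\<And>v' t. v' \<in> S \<Longrightarrow> dist v' v < d \<Longrightarrow> \<bar>t\<bar> \<le> T \<Longrightarrow>
    norm (trj v' t - trj v t) < e \<and> \<bar>hgt v' t - hgt v t\<bar> < e \<and> norm (X v' - X v) < e"
proof -
  define r where "r = norm v + 1"
  \<comment> \<open>Making the rate at least 1 bounds the difference of the derivatives of the
    heights by \<open>D * Kc * exp (Kc * \<bar>t\<bar>)\<close>, the form that the exponential
    comparison lemma expects.\<close>
  define Kc where "Kc = KX r + 1"
  have r: "r \<ge> 0" by (simp add: r_def)
  have Kc: "Kc \<ge> 1" using KX_nonneg[OF r] by (simp add: Kc_def)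
  define d where "d = min 1 (e / (exp (Kc * \<bar>T\<bar>) + Kc))"
  have den: "exp (Kc * \<bar>T\<bar>) + Kc > 0" using Kc by (intro add_pos_pos) auto
  have "d > 0" using \<open>e > 0\<close> den by (simp add: d_def)
  then show thesis
  proof (rule that)
    fix v' t assume v': "v' \<in> S" "dist v' v < d" and t: "\<bar>t\<bar> \<le> T"
    define D where "D = norm (v' - v)"
    have D: "D < d" "D \<ge> 0" using v' by (auto simp: D_def dist_norm)
    have nv: "norm v \<le> r" "norm v' \<le> r"
      using norm_triangle_sub[of v' v] D by (auto simp: r_def d_def D_def)
    have "D * (exp (Kc * \<bar>T\<bar>) + Kc) < e"
      using D(1) den unfolding d_def by (auto simp: pos_less_divide_eq)
    then have bound: "D * exp (Kc * \<bar>T\<bar>) + D * Kc < e" by (simp add: distrib_left)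
    have tj: "norm (trj v' t - trj v t) \<le> D * exp (Kc * \<bar>t\<bar>)" for t
    proof -
      have "norm (trj v' t - trj v t) \<le> exp (KX r * \<bar>t\<bar>) * D"
        unfolding D_def by (rule trj_dist[OF v'(1) v nv(2,1)])
      also have "\<dots> \<le> exp (Kc * \<bar>t\<bar>) * D"
        using D by (intro mult_right_mono) (auto simp: Kc_def algebra_simps)
      finally show ?thesis by (simp add: mult.commute)
    qed
    have mono: "D * exp (Kc * \<bar>t\<bar>) \<le> D * exp (Kc * \<bar>T\<bar>)"
      using t D Kc by (intro mult_left_mono) auto
    have "norm ((hgt v' t - hgt v t) - (hgt v' 0 - hgt v 0)) \<le> D * (exp (Kc * \<bar>t\<bar>) - 1)"
    proof (rule norm_le_exp_if_derivative_le_exp)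
      show "((\<lambda>t. hgt v' t - hgt v t) has_vector_derivative snd (trj v' t) - snd (trj v t)) (at t)" for t
        by (intro has_vector_derivative_diff hgt_vder v v')
      have "norm (snd (trj v' t) - snd (trj v t)) \<le> norm (trj v' t - trj v t)" for t
        using norm_snd_le[of "snd (trj v' t - trj v t)" "fst (trj v' t - trj v t)"] unfolding prod.collapse by simp
      moreover have "D * exp (Kc * \<bar>t\<bar>) \<le> D * Kc * exp (Kc * \<bar>t\<bar>)" for t
        using D Kc by (intro mult_right_mono) (auto simp: mult_le_cancel_left1)
      ultimately show "norm (snd (trj v' t) - snd (trj v t)) \<le> D * Kc * exp (Kc * \<bar>t\<bar>)" for t
        using tj[of t] by (meson order_trans)
    qed
    then have "\<bar>hgt v' t - hgt v t\<bar> \<le> D * exp (Kc * \<bar>t\<bar>)"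
      using D by (simp add: hgt_0 v v' right_diff_distrib)
    moreover have "norm (X v' - X v) \<le> D * Kc"
    proof -
      define m where "m = max (norm v) (norm v')"
      have "cball 0 m \<subseteq> \<Omega>" using S_subset[OF v] S_subset[OF v'(1)] by (auto simp: m_def max_def)
      then have "norm (X v' - X v) \<le> KX m * D" unfolding D_def by (rule X_lip) (auto simp: m_def)
      also have "\<dots> \<le> Kc * D" using nv KX_mono[of m r] D by (intro mult_right_mono) (auto simp: m_def Kc_def)
      finally show ?thesis by (simp add: mult.commute)
    qed
    moreover have "D * Kc \<ge> 0" "D * exp (Kc * \<bar>T\<bar>) \<ge> 0" using D Kc by auto
    ultimately show "norm (trj v' t - trj v t) < e \<and> \<bar>hgt v' t - hgt v t\<bar> < e \<and> norm (X v' - X v) < e"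
      using tj[of t] mono bound by linarith
  qed
qed

text \<open>Being good is an open condition because \<open>\<eta>\<close> changes sign at its zeros.\<close>
lemma good_nearby:
  assumes "good v" "e > 0"
  obtains d where "d > 0" "\<And>v'. v' \<in> S \<Longrightarrow> dist v' v < d \<Longrightarrow>
    good v' \<and> (\<forall>t. \<exists>s. \<bar>hgt v' t - hgt v s\<bar> < e)"
proof -
  have v: "v \<in> S" "X v \<noteq> 0" using assms(1) by (auto simp: good_def)
  obtain a b where ab: "a < b" "snd (trj v a) = 0" "snd (trj v b) = 0"
    and nz: "\<And>t. a < t \<Longrightarrow> t < b \<Longrightarrow> snd (trj v t) \<noteq> 0" using good_turning_points[OF assms(1)] by blast
  \<comment> \<open>With a third of the gap, the zeros found within \<open>\<delta>\<close> of a and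
    of b remain ordered. By reflection \<eta> has opposite signs at \<open>a - \<delta>\<close> and
    \<open>a + \<delta>\<close>, and likewise around b.\<close>
  define \<delta> where "\<delta> = (b - a) / 3"
  have \<delta>: "\<delta> > 0" "a + \<delta> < b - \<delta>" using ab by (auto simp: \<delta>_def field_simps)
  define m1 where "m1 = snd (trj v (a + \<delta>))"
  define m2 where "m2 = snd (trj v (b - \<delta>))"
  have m: "m1 \<noteq> 0" "m2 \<noteq> 0" using nz \<delta> unfolding m1_def m2_def by auto
  have m1': "snd (trj v (a - \<delta>)) = - m1" using trj_reflect(1)[OF v(1) ab(2), of \<delta>] by (simp add: m1_def)
  have m2': "snd (trj v (b + \<delta>)) = - m2" using trj_reflect(1)[OF v(1) ab(3), of \<delta>] by (simp add: m2_def)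
  \<comment> \<open>Large enough for a whole period of the perturbed trajectory, which starts at a'
    \<ge> \<open>a - \<delta>\<close> and lasts at most \<open>4 * (b - a)\<close>.\<close>
  define T where "T = \<bar>a\<bar> + \<bar>b\<bar> + 5 * (b - a)"
  define e' where "e' = min e (min (norm (X v)) (min \<bar>m1\<bar> \<bar>m2\<bar>))"
  have e': "e' > 0" "e' \<le> e" "e' \<le> norm (X v)" "e' \<le> \<bar>m1\<bar>" "e' \<le> \<bar>m2\<bar>" using assms v m by (auto simp: e'_def)
  obtain d where d: "d > 0" "\<And>v' t. v' \<in> S \<Longrightarrow> dist v' v < d \<Longrightarrow> \<bar>t\<bar> \<le> T \<Longrightarrow>
    norm (trj v' t - trj v t) < e' \<and> \<bar>hgt v' t - hgt v t\<bar> < e' \<and> norm (X v' - X v) < e'"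
    using trajectories_close[OF v(1) e'(1), of T] by blast
  show thesis
  proof (rule that[OF d(1)])
    fix v' assume v': "v' \<in> S" "dist v' v < d"
    have sn: "\<bar>snd (trj v' t) - snd (trj v t)\<bar> < e'" if "\<bar>t\<bar> \<le> T" for t
      using d(2)[OF v' that] norm_snd_le[of "snd (trj v' t - trj v t)" "fst (trj v' t - trj v t)"]
      unfolding prod.collapse by simp
    have zero: "\<exists>z. c - \<delta> \<le> z \<and> z \<le> c + \<delta> \<and> snd (trj v' z) = 0"
      if "snd (trj v' (c - \<delta>)) < 0 \<and> snd (trj v' (c + \<delta>)) > 0 \<or> snd (trj v' (c - \<delta>)) > 0 \<and> snd (trj v' (c + \<delta>)) < 0" for c
    proof -
      have "continuous_on {c - \<delta>..c + \<delta>} (\<lambda>t. snd (trj v' t))" using trj_cont[OF v'(1)] by (intro continuous_intros)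
      then show ?thesis using that \<delta>(1) IVT'[of "\<lambda>t. snd (trj v' t)" "c - \<delta>" 0 "c + \<delta>"]
        IVT2'[of "\<lambda>t. snd (trj v' t)" "c + \<delta>" 0 "c - \<delta>"] by auto
    qed
    have Ts: "\<bar>a - \<delta>\<bar> \<le> T" "\<bar>a + \<delta>\<bar> \<le> T" "\<bar>b - \<delta>\<bar> \<le> T" "\<bar>b + \<delta>\<bar> \<le> T"
      using ab by (auto simp: T_def \<delta>_def field_simps abs_if)
    obtain a' where a': "a - \<delta> \<le> a'" "a' \<le> a + \<delta>" "snd (trj v' a') = 0"
      using zero[of a] sn[OF Ts(1)] sn[OF Ts(2)] m1' m1_def e' by (auto simp: abs_if split: if_splits)
    obtain b' where b': "b - \<delta> \<le> b'" "b' \<le> b + \<delta>" "snd (trj v' b') = 0"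
      using zero[of b] sn[OF Ts(3)] sn[OF Ts(4)] m2' m2_def e' by (auto simp: abs_if split: if_splits)
    have lt: "a' < b'" using a' b' \<delta> by linarith
    have "X v' \<noteq> 0" using d(2)[OF v', of 0] e' ab by (auto simp: T_def)
    then have g: "good v'" unfolding good_def using v' a' b' lt by blast
    \<comment> \<open>Closeness is known for bounded times only, so t is first reduced modulo the
      period of the perturbed trajectory.\<close>
    have "\<exists>s. \<bar>hgt v' t - hgt v s\<bar> < e" for t
    proof -
      define P where "P = 2 * (b' - a')"
      have P: "P > 0" "P \<le> 4 * (b - a)" using lt a' b' ab by (auto simp: P_def \<delta>_def field_simps)
      define k where "k = - \<lfloor>(t - a') / P\<rfloor>"
      define s where "s = t + of_int k * P"
      have "of_int (- k) \<le> (t - a') / P" "(t - a') / P < of_int (- k) + 1" unfolding k_def by simp_all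
      then have "a' \<le> s" "s < a' + P" using P by (auto simp: s_def field_simps)
      moreover have "\<delta> \<le> b - a" using ab by (simp add: \<delta>_def)
      moreover have "a' + P \<le> (a + \<delta>) + 4 * (b - a)" by (intro add_mono a'(2) P(2))
      ultimately have "s \<le> a + 5 * (b - a)" "a - (b - a) \<le> s"
        using a'(1) by (simp_all add: algebra_simps)
      then have "\<bar>s\<bar> \<le> T" using ab(1) by (auto simp: T_def abs_if)
      moreover have "hgt v' s = hgt v' t" using trj_period_int[OF v'(1) a'(3) b'(3), of t k] by (simp add: s_def P_def)
      ultimately have "\<bar>hgt v' t - hgt v s\<bar> < e" using d(2)[OF v', of s] e' by simp
      then show ?thesis by blast
    qed
    with g show "good v' \<and> (\<forall>t. \<exists>s. \<bar>hgt v' t - hgt v s\<bar> < e)" by blast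
  qed
qed

text \<open>Along a trajectory on the sphere of radius \<open>R\<close>, \<open>\<xi>\<close> follows the flow \<open>\<phi>\<close> of \<open>G\<close> for the
  time \<open>u\<close>. If \<open>\<eta>\<close> has at most one zero, then \<open>u\<close> is eventually monotone; either it is unbounded,
  so that \<open>\<phi>\<close> keeps \<open>\<xi>\<close> in the ball for all positive or all negative times, which \<open>expanding\<close> excludes
  on a dense open set, or the trajectory converges to an equilibrium on the sphere.\<close>
lemma good_dense:
  assumes v: "v \<in> S" "v \<noteq> 0" and "e > 0"
    and expd: "expanding G \<Omega>" "expanding (\<lambda>x. - G x) \<Omega>"
  obtains v' where "v' \<in> S" "norm v' = norm v" "dist v' v < e" "good v'"
proof -
  define R where "R = norm v"
  have R: "R > 0" "cball 0 R \<subseteq> \<Omega>" using v S_subset by (auto simp: R_def)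
  define Gt where "Gt x = G (closest_point (cball 0 R) x)" for x
  have Gt_lip: "norm (Gt x - Gt y) \<le> K * norm (x - y)" for x y
    unfolding Gt_def using R(2) by (intro closest_point_cball_Lipschitz G_lip less_imp_le[OF R(1)] K_nonneg) auto
  have GtG: "Gt x = G x" if "norm x \<le> R" for x
    unfolding Gt_def using that by (subst closest_point_self) auto
  obtain \<phi> :: "real \<Rightarrow> 'a \<Rightarrow> 'a" where \<phi>0: "\<And>x. \<phi> 0 x = x"
    and \<phi>d: "\<And>x t. ((\<lambda>t. \<phi> t x) has_vector_derivative Gt (\<phi> t x)) (at t)"
    and \<phi>a: "\<And>s t x. \<phi> (s + t) x = \<phi> s (\<phi> t x)"
    and \<phi>l: "\<And>t x y. norm (\<phi> t x - \<phi> t y) \<le> exp (K * \<bar>t\<bar>) * norm (x - y)"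
    using Lipschitz_flow[of Gt K] Gt_lip by blast
  have \<phi>c: "continuous_on UNIV (\<phi> t)" for t
    by (rule lipschitz_on_continuous_on[of "exp (K * \<bar>t\<bar>)"]) (use \<phi>l in \<open>auto simp: lipschitz_on_def dist_norm\<close>)
  \<comment> \<open>The \<xi> whose orbit under \<open>\<phi>\<close> never leaves the ball in the
    time direction \<open>\<sigma>\<close>. Since this set is closed, empty interior means nowhere
    dense.\<close>
  define N where "N \<sigma> = cball 0 R \<inter> (\<Inter>s\<in>{0..}. {x. norm (\<phi> (\<sigma> * s) x) \<le> R})" for \<sigma> :: real
  have Ncl: "closed (N \<sigma>)" for \<sigma>
    unfolding N_def by (intro closed_Int closed_INT ballI closed_cball closed_Collect_le continuous_intros
        continuous_on_norm \<phi>c)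
  have Nint: "interior (N \<sigma>) = {}" if \<sigma>: "\<sigma> = 1 \<or> \<sigma> = -1" for \<sigma>
  proof (rule ccontr)
    assume "interior (N \<sigma>) \<noteq> {}"
    then obtain x r where x: "r > 0" "ball x r \<subseteq> N \<sigma>" by (auto simp: mem_interior)
    have "expanding (\<lambda>x. \<sigma> *\<^sub>R G x) \<Omega>" using expd \<sigma> by auto
    then obtain w where w: "\<And>h y z. h > 0 \<Longrightarrow>
      (\<forall>s\<ge>0. (y has_vector_derivative \<sigma> *\<^sub>R G (y s)) (at s) \<and> y s \<in> \<Omega>) \<Longrightarrow>
      (\<forall>s\<ge>0. (z has_vector_derivative \<sigma> *\<^sub>R G (z s)) (at s) \<and> z s \<in> \<Omega>) \<Longrightarrow>
      y 0 - z 0 = h *\<^sub>R w \<Longrightarrow> bounded (y ` {0..}) \<Longrightarrow> bounded (z ` {0..}) \<Longrightarrow> False"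
      unfolding expanding_def by blast
    \<comment> \<open>Small enough that x and \<open>x + h *\<^sub>R w\<close> both lie in the ball
      inside \<open>N \<sigma>\<close>; the summand 1 covers w = 0.\<close>
    define h where "h = r / (2 * (norm w + 1))"
    have h: "h > 0" using x by (simp add: h_def add_nonneg_pos)
    have "norm w + 1 > 0" using norm_ge_zero[of w] by linarith
    then have "h * (norm w + 1) = r / 2" unfolding h_def
      by (metis less_irrefl nonzero_mult_div_cancel_right times_divide_eq_left mult_divide_mult_cancel_right)
    then have "h * norm w \<le> r / 2" using h by (simp add: distrib_left)
    then have xh: "x + h *\<^sub>R w \<in> N \<sigma>" "x \<in> N \<sigma>" using x h by (auto simp: dist_norm)
    have *: "(\<forall>s\<ge>0. ((\<lambda>s. \<phi> (\<sigma> * s) p) has_vector_derivative \<sigma> *\<^sub>R G (\<phi> (\<sigma> * s) p)) (at s) \<and> \<phi> (\<sigma> * s) p \<in> \<Omega>)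
      \<and> bounded ((\<lambda>s. \<phi> (\<sigma> * s) p) ` {0..})" if "p \<in> N \<sigma>" for p
    proof -
      have n: "norm (\<phi> (\<sigma> * s) p) \<le> R" if "s \<ge> 0" for s using \<open>p \<in> N \<sigma>\<close> that by (auto simp: N_def)
      have "((\<lambda>s. \<phi> (\<sigma> * s) p) has_vector_derivative \<sigma> *\<^sub>R G (\<phi> (\<sigma> * s) p)) (at s)" if "s \<ge> 0" for s
        using vector_derivative_comp_affine[of "\<lambda>t. \<phi> t p" _ \<sigma> s 0] \<phi>d[of p "\<sigma> * s"] GtG[OF n[OF that]] by simp
      moreover have "\<phi> (\<sigma> * s) p \<in> \<Omega>" if "s \<ge> 0" for s using n[OF that] R by auto
      moreover have "bounded ((\<lambda>s. \<phi> (\<sigma> * s) p) ` {0..})" using n by (auto simp: bounded_iff)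
      ultimately show ?thesis by blast
    qed
    show False
      by (rule w[OF h, of "\<lambda>s. \<phi> (\<sigma> * s) (x + h *\<^sub>R w)" "\<lambda>s. \<phi> (\<sigma> * s) x"])
        (use *[OF xh(1)] *[OF xh(2)] in \<open>auto simp: \<phi>0\<close>)
  qed
  define Z where "Z = {z. norm z = R \<and> Gt z \<bullet> z = 0}"
  have neg: "negligible (\<Union>s. \<phi> s ` Z)" unfolding Z_def
    by (rule negligible_orbits_tangent_to_sphere[OF Gt_lip K_nonneg R(1) \<phi>0 \<phi>d \<phi>a \<phi>l])
  \<comment> \<open>The hemisphere through v as a graph over \<xi>. It turns the search for v' on
    the sphere into one for \<xi> in a ball, where category and measure arguments apply.\<close>
  define f where "f \<xi> = (\<xi>, (if snd v < 0 then -1 else 1) * sqrt (R\<^sup>2 - (norm \<xi>)\<^sup>2))" for \<xi> :: 'a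
  have f_norm: "norm (f \<xi>) = R" if "norm \<xi> \<le> R" for \<xi>
  proof -
    have "(norm \<xi>)\<^sup>2 \<le> R\<^sup>2" using that by (intro power_mono) auto
    then show ?thesis using R by (simp add: f_def norm_Pair power_mult_distrib)
  qed
  have "(norm v)\<^sup>2 = (norm (fst v))\<^sup>2 + (snd v)\<^sup>2"
    using norm_Pair[of "fst v" "snd v"] by simp
  then have "R\<^sup>2 - (norm (fst v))\<^sup>2 = (snd v)\<^sup>2" by (simp add: R_def)
  then have fv: "f (fst v) = v" by (simp add: f_def prod_eq_iff)
  have fc: "continuous_on UNIV f" unfolding f_def by (intro continuous_intros)
  define U where "U = {\<xi>. dist (f \<xi>) v < e} \<inter> ball 0 R"
  have oU0: "open {\<xi>. dist (f \<xi>) v < e}" by (intro open_Collect_less continuous_intros fc)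
  \<comment> \<open>If \<eta> = 0 at v, its projection lies on the boundary of the ball; hence the
    detour through the closure.\<close>
  have "fst v \<in> {\<xi>. dist (f \<xi>) v < e} \<inter> closure (ball 0 R)"
    using fv \<open>e > 0\<close> R norm_fst_le[of "fst v" "snd v"] by (auto simp: R_def)
  then have "U \<noteq> {}" using open_Int_closure_eq_empty[OF oU0, of "ball 0 R"] unfolding U_def by blast
  moreover have "open U" unfolding U_def using oU0 by auto
  moreover have "interior (N 1 \<union> N (-1)) = {}"
    using interior_closed_Un_empty_interior[OF Ncl Nint] Nint by simp
  ultimately have "open (U - (N 1 \<union> N (-1)))" "U - (N 1 \<union> N (-1)) \<noteq> {}"
    using Ncl interior_maximal[of U "N 1 \<union> N (-1)"] by (auto intro!: open_Diff)
  then have "\<not> negligible (U - (N 1 \<union> N (-1)))" using open_not_negligible by blast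
  then have "\<not> U - (N 1 \<union> N (-1)) \<subseteq> (\<Union>s. \<phi> s ` Z)" using negligible_subset[OF neg] by metis
  then obtain \<xi> where \<xi>: "\<xi> \<in> U" "\<xi> \<notin> N 1" "\<xi> \<notin> N (-1)" "\<xi> \<notin> (\<Union>s. \<phi> s ` Z)"
    unfolding subset_iff by auto
  define v' where "v' = f \<xi>"
  have \<xi>R: "norm \<xi> < R" using \<xi>(1) by (simp add: U_def)
  have nv': "norm v' = norm v" using f_norm[of \<xi>] \<xi>R by (simp add: v'_def R_def)
  have v'S: "v' \<in> S" using S_sphere[OF v(1) nv'] .
  have dv': "dist v' v < e" using \<xi>(1) by (simp add: U_def v'_def)
  have fst': "fst v' = \<xi>" by (simp add: v'_def f_def)
  have "(norm \<xi>)\<^sup>2 < R\<^sup>2" using \<xi>R by (intro power_strict_mono) auto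
  then have snd': "snd v' \<noteq> 0" by (simp add: v'_def f_def)
  define x where "x = trj v'"
  define h where "h = hgt v'"
  have xn: "norm (x t) = R" for t using trj_norm[OF v'S] nv' by (simp add: x_def R_def)
  have fx: "norm (fst (x t)) \<le> R" and sx: "\<bar>snd (x t)\<bar> \<le> R" for t
    using xn[of t] norm_fst_le[of "fst (x t)" "snd (x t)"] norm_snd_le[of "snd (x t)" "fst (x t)"] by auto
  have h0: "h 0 = 0" and hd: "(h has_real_derivative snd (x t)) (at t)" for t
    using hgt_0[OF v'S] hgt_der[OF v'S] by (auto simp: h_def x_def)
  have hc: "continuous_on A h" for A using hgt_cont[OF v'S] by (simp add: h_def)
  have xphi: "fst (x t) = \<phi> (h t) \<xi>" for t
  proof -
    have "norm (fst (x t) - \<phi> (h t) \<xi>) \<le> exp (R * K * \<bar>t\<bar>) * norm (fst (x 0) - \<phi> (h 0) \<xi>)"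
    proof (rule ode_dist_le)
      show "((\<lambda>t. fst (x t)) has_vector_derivative snd (x t) *\<^sub>R Gt (fst (x t))) (at t)" for t
        using bounded_linear.has_vector_derivative[OF bounded_linear_fst trj_der[OF v'S, of t]] GtG[OF fx[of t]]
        by (simp add: x_def LF_red_def)
      show "((\<lambda>t. \<phi> (h t) \<xi>) has_vector_derivative snd (x t) *\<^sub>R Gt (\<phi> (h t) \<xi>)) (at t)" for t
        using vector_diff_chain_at[OF hd[of t, unfolded has_real_derivative_iff_has_vector_derivative] \<phi>d[of \<xi>]]
        by (simp add: o_def)
      show "norm (snd (x t) *\<^sub>R Gt (fst (x t)) - snd (x t) *\<^sub>R Gt (\<phi> (h t) \<xi>)) \<le> R * K * norm (fst (x t) - \<phi> (h t) \<xi>)" for t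
        using mult_mono[OF sx[of t] Gt_lip[of "fst (x t)" "\<phi> (h t) \<xi>"]] R by (simp add: scaleR_diff_right[symmetric])
    qed
    then show ?thesis by (simp add: h0 \<phi>0 x_def trj_0[OF v'S] fst')
  qed
  \<comment> \<open>Some time s carries \<open>\<xi>\<close> out of the ball. If
    \<open>\<sigma> * h\<close> exceeded s, then by the intermediate value theorem h would take the
    value \<open>\<sigma> * s\<close>, where the trajectory would have \<xi> outside the
    ball.\<close>
  have Nunb: "\<exists>B. \<forall>t. \<sigma> * h t \<le> B" if \<sigma>: "\<sigma> = 1 \<or> \<sigma> = -1" and "\<xi> \<notin> N \<sigma>" for \<sigma>
  proof -
    obtain s where s: "s \<ge> 0" "\<not> norm (\<phi> (\<sigma> * s) \<xi>) \<le> R" using \<open>\<xi> \<notin> N \<sigma>\<close> \<xi>R by (auto simp: N_def)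
    have "\<sigma> * h t \<le> s" for t
    proof (rule ccontr)
      assume "\<not> \<sigma> * h t \<le> s"
      have c: "continuous_on A (\<lambda>t. \<sigma> * h t)" for A using hc by (intro continuous_intros)
      have "\<exists>z. \<sigma> * h z = s"
      proof (cases "t \<ge> 0")
        case True
        then show ?thesis using IVT'[of "\<lambda>t. \<sigma> * h t" 0 s t] c h0 s \<open>\<not> \<sigma> * h t \<le> s\<close> by auto
      next
        case False
        then show ?thesis using IVT2'[of "\<lambda>t. \<sigma> * h t" 0 s t] c h0 s \<open>\<not> \<sigma> * h t \<le> s\<close> by auto
      qed
      then obtain z where "\<sigma> * h z = s" by blast
      then have "h z = \<sigma> * s" using \<sigma> by auto
      then show False using s(2) xphi[of z] fx[of z] by simp
    qed
    then show ?thesis by blast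
  qed
  have "good v'"
  proof (rule ccontr)
    assume ng: "\<not> good v'"
    have "X v' \<noteq> 0"
    proof
      assume "X v' = 0"
      then have G0: "Gt \<xi> = 0" using snd' fst' GtG[of \<xi>] \<xi>R by (simp add: LF_red_def zero_prod_def)
      have "\<phi> s \<xi> = \<xi>" for s
        using ode_dist_le[of "\<lambda>s. \<phi> s \<xi>" _ "\<lambda>_. \<xi>" "\<lambda>_. Gt \<xi>" K s, OF \<phi>d] Gt_lip[of _ \<xi>] by (simp add: G0 \<phi>0)
      then show False using \<xi>(2) \<xi>R by (auto simp: N_def)
    qed
    then have one: "\<not> (a < b \<and> snd (x a) = 0 \<and> snd (x b) = 0)" for a b
      using ng v'S by (auto simp: good_def x_def)
    obtain T where T: "\<And>t. t \<ge> T \<Longrightarrow> snd (x t) \<noteq> 0"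
    proof (cases "\<exists>a. snd (x a) = 0")
      case True
      then obtain a where a: "snd (x a) = 0" by blast
      show ?thesis by (rule that[of "a + 1"]) (use one[of a] a in force)
    qed (use that in blast)
    define \<sigma> where "\<sigma> = sgn (snd (x T))"
    have \<sigma>: "\<sigma> = 1 \<or> \<sigma> = -1" using T[of T] by (auto simp: \<sigma>_def sgn_if)
    have xc: "continuous_on A (\<lambda>t. snd (x t))" for A
      using trj_cont[OF v'S] unfolding x_def by (intro continuous_intros)
    have sg: "\<sigma> * snd (x t) > 0" if "t \<ge> T" for t
    proof (rule ccontr)
      assume "\<not> \<sigma> * snd (x t) > 0"
      then have 1: "\<sigma> * snd (x t) \<le> 0" by simp
      have 2: "0 \<le> \<sigma> * snd (x T)" using T[of T] by (auto simp: \<sigma>_def sgn_if)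
      have 3: "continuous_on {T..t} (\<lambda>t. \<sigma> * snd (x t))" by (intro continuous_on_mult_left xc)
      from IVT2'[OF 1 2 that 3] obtain z where "z \<ge> T" "\<sigma> * snd (x z) = 0" by auto
      then show False using T[of z] \<sigma> by auto
    qed
    have "\<exists>l. ((\<lambda>t. \<sigma> * h t) \<longlongrightarrow> l) at_top"
    proof -
      have "\<sigma> * h s \<le> \<sigma> * h t" if "T \<le> s" "s \<le> t" for s t
      proof (rule DERIV_nonneg_imp_nondecreasing[OF that(2)])
        fix r assume "s \<le> r"
        then have "\<sigma> * snd (x r) \<ge> 0" using sg[of r] that by simp
        moreover have "((\<lambda>t. \<sigma> * h t) has_real_derivative \<sigma> * snd (x r)) (at r)" by (intro DERIV_cmult hd)
        ultimately show "\<exists>y. ((\<lambda>t. \<sigma> * h t) has_real_derivative y) (at r) \<and> 0 \<le> y" by blast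
      qed
      moreover obtain B where "\<forall>t. \<sigma> * h t \<le> B" using Nunb[OF \<sigma>] \<sigma> \<xi> by blast
      ultimately show ?thesis by (intro mono_bounded_tendsto_at_top[of T _ B]) auto
    qed
    then obtain l0 where l0: "((\<lambda>t. \<sigma> * h t) \<longlongrightarrow> l0) at_top" by blast
    define l where "l = \<sigma> * l0"
    have hl: "(h \<longlongrightarrow> l) at_top"
    proof -
      have "((\<lambda>t. \<sigma> * (\<sigma> * h t)) \<longlongrightarrow> \<sigma> * l0) at_top" by (intro tendsto_intros l0)
      moreover have "\<sigma> * (\<sigma> * h t) = h t" for t using \<sigma> by auto
      ultimately show ?thesis by (simp add: l_def)
    qed
    obtain B1 B2 where B12: "\<forall>t. 1 * h t \<le> B1" "\<forall>t. -1 * h t \<le> B2" using Nunb \<xi> by metis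
    have hB: "\<bar>h t\<bar> \<le> \<bar>B1\<bar> + \<bar>B2\<bar>" for t using B12[rule_format, of t] by linarith
    define z where "z = \<phi> l \<xi>"
    have "isCont (\<lambda>t. \<phi> t \<xi>) l" using \<phi>d has_vector_derivative_continuous by blast
    from isCont_tendsto_compose[OF this hl] have xz: "((\<lambda>t. fst (x t)) \<longlongrightarrow> z) at_top"
      by (simp add: xphi z_def)
    have zR: "norm z \<le> R"
      by (rule Lim_norm_ubound[OF _ xz]) (auto simp: fx)
    have "snd (x t) = \<sigma> * sqrt (R\<^sup>2 - (norm (fst (x t)))\<^sup>2)" if "t \<ge> T" for t
    proof -
      have "R\<^sup>2 = (norm (fst (x t)))\<^sup>2 + (snd (x t))\<^sup>2"
        using xn[of t] norm_Pair[of "fst (x t)" "snd (x t)"] by (metis prod.collapse real_sqrt_ge_0_iff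
          real_sqrt_pow2 norm_ge_zero real_norm_def power2_abs)
      then have "R\<^sup>2 - (norm (fst (x t)))\<^sup>2 = (snd (x t))\<^sup>2" by simp
      then show ?thesis using sg[OF that] \<sigma> by auto
    qed
    then have "eventually (\<lambda>t. \<sigma> * sqrt (R\<^sup>2 - (norm (fst (x t)))\<^sup>2) = snd (x t)) at_top"
      unfolding eventually_at_top_linorder by (intro exI[of _ T]) metis
    moreover have "((\<lambda>t. \<sigma> * sqrt (R\<^sup>2 - (norm (fst (x t)))\<^sup>2)) \<longlongrightarrow> \<sigma> * sqrt (R\<^sup>2 - (norm z)\<^sup>2)) at_top"
      by (intro tendsto_intros xz)
    ultimately have "((\<lambda>t. snd (x t)) \<longlongrightarrow> \<sigma> * sqrt (R\<^sup>2 - (norm z)\<^sup>2)) at_top"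
      by (rule Lim_transform_eventually[rotated])
    \<comment> \<open>The bounded height has a convergent derivative \<eta>, so \<eta> tends to 0
      and the limit z lies on the sphere. The same argument for \<eta> itself then gives
      \<open>Gt z \<bullet> z = 0\<close>, which places \<open>\<xi>\<close> on an orbit through the
      discarded set \<open>Z\<close>.\<close>
    from derivative_limit_of_bounded_eq_0[OF hd this hB]
    have "R\<^sup>2 = (norm z)\<^sup>2" using \<sigma> by auto
    then have zR': "norm z = R" using R by (simp add: power2_eq_iff_nonneg)
    have "continuous_on UNIV Gt"
      by (rule lipschitz_on_continuous_on[of K]) (use Gt_lip K_nonneg in \<open>auto simp: lipschitz_on_def dist_norm\<close>)
    then have "isCont Gt z" by (simp add: continuous_on_eq_continuous_at)
    from isCont_tendsto_compose[OF this xz]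
    have "((\<lambda>t. - (Gt (fst (x t)) \<bullet> fst (x t))) \<longlongrightarrow> - (Gt z \<bullet> z)) at_top" by (intro tendsto_intros xz)
    moreover have "((\<lambda>t. snd (x t)) has_real_derivative - (Gt (fst (x t)) \<bullet> fst (x t))) (at t)" for t
      using snd_trj_der[OF v'S, of t] GtG[OF fx[of t]] by (simp add: x_def)
    ultimately have "- (Gt z \<bullet> z) = 0" using sx by (intro derivative_limit_of_bounded_eq_0) auto
    then have "z \<in> Z" using zR' by (simp add: Z_def)
    moreover have "\<xi> = \<phi> (- l) z" unfolding z_def \<phi>a[symmetric] by (simp add: \<phi>0)
    ultimately show False using \<xi>(4) by blast
  qed
  then show thesis using that v'S nv' dv' by blast
qed

end

section \<open>Invariant tori\<close>

lemma C_diff_on_Pair: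
  fixes f :: "'a::euclidean_space \<Rightarrow> 'b::euclidean_space" and g :: "'a \<Rightarrow> 'c::euclidean_space"
  assumes "C_diff_on k f S" "C_diff_on k g S"
  shows "C_diff_on k (\<lambda>x. (f x, g x)) S"
proof -
  have "bounded_linear (\<lambda>y::'b. (y, 0::'c))" "bounded_linear (\<lambda>y::'c. (0::'b, y))"
    by (intro bounded_linear_Pair bounded_linear_ident bounded_linear_zero)+
  then have "C_diff_on k (\<lambda>x. (f x, 0::'c)) S" "C_diff_on k (\<lambda>x. (0::'b, g x)) S"
    using C_diff_on_compose[OF C_diff_on_bounded_linear assms(1), of "\<lambda>y. (y, 0)"]
      C_diff_on_compose[OF C_diff_on_bounded_linear assms(2), of "\<lambda>y. (0, y)"] by auto
  from C_diff_on_add[OF this] show ?thesis by simp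
qed

lemma C_diff_on_linear_comp:
  fixes f :: "'a::euclidean_space \<Rightarrow> 'b::euclidean_space"
  assumes "bounded_linear h" "C_diff_on k f S"
  shows "C_diff_on k (\<lambda>x. h (f x)) S"
  by (rule C_diff_on_compose[OF C_diff_on_bounded_linear[OF assms(1), of k UNIV] assms(2)]) simp

text \<open>A lattice basis gives the linear coordinates in which the lattice is integral, as
  \<open>quasi_periodic_torus\<close> demands of the angles.\<close>

lemma full_lattice_linear_image:
  fixes \<Gamma> :: "(real^'n) set"
  assumes "full_lattice \<Gamma>"
  shows "\<exists>B :: real^'n \<Rightarrow> real^'n. linear B \<and> inj B \<and> surj B \<and> (\<forall>x. B x \<in> \<Gamma> \<longleftrightarrow> (\<forall>i. x $ i \<in> \<int>))"
proof -
  obtain b :: "'n \<Rightarrow> real^'n" where b: "inj b" "independent (range b)"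
    and G: "\<Gamma> = range (\<lambda>k :: 'n \<Rightarrow> int. \<Sum>i\<in>UNIV. of_int (k i) *\<^sub>R b i)"
    using assms unfolding full_lattice_def by blast
  define B where "B x = (\<Sum>i\<in>UNIV. x $ i *\<^sub>R b i)" for x :: "real^'n"
  have lin: "linear B"
    by (rule linearI) (simp_all add: B_def scaleR_add_left sum.distrib scaleR_sum_right)
  have "x = 0" if "B x = 0" for x
  proof -
    have "(\<Sum>v\<in>range b. (x $ (inv b v)) *\<^sub>R v) = 0"
      using that b(1) by (simp add: sum.reindex B_def)
    then have "\<forall>v\<in>range b. x $ (inv b v) = 0"
      using b(2) dependent_finite[of "range b"] by auto
    then show ?thesis using b(1) by (simp add: vec_eq_iff)
  qed
  then have inj: "inj B" by (simp add: linear_injective_0[OF lin])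
  have "B x \<in> \<Gamma> \<longleftrightarrow> (\<forall>i. x $ i \<in> \<int>)" for x
  proof
    assume "B x \<in> \<Gamma>"
    then obtain k :: "'n \<Rightarrow> int" where "B x = B (\<chi> i. of_int (k i))" by (auto simp: G B_def)
    then have "x = (\<chi> i. of_int (k i))" using inj by (simp add: inj_eq)
    then show "\<forall>i. x $ i \<in> \<int>" by simp
  next
    assume "\<forall>i. x $ i \<in> \<int>"
    then have "B x = (\<Sum>i\<in>UNIV. of_int \<lfloor>x $ i\<rfloor> *\<^sub>R b i)" by (simp add: B_def)
    then show "B x \<in> \<Gamma>" unfolding G by (intro range_eqI[of _ _ "\<lambda>i. \<lfloor>x $ i\<rfloor>"]) 
  qed
  then show ?thesis using lin inj linear_inj_imp_surj[OF lin inj] by blast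
qed

lemma Ints_Basis_prod_iff:
  fixes z :: "(real^'n) \<times> real"
  shows "(\<forall>b\<in>Basis. z \<bullet> b \<in> \<int>) \<longleftrightarrow> (\<forall>i. fst z $ i \<in> \<int>) \<and> snd z \<in> \<int>"
  by (auto simp: Basis_prod_def Basis_vec_def inner_prod_def inner_axis)

lemma topspace_TM_space: "topspace (TM_space L \<Gamma>) = range (TM_proj L \<Gamma>)"
proof
  show "topspace (TM_space L \<Gamma>) \<subseteq> range (TM_proj L \<Gamma>)"
    using openin_topspace[of "TM_space L \<Gamma>"] unfolding TM_space_def openin_quotient_topology by simp
  have "openin (TM_space L \<Gamma>) (range (TM_proj L \<Gamma>))"
    unfolding TM_space_def openin_quotient_topology by simp
  then show "range (TM_proj L \<Gamma>) \<subseteq> topspace (TM_space L \<Gamma>)" by (rule openin_subset)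
qed

lemma openin_TM_space:
  "openin (TM_space L \<Gamma>) V \<longleftrightarrow> V \<subseteq> range (TM_proj L \<Gamma>) \<and> open {x. TM_proj L \<Gamma> x \<in> V}"
  unfolding TM_space_def openin_quotient_topology by simp

locale LF_lattice = LF_reduced G \<Omega> S K
  for G :: "real^'n \<Rightarrow> real^'n" and \<Omega> S K +
  fixes L :: "real^'n \<Rightarrow> real^'n" and \<Gamma> :: "(real^'n) set"
  assumes L: "linear L" and lattice: "full_lattice \<Gamma>" and G_smooth: "smooth_on G \<Omega>"
begin

abbreviation q :: "'n grp \<times> 'n alg \<Rightarrow> 'n grp set \<times> 'n alg" where "q \<equiv> TM_proj L \<Gamma>"

text \<open>Treats both phase spaces at once: \<open>S = UNIV\<close> gives the trajectories on TM,
  the unit sphere those on SM.\<close>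

definition traj :: "(real \<Rightarrow> 'n grp set \<times> 'n alg) set" where
  "traj = {\<gamma> \<in> LF_TM L G \<Gamma>. \<forall>t. snd (\<gamma> t) \<in> S}"

lemma lattice_diff: "x \<in> \<Gamma> \<Longrightarrow> y \<in> \<Gamma> \<Longrightarrow> x - y \<in> \<Gamma>" and lattice_0: "0 \<in> \<Gamma>"
proof -
  obtain B :: "real^'n \<Rightarrow> real^'n" where B: "linear B" "inj B" "surj B" "\<And>x. B x \<in> \<Gamma> \<longleftrightarrow> (\<forall>i. x $ i \<in> \<int>)"
    using full_lattice_linear_image[OF lattice] by blast
  show "0 \<in> \<Gamma>" using B(4)[of 0] linear_0[OF B(1)] by simp
  assume "x \<in> \<Gamma>" "y \<in> \<Gamma>"
  moreover obtain x' y' where "x = B x'" "y = B y'" using B(3) by (meson surjE)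
  ultimately show "x - y \<in> \<Gamma>" using B(4)[of "x' - y'"] B(4)[of x'] B(4)[of y']
    by (simp add: linear_diff[OF B(1)])
qed

text \<open>An element of the lattice has u = 0, where the exponential is the identity; so it
  translates w, whatever L is.\<close>

lemma M_proj_eq: "M_proj L \<Gamma> (w, u) = (\<lambda>\<gamma>. (\<gamma> + w, u)) ` \<Gamma>"
  using lin_exp_0[OF L] by (simp add: M_proj_def)

lemma q_eq_iff: "q ((w, u), v) = q ((w', u'), v') \<longleftrightarrow> w - w' \<in> \<Gamma> \<and> u = u' \<and> v = v'"
proof -
  have "w - w' \<in> \<Gamma> \<and> u = u'" if eq: "(\<lambda>\<gamma>. (\<gamma> + w, u)) ` \<Gamma> = (\<lambda>\<gamma>. (\<gamma> + w', u')) ` \<Gamma>"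
  proof -
    have "(0 + w, u) \<in> (\<lambda>\<gamma>. (\<gamma> + w, u)) ` \<Gamma>" using lattice_0 by blast
    then have "(0 + w, u) \<in> (\<lambda>\<gamma>. (\<gamma> + w', u')) ` \<Gamma>" unfolding eq .
    then show ?thesis by auto
  qed
  moreover have "(\<lambda>\<gamma>. (\<gamma> + w, u)) ` \<Gamma> = (\<lambda>\<gamma>. (\<gamma> + w', u)) ` \<Gamma>" if w: "w - w' \<in> \<Gamma>"
  proof -
    have neg: "w' - w \<in> \<Gamma>" using lattice_diff[OF lattice_0 w] by simp
    have "(\<gamma> + w, u) \<in> (\<lambda>\<gamma>. (\<gamma> + w', u)) ` \<Gamma>" if "w' - w \<in> \<Gamma>" "\<gamma> \<in> \<Gamma>" for \<gamma> w w'
      by (rule image_eqI[of _ _ "\<gamma> - (w' - w)"]) (use lattice_diff that in auto)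
    then show ?thesis using neg w by blast
  qed
  ultimately show ?thesis unfolding TM_proj_def by (auto simp: M_proj_eq)
qed

text \<open>The lift of a torus: (u, \<xi>, \<eta>) runs through one reduced orbit while w is
  arbitrary, since a single trajectory need not fill the torus.\<close>

definition orb :: "real \<Rightarrow> 'n alg \<Rightarrow> ('n grp \<times> 'n alg) set" where
  "orb u v = {((w, u + hgt v t), trj v t) | w t. True}"

lemma orb_shift: "v \<in> S \<Longrightarrow> orb (u + hgt v t) (trj v t) = orb u v"
proof -
  assume v: "v \<in> S"
  have *: "orb (u + hgt v t) (trj v t) \<subseteq> orb u v" if "v \<in> S" for u v t
  proof
    fix p assume "p \<in> orb (u + hgt v t) (trj v t)"
    then obtain w s where "p = ((w, u + hgt v t + hgt (trj v t) s), trj (trj v t) s)" by (auto simp: orb_def)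
    then have "p = ((w, u + hgt v (s + t)), trj v (s + t))" using that by (simp add: trj_add hgt_add)
    then show "p \<in> orb u v" unfolding orb_def by blast
  qed
  have "orb ((u + hgt v t) + hgt (trj v t) (- t)) (trj (trj v t) (- t)) \<subseteq> orb (u + hgt v t) (trj v t)"
    by (rule *[OF trj_S[OF v]])
  moreover have "hgt v t + hgt (trj v t) (- t) = 0" using hgt_add[OF v, of "- t" t] hgt_0[OF v] by simp
  ultimately have "orb u v \<subseteq> orb (u + hgt v t) (trj v t)" by (simp add: trj_add[OF v] trj_0[OF v] add.assoc)
  with *[OF v] show ?thesis by blast
qed

lemma orb_base: "v \<in> S \<Longrightarrow> ((w, u), v) \<in> orb u v"
  using hgt_0[of v] trj_0[of v] by (auto simp: orb_def intro!: exI[of _ 0])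

text \<open>The projection identifies points that differ only in w, and w is unrestricted in
  \<open>orb u v\<close>.\<close>

lemma orb_saturated: "q p \<in> q ` orb u v \<longleftrightarrow> p \<in> orb u v"
proof
  assume "q p \<in> q ` orb u v"
  then obtain w t where "q p = q ((w, u + hgt v t), trj v t)" by (auto simp: orb_def)
  then have "snd (fst p) = u + hgt v t" "snd p = trj v t" using q_eq_iff by (metis prod.collapse)+
  then show "p \<in> orb u v" unfolding orb_def by (metis (mono_tags, lifting) mem_Collect_eq prod.collapse)
qed simp

lemma LF_field_red: "snd (LF_field L G p) = X (snd p)" "snd (fst (LF_field L G p)) = snd (snd p)"
  "fst (fst (LF_field L G p)) = lin_exp (\<lambda>v. snd (fst p) *\<^sub>R L v) (fst (snd p))"
proof -
  obtain w u x e where "p = ((w, u), (x, e))" by (metis prod.collapse)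
  then show "snd (LF_field L G p) = X (snd p)" "snd (fst (LF_field L G p)) = snd (snd p)"
    "fst (fst (LF_field L G p)) = lin_exp (\<lambda>v. snd (fst p) *\<^sub>R L v) (fst (snd p))"
    by (simp_all add: LF_red_def)
qed

lemma solution_in_orbit:
  assumes c: "\<And>t. (c has_vector_derivative LF_field L G (c t)) (at t)" and S: "snd (c 0) \<in> S"
  shows "snd (c t) = trj (snd (c 0)) t" "snd (fst (c t)) = snd (fst (c 0)) + hgt (snd (c 0)) t"
proof -
  have "((\<lambda>t. snd (c t)) has_vector_derivative X (snd (c t))) (at t)" for t
    using bounded_linear.has_vector_derivative[OF bounded_linear_snd c[of t]] by (simp add: LF_field_red)
  from trj_unique[OF this S] show 1: "snd (c t) = trj (snd (c 0)) t" for t .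
  have "((\<lambda>t. snd (fst (c t))) has_vector_derivative snd (trj (snd (c 0)) t)) (at t)" for t
    using bounded_linear.has_vector_derivative[OF bounded_linear_snd
      bounded_linear.has_vector_derivative[OF bounded_linear_fst c[of t]]] by (simp add: LF_field_red 1[symmetric])
  from hgt_unique[OF S this] show "snd (fst (c t)) = snd (fst (c 0)) + hgt (snd (c 0)) t" .
qed

lemma traj_in_orbit:
  assumes "\<gamma> \<in> traj" "\<gamma> s = q ((w, u), v)" "v \<in> S"
  shows "\<gamma> (t + s) \<in> q ` {((w, u + hgt v t), trj v t) | w. True}"
proof -
  from assms(1) obtain c0 where c0: "\<gamma> = q \<circ> c0" "\<And>t. (c0 has_vector_derivative LF_field L G (c0 t)) (at t)"
    unfolding traj_def LF_TM_def by blast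
  define c where "c t = c0 (t + s)" for t
  have c: "(c has_vector_derivative LF_field L G (c t)) (at t)" for t
    unfolding c_def using vector_derivative_comp_affine[of c0 _ 1 t s] c0(2) by simp
  have "q (c 0) = q ((w, u), v)" using assms(2) c0(1) by (simp add: c_def)
  then have c_init: "snd (fst (c 0)) = u" "snd (c 0) = v" using q_eq_iff by (metis prod.collapse)+
  have "c t = ((fst (fst (c t)), u + hgt v t), trj v t)"
    using solution_in_orbit[OF c, of t] c_init assms(3) by (simp add: prod_eq_iff)
  moreover have "\<gamma> (t + s) = q (c t)" by (simp add: c0(1) c_def)
  ultimately show ?thesis by (metis (mono_tags, lifting) imageI mem_Collect_eq)
qed

section \<open>Smooth parametrization of an invariant torus\<close>

lemma C_diff_on_X: "C_diff_on k X (\<Omega> \<times> UNIV)"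
proof -
  have f: "C_diff_on k fst (\<Omega> \<times> (UNIV::real set))" "C_diff_on k snd (\<Omega> \<times> (UNIV::real set))"
    by (intro C_diff_on_bounded_linear bounded_linear_fst bounded_linear_snd)+
  have G: "C_diff_on k (\<lambda>v::(real^'n) \<times> real. G (fst v)) (\<Omega> \<times> UNIV)"
    by (rule C_diff_on_compose[OF _ f(1)]) (use G_smooth in \<open>auto simp: smooth_on_def\<close>)
  have "C_diff_on k (\<lambda>v. (snd v *\<^sub>R G (fst v), (-1) *\<^sub>R (G (fst v) \<bullet> fst v))) (\<Omega> \<times> UNIV)"
    by (intro C_diff_on_Pair bounded_bilinear.C_diff_on_prod[OF bounded_bilinear_scaleR]
        bounded_bilinear.C_diff_on_prod[OF bounded_bilinear_inner] f G C_diff_on_const)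
  then show ?thesis by (simp add: LF_red_def[abs_def])
qed

lemma C_diff_on_trj: "v \<in> S \<Longrightarrow> C_diff_on k (trj v) UNIV"
proof (rule ode_solution_C_diff_on[OF trj_der])
  assume v: "v \<in> S"
  show "trj v t \<in> \<Omega> \<times> UNIV" for t
    using S_subset[OF v] trj_norm[OF v, of t] norm_fst_le[of "fst (trj v t)" "snd (trj v t)"]
    by (auto simp: mem_Times_iff)
qed (auto intro: C_diff_on_X)

lemma C_diff_on_hgt: "v \<in> S \<Longrightarrow> C_diff_on k (hgt v) UNIV"
  by (rule C_diff_on_SucD, rule C_diff_on_vector_derivative[OF hgt_vder])
    (auto intro: C_diff_on_linear_comp bounded_linear_snd C_diff_on_trj)

text \<open>The angles are n lattice coordinates for w and the time along the reduced orbit divided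
  by its period. Once the drift of w over a period has been subtracted linearly in the last angle,
  the parametrization is periodic and the flow linear.\<close>

lemma torus_quasi_periodic:
  assumes "good v"
  shows "quasi_periodic_torus TYPE((real^'n) \<times> real) q traj (q ` orb u v)"
proof -
  have v: "v \<in> S" "X v \<noteq> 0" using assms by (auto simp: good_def)
  obtain a b where ab: "a < b" "snd (trj v a) = 0" "snd (trj v b) = 0"
    and nz: "\<And>t. a < t \<Longrightarrow> t < b \<Longrightarrow> snd (trj v t) \<noteq> 0" using good_turning_points[OF assms] by blast
  define P where "P = 2 * (b - a)"
  have P: "P > 0" using ab by (simp add: P_def)
  have per: "trj v (t + of_int k * P) = trj v t" "hgt v (t + of_int k * P) = hgt v t" for t k
    using trj_period_int[OF v(1) ab(2,3)] by (auto simp: P_def)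
  have per1: "trj v (t + P) = trj v t" "hgt v (t + P) = hgt v t" for t using per[of t 1] by auto
  \<comment> \<open>The velocity of w involves u and \<xi> only, so it has the period P of the
    reduced orbit, and its integral W is periodic up to the constant
    \<open>\<Delta>\<close>.\<close>
  define w' where "w' t = lin_exp (\<lambda>x. (u + hgt v t) *\<^sub>R L x) (fst (trj v t))" for t
  have w'_smooth: "C_diff_on k w' UNIV" for k
    unfolding w'_def
    by (intro C_diff_on_lin_exp[OF L] C_diff_on_add C_diff_on_const C_diff_on_hgt[OF v(1)]
        C_diff_on_linear_comp[OF bounded_linear_fst] C_diff_on_trj[OF v(1)])
  obtain W where W: "\<And>t. (W has_vector_derivative w' t) (at t)"
    using continuous_antiderivative[of w' 0] w'_smooth[of 0] by auto
  define \<Delta> where "\<Delta> = W P - W 0"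
  have W1: "W (t + P) = W t + \<Delta>" for t
  proof -
    have "((\<lambda>t. W (t + P)) has_vector_derivative w' t) (at t)" for t
      using vector_derivative_comp_affine[of W _ 1 t P] W[of "t + P"] by (simp add: w'_def per1)
    from same_vector_derivative_diff_eq[OF this W, of t 0] show ?thesis by (simp add: \<Delta>_def algebra_simps)
  qed
  have Wk: "W (t + of_int k * P) = W t + of_int k *\<^sub>R \<Delta>" for t k
  proof (induction k rule: int_induct[where k = 0])
    case (step1 i)
    then show ?case using W1[of "t + of_int i * P"] by (simp add: algebra_simps)
  next
    case (step2 i)
    then show ?case using W1[of "t + of_int (i - 1) * P"] by (simp add: algebra_simps)
  qed simp
  obtain B :: "real^'n \<Rightarrow> real^'n" where B: "linear B" "inj B" "surj B" "\<And>x. B x \<in> \<Gamma> \<longleftrightarrow> (\<forall>i. x $ i \<in> \<int>)"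
    using full_lattice_linear_image[OF lattice] by blast
  have Bb: "bounded_linear B" using B(1) by (simp add: linear_conv_bounded_linear)
  define H :: "(real^'n) \<times> real \<Rightarrow> 'n grp \<times> 'n alg" where
    "H \<theta> = ((B (fst \<theta>) + W (snd \<theta> * P) + (- snd \<theta>) *\<^sub>R \<Delta>, u + hgt v (snd \<theta> * P)), trj v (snd \<theta> * P))" for \<theta>
  \<comment> \<open>The last angle advances by 1 in time P. The first component, the drift per unit
    time in lattice coordinates, restores what H subtracts, so that w moves along W.\<close>
  define \<omega> where "\<omega> = (inv B ((1 / P) *\<^sub>R \<Delta>), 1 / P)"
  have Binv: "B (inv B x) = x" for x using B(3) by (simp add: surj_f_inv_f)
  have Wsm: "C_diff_on k W UNIV" for k
    by (rule C_diff_on_SucD, rule C_diff_on_vector_derivative[OF W w'_smooth])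
  have sP: "C_diff_on k (\<lambda>\<theta>::(real^'n) \<times> real. snd \<theta> * P) UNIV" for k
    by (intro C_diff_on_bounded_linear bounded_linear_mult_const bounded_linear_snd)
  have "C_diff_on k H UNIV" for k
    unfolding H_def
    by (intro C_diff_on_Pair C_diff_on_add C_diff_on_const
        bounded_bilinear.C_diff_on_prod[OF bounded_bilinear_scaleR]
        C_diff_on_compose[OF Wsm sP] C_diff_on_compose[OF C_diff_on_hgt[OF v(1)] sP]
        C_diff_on_compose[OF C_diff_on_trj[OF v(1)] sP]
        C_diff_on_linear_comp[OF Bb C_diff_on_bounded_linear[OF bounded_linear_fst]]
        C_diff_on_bounded_linear[OF bounded_linear_minus[OF bounded_linear_snd]]) auto
  then have smooth: "smooth_on H UNIV" by (simp add: smooth_on_def)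
  have imm: "inj (frechet_derivative H (at \<theta>))" for \<theta>
  proof -
    define s where "s = snd \<theta> * P"
    define H' :: "(real^'n) \<times> real \<Rightarrow> 'n grp \<times> 'n alg" where
      "H' z = ((B (fst z) + (snd z * P) *\<^sub>R w' s + (- snd z) *\<^sub>R \<Delta>, (snd z * P) *\<^sub>R snd (trj v s)), (snd z * P) *\<^sub>R X (trj v s))" for z
    have comp: "((\<lambda>\<theta>::(real^'n) \<times> real. f (snd \<theta> * P)) has_derivative (\<lambda>z. (snd z * P) *\<^sub>R d)) (at \<theta>)"
      if "(f has_vector_derivative d) (at s)" for f :: "real \<Rightarrow> 'z::real_normed_vector" and d
    proof -
      have "((\<lambda>\<theta>::(real^'n) \<times> real. snd \<theta> * P) has_derivative (\<lambda>z. snd z * P)) (at \<theta>)"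
        by (auto intro!: derivative_eq_intros)
      from has_derivative_compose[OF this that[unfolded has_vector_derivative_def s_def]] show ?thesis .
    qed
    have BD: "((\<lambda>\<theta>::(real^'n) \<times> real. B (fst \<theta>)) has_derivative (\<lambda>z. B (fst z))) (at \<theta>)"
      by (intro bounded_linear_imp_has_derivative bounded_linear_compose[OF Bb] bounded_linear_fst)
    have DD: "((\<lambda>\<theta>::(real^'n) \<times> real. (- snd \<theta>) *\<^sub>R \<Delta>) has_derivative (\<lambda>z. (- snd z) *\<^sub>R \<Delta>)) (at \<theta>)"
      by (auto intro!: derivative_eq_intros)
    have UD: "((\<lambda>\<theta>::(real^'n) \<times> real. u + hgt v (snd \<theta> * P)) has_derivative (\<lambda>z. (snd z * P) *\<^sub>R snd (trj v s))) (at \<theta>)"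
      using has_derivative_add[OF has_derivative_const[of u] comp[OF hgt_vder[OF v(1)]]] by simp
    have "(H has_derivative H') (at \<theta>)"
      unfolding H_def H'_def
      by (intro has_derivative_Pair has_derivative_add BD DD UD comp[OF W] comp[OF trj_der[OF v(1)]])
    then have fd: "frechet_derivative H (at \<theta>) = H'" and lin: "linear H'"
      by (auto simp: frechet_derivative_at[symmetric] has_derivative_linear)
    \<comment> \<open>\<open>X\<close> does not vanish along the orbit, which kills the last
      component of z; injectivity of B kills the others.\<close>
    have "z = 0" if "H' z = 0" for z
    proof -
      have "(snd z * P) *\<^sub>R X (trj v s) = 0" using that by (simp add: H'_def zero_prod_def)
      then have z2: "snd z = 0" using P X_trj_nonzero[OF v] by simp
      then have "B (fst z) = 0" using that by (simp add: H'_def zero_prod_def)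
      then have "fst z = 0" using B(2) linear_injective_0[OF B(1)] by blast
      with z2 show ?thesis by (simp add: prod_eq_iff)
    qed
    then show ?thesis unfolding fd by (simp add: linear_injective_0[OF lin])
  qed
  have fibres: "q (H \<theta>) = q (H \<theta>') \<longleftrightarrow> (\<forall>b\<in>Basis. (\<theta> - \<theta>') \<bullet> b \<in> \<int>)" for \<theta> \<theta>'
  proof -
    obtain x s x' s' where \<theta>: "\<theta> = (x, s)" "\<theta>' = (x', s')" by (cases \<theta>; cases \<theta>') auto
    have diff: "B x + W (s * P) + (- s) *\<^sub>R \<Delta> - (B x' + W (s' * P) + (- s') *\<^sub>R \<Delta>) = B (x - x')"
      if k: "s = s' + of_int k" for k
    proof -
      have "s * P = s' * P + of_int k * P" using k by (simp add: distrib_right)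
      then show ?thesis using Wk[of "s' * P" k] k by (simp add: linear_diff[OF B(1)] algebra_simps)
    qed
    have "(q (H \<theta>) = q (H \<theta>')) \<longleftrightarrow> (\<forall>i. (x - x') $ i \<in> \<int>) \<and> s - s' \<in> \<int>"
    proof
      assume "q (H \<theta>) = q (H \<theta>')"
      then have eq: "B x + W (s * P) + (- s) *\<^sub>R \<Delta> - (B x' + W (s' * P) + (- s') *\<^sub>R \<Delta>) \<in> \<Gamma>"
        "hgt v (s * P) = hgt v (s' * P)" "trj v (s * P) = trj v (s' * P)"
        unfolding H_def \<theta> q_eq_iff by simp_all
      obtain k :: int where "s * P - s' * P = of_int k * P"
        using trj_minimal_period[OF v(1) ab nz eq(2,3)] unfolding P_def by blast
      then have "(s - s' - of_int k) * P = 0" by (simp add: algebra_simps)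
      then have k: "s = s' + of_int k" using P by simp
      then show "(\<forall>i. (x - x') $ i \<in> \<int>) \<and> s - s' \<in> \<int>" using eq(1) B(4) unfolding diff[OF k] by simp
    next
      assume as: "(\<forall>i. (x - x') $ i \<in> \<int>) \<and> s - s' \<in> \<int>"
      then obtain k where "s - s' = of_int k" by (auto elim: Ints_cases)
      then have k: "s = s' + of_int k" by simp
      then have "s * P = s' * P + of_int k * P" by (simp add: distrib_right)
      then have "trj v (s * P) = trj v (s' * P)" "hgt v (s * P) = hgt v (s' * P)" using per by simp_all
      moreover have "B (x - x') \<in> \<Gamma>" using as B(4) by blast
      ultimately show "q (H \<theta>) = q (H \<theta>')" unfolding H_def \<theta> q_eq_iff fst_conv snd_conv diff[OF k] by simp
    qed
    then show ?thesis unfolding Ints_Basis_prod_iff by (simp add: \<theta>)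
  qed
  have ran: "range (q \<circ> H) = q ` orb u v"
  proof -
    have "range H = orb u v"
    proof
      show "range H \<subseteq> orb u v" unfolding H_def orb_def by blast
      show "orb u v \<subseteq> range H"
      proof
        fix p assume "p \<in> orb u v"
        then obtain w t where p: "p = ((w, u + hgt v t), trj v t)" by (auto simp: orb_def)
        have "p = H (inv B (w - W t + (t / P) *\<^sub>R \<Delta>), t / P)" using P by (simp add: H_def p Binv)
        then show "p \<in> range H" by blast
      qed
    qed
    then show ?thesis by (simp only: image_comp[symmetric])
  qed
  have flow: "(\<lambda>t. q (H (\<theta> + t *\<^sub>R \<omega>))) \<in> traj" for \<theta>
  proof -
    obtain x s where \<theta>: "\<theta> = (x, s)" by (cases \<theta>)
    define c where "c t = ((B x + W (1 * t + s * P) - s *\<^sub>R \<Delta>, u + hgt v (1 * t + s * P)), trj v (1 * t + s * P))" for t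
    have cH: "H (\<theta> + t *\<^sub>R \<omega>) = c t" for t
    proof -
      have "(s + t / P) * P = 1 * t + s * P" using P by (simp add: distrib_right)
      then show ?thesis using P
        by (simp add: H_def c_def \<theta> \<omega>_def linear_add[OF B(1)] linear_scale[OF B(1)] Binv algebra_simps)
    qed
    have "(c has_vector_derivative LF_field L G (c t)) (at t)" for t
    proof -
      let ?s = "1 * t + s * P"
      have "((\<lambda>t. B x + W (1 * t + s * P) - s *\<^sub>R \<Delta>) has_vector_derivative 0 + 1 *\<^sub>R w' ?s - 0) (at t)"
        by (intro has_vector_derivative_add has_vector_derivative_diff has_vector_derivative_const
            vector_derivative_comp_affine W)
      moreover have "((\<lambda>t. u + hgt v (1 * t + s * P)) has_vector_derivative 0 + 1 *\<^sub>R snd (trj v ?s)) (at t)"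
        by (intro has_vector_derivative_add has_vector_derivative_const vector_derivative_comp_affine hgt_vder[OF v(1)])
      moreover have "((\<lambda>t. trj v (1 * t + s * P)) has_vector_derivative 1 *\<^sub>R X (trj v ?s)) (at t)"
        by (intro vector_derivative_comp_affine trj_der[OF v(1)])
      ultimately have "(c has_vector_derivative ((0 + 1 *\<^sub>R w' ?s - 0, 0 + 1 *\<^sub>R snd (trj v ?s)), 1 *\<^sub>R X (trj v ?s))) (at t)"
        unfolding c_def by (intro has_vector_derivative_Pair)
      moreover have "LF_field L G (c t) = ((w' ?s, snd (trj v ?s)), X (trj v ?s))"
        using LF_field_red[of "c t"] by (simp add: prod_eq_iff c_def w'_def)
      ultimately show ?thesis by simp
    qed
    moreover have "snd (q (c t)) \<in> S" for t by (simp add: c_def TM_proj_def trj_S[OF v(1)])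
    ultimately show ?thesis unfolding traj_def LF_TM_def cH by (auto simp: o_def intro!: exI[of _ c])
  qed
  have inv: "\<gamma> t \<in> q ` orb u v" if \<gamma>: "\<gamma> \<in> traj" "\<gamma> 0 \<in> q ` orb u v" for \<gamma> t
  proof -
    obtain w s where "\<gamma> 0 = q ((w, u + hgt v s), trj v s)" using \<gamma>(2) by (auto simp: orb_def)
    from traj_in_orbit[OF \<gamma>(1) this trj_S[OF v(1)], of t]
    have "\<gamma> t \<in> q ` orb (u + hgt v s) (trj v s)" unfolding orb_def by auto
    then show ?thesis by (simp add: orb_shift[OF v(1)])
  qed
  show ?thesis
    unfolding quasi_periodic_torus_def
    using smooth imm fibres ran flow inv by (intro conjI exI[of _ H] exI[of _ \<omega>]) blast+
qed

section \<open>Families of tori that fill an open dense set\<close>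

definition tori :: "(real \<Rightarrow> 'n alg \<Rightarrow> bool) \<Rightarrow> ('n grp set \<times> 'n alg) set set" where
  "tori Q = {q ` orb u v | u v. Q u v}"

context
  fixes Q :: "real \<Rightarrow> 'n alg \<Rightarrow> bool"
  assumes Q_good: "\<And>u v. Q u v \<Longrightarrow> good v"
    and Q_orb: "\<And>u v t. Q u v \<Longrightarrow> Q (u + hgt v t) (trj v t)"
    and Q_open: "\<And>u v. Q u v \<Longrightarrow> \<exists>d>0. \<forall>u' v'. v' \<in> S \<longrightarrow> dist u' u < d \<longrightarrow> dist v' v < d \<longrightarrow> Q u' v'"
    and Q_dense: "\<And>u v e. v \<in> S \<Longrightarrow> e > 0 \<Longrightarrow> \<exists>u' v'. v' \<in> S \<and> dist u' u < e \<and> dist v' v < e \<and> Q u' v'"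
begin

lemma q_in_tori: "q ((w, u), v) \<in> \<Union>(tori Q) \<longleftrightarrow> Q u v"
proof
  assume "q ((w, u), v) \<in> \<Union>(tori Q)"
  then obtain u0 v0 where Q: "Q u0 v0" "q ((w, u), v) \<in> q ` orb u0 v0" by (auto simp: tori_def)
  then have "((w, u), v) \<in> orb u0 v0" by (simp add: orb_saturated)
  then show "Q u v" using Q_orb[OF Q(1)] by (auto simp: orb_def)
next
  assume Q: "Q u v"
  then have "((w, u), v) \<in> orb u v" using Q_good by (intro orb_base) (auto simp: good_def)
  then show "q ((w, u), v) \<in> \<Union>(tori Q)" using Q unfolding tori_def by blast
qed

lemma Union_tori: "\<Union>(tori Q) = q ` {p. Q (snd (fst p)) (snd p)}"
proof (intro set_eqI iffI)
  fix y assume y: "y \<in> \<Union>(tori Q)"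
  then obtain p where p: "y = q p" by (auto simp: tori_def)
  have "Q (snd (fst p)) (snd p)"
    using y q_in_tori[of "fst (fst p)" "snd (fst p)" "snd p"] unfolding p prod.collapse by simp
  then show "y \<in> q ` {p. Q (snd (fst p)) (snd p)}" unfolding p by blast
next
  fix y assume "y \<in> q ` {p. Q (snd (fst p)) (snd p)}"
  then obtain w u v where "y = q ((w, u), v)" "Q u v" by (auto simp: split_paired_all)
  then show "y \<in> \<Union>(tori Q)" using q_in_tori by blast
qed

theorem tori_integrable:
  "integrable_with_tori TYPE((real^'n) \<times> real) (subtopology (TM_space L \<Gamma>) {(m, v). v \<in> S}) q traj (tori Q)"
proof -
  define Z where "Z = subtopology (TM_space L \<Gamma>) {(m, v :: 'n alg). v \<in> S}"
  have qS: "q p \<in> {(m, v). v \<in> S} \<longleftrightarrow> snd p \<in> S" for p by (auto simp: TM_proj_def split_beta)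
  have QS: "Q u v \<Longrightarrow> v \<in> S" for u v using Q_good by (auto simp: good_def)
  \<comment> \<open>\<open>Q\<close> is open only relative to S. This union of open boxes is an
    ambient open set with trace \<open>Q\<close>, as the subspace topology requires.\<close>
  define O2 where "O2 = \<Union>{ball u d \<times> ball v d | u v d.
     \<forall>u' v'. v' \<in> S \<longrightarrow> dist u' u < d \<longrightarrow> dist v' v < d \<longrightarrow> Q u' v'}"
  have O2: "open O2" unfolding O2_def by (auto intro!: open_Union open_Times)
  have O2Q: "(u, v) \<in> O2 \<and> v \<in> S \<longleftrightarrow> Q u v" for u v
  proof
    assume "(u, v) \<in> O2 \<and> v \<in> S"
    then obtain u0 v0 d where "(u, v) \<in> ball u0 d \<times> ball v0 d" "v \<in> S"
      "\<forall>u' v'. v' \<in> S \<longrightarrow> dist u' u0 < d \<longrightarrow> dist v' v0 < d \<longrightarrow> Q u' v'"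
      unfolding O2_def by blast
    then show "Q u v" by (metis mem_Sigma_iff mem_ball dist_commute)
  next
    assume Q: "Q u v"
    then obtain d where "d > 0" "\<forall>u' v'. v' \<in> S \<longrightarrow> dist u' u < d \<longrightarrow> dist v' v < d \<longrightarrow> Q u' v'"
      using Q_open by blast
    moreover from this have "(u, v) \<in> ball u d \<times> ball v d" by simp
    ultimately show "(u, v) \<in> O2 \<and> v \<in> S" using QS[OF Q] unfolding O2_def by blast
  qed
  define V where "V = q ` {p. (snd (fst p), snd p) \<in> O2}"
  have "{p. q p \<in> V} = {p. (snd (fst p), snd p) \<in> O2}"
  proof -
    have "(snd (fst p), snd p) \<in> O2" if "q p = q p'" "(snd (fst p'), snd p') \<in> O2" for p p'
      using that q_eq_iff[of "fst (fst p)" "snd (fst p)" "snd p" "fst (fst p')" "snd (fst p')" "snd p'"] by simp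
    then show ?thesis unfolding V_def by blast
  qed
  moreover have "open {p :: 'n grp \<times> 'n alg. (snd (fst p), snd p) \<in> O2}"
  proof -
    have "open ((\<lambda>p :: 'n grp \<times> 'n alg. (snd (fst p), snd p)) -` O2)"
      by (intro open_vimage O2 continuous_intros)
    then show ?thesis by (simp add: vimage_def)
  qed
  ultimately have "openin (TM_space L \<Gamma>) V" unfolding openin_TM_space by (auto simp: V_def)
  moreover have "\<Union>(tori Q) = V \<inter> {(m, v). v \<in> S}"
  proof -
    have "{p :: 'n grp \<times> 'n alg. Q (snd (fst p)) (snd p)} = {p. (snd (fst p), snd p) \<in> O2} \<inter> {p. snd p \<in> S}"
      using O2Q by blast
    moreover have "q ` (A \<inter> {p. snd p \<in> S}) = q ` A \<inter> C" if "\<And>p. q p \<in> C \<longleftrightarrow> snd p \<in> S" for A C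
      using that by blast
    note this[OF qS]
    ultimately show ?thesis unfolding Union_tori V_def by (simp only:)
  qed
  ultimately have opn: "openin Z (\<Union>(tori Q))" unfolding Z_def openin_subtopology by blast
  have "topspace Z \<subseteq> Z closure_of (\<Union>(tori Q))"
  proof
    fix y assume y: "y \<in> topspace Z"
    then have "y \<in> {(m, v). v \<in> S}" "y \<in> range q"
      unfolding Z_def topspace_subtopology topspace_TM_space by blast+
    then obtain p' where p': "y = q p'" by blast
    have "snd p' \<in> S" using \<open>y \<in> {(m, v). v \<in> S}\<close> unfolding p' qS .
    moreover have "y = q ((fst (fst p'), snd (fst p')), snd p')" by (simp add: p')
    ultimately obtain w u v where p: "y = q ((w, u), v)" "v \<in> S" by blast
    have "\<exists>z. z \<in> \<Union>(tori Q) \<and> z \<in> T" if T: "y \<in> T" "openin Z T" for T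
    proof -
      obtain V where V: "openin (TM_space L \<Gamma>) V" "T = V \<inter> {(m, v). v \<in> S}"
        using T(2) unfolding Z_def openin_subtopology by blast
      have "open {x. q x \<in> V}" using V(1) by (simp add: openin_TM_space)
      moreover have "((w, u), v) \<in> {x. q x \<in> V}" using T(1) V(2) p by simp
      ultimately obtain e where e: "e > 0" "\<And>p. dist p ((w, u), v) < e \<Longrightarrow> q p \<in> V"
        unfolding open_dist by blast
      \<comment> \<open>Only u and v are moved; w is kept.\<close>
      obtain u' v' where uv: "v' \<in> S" "dist u' u < e / 2" "dist v' v < e / 2" "Q u' v'"
        using Q_dense[OF p(2), of "e / 2" u] e(1) by auto
      have "dist ((w, u'), v') ((w, u), v) \<le> dist u' u + dist v' v"
        unfolding dist_Pair_Pair by (rule order_trans[OF sqrt_sum_squares_le_sum]) auto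
      then have "q ((w, u'), v') \<in> V" using uv by (intro e(2)) simp
      then have "q ((w, u'), v') \<in> T" using qS uv(1) unfolding V(2) by simp
      then show ?thesis using q_in_tori uv(4) by blast
    qed
    with y show "y \<in> Z closure_of (\<Union>(tori Q))"
      unfolding in_closure_of by (intro conjI allI impI) simp_all
  qed
  then have dense: "Z closure_of (\<Union>(tori Q)) = topspace Z"
    by (intro antisym closure_of_subset_topspace)
  have disj: "disjoint (tori Q)"
  proof (rule disjointI)
    fix T1 T2 assume T: "T1 \<in> tori Q" "T2 \<in> tori Q" "T1 \<noteq> T2"
    then obtain u1 v1 u2 v2 where T1: "T1 = q ` orb u1 v1" "Q u1 v1" and T2: "T2 = q ` orb u2 v2" "Q u2 v2"
      unfolding tori_def by blast
    show "T1 \<inter> T2 = {}"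
    proof (rule ccontr)
      assume "T1 \<inter> T2 \<noteq> {}"
      then obtain p where "p \<in> orb u1 v1" "q p \<in> T2" unfolding T1 by blast
      then have "p \<in> orb u1 v1" "p \<in> orb u2 v2" unfolding T2 orb_saturated by auto
      then obtain w1 t1 w2 t2 where "p = ((w1, u1 + hgt v1 t1), trj v1 t1)" "p = ((w2, u2 + hgt v2 t2), trj v2 t2)"
        unfolding orb_def by blast
      then have "orb u1 v1 = orb u2 v2" using orb_shift[OF QS[OF T1(2)], of u1 t1] orb_shift[OF QS[OF T2(2)], of u2 t2]
        by simp
      then show False using T T1 T2 by simp
    qed
  qed
  have "\<forall>T\<in>tori Q. quasi_periodic_torus TYPE((real^'n) \<times> real) q traj T"
    unfolding tori_def using torus_quasi_periodic Q_good by blast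
  with opn dense disj show ?thesis unfolding integrable_with_tori_def Z_def by blast
qed

end

text \<open>\<open>good_dense\<close> works on a sphere of positive radius. The closure hypothesis
  allows a first small move away from 0, and half of the distance is spent on each move.\<close>

lemma all_good_integrable:
  assumes "expanding G \<Omega>" "expanding (\<lambda>x. - G x) \<Omega>" "S \<subseteq> closure (S - {0})"
  shows "integrable_with_tori TYPE((real^'n) \<times> real) (subtopology (TM_space L \<Gamma>) {(m, v). v \<in> S}) q traj
    (tori (\<lambda>u v. good v))"
proof (rule tori_integrable)
  show "\<exists>d>0. \<forall>u' v'. v' \<in> S \<longrightarrow> dist u' u < d \<longrightarrow> dist v' v < d \<longrightarrow> good v'" if "good v" for u v
    using good_nearby[OF that, of 1] by (metis zero_less_one)
  show "\<exists>u' v'. v' \<in> S \<and> dist u' u < e \<and> dist v' v < e \<and> good v'" if "v \<in> S" "e > 0" for u v and e :: real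
  proof -
    have e2: "e / 2 > 0" using that by simp
    have "v \<in> closure (S - {0})" using assms(3) that by blast
    then have "\<exists>y\<in>S - {0}. dist y v < e / 2" using e2 unfolding closure_approachable by blast
    then obtain v1 where v1: "v1 \<in> S" "v1 \<noteq> 0" "dist v1 v < e / 2" by blast
    from good_dense[OF v1(1,2) e2 assms(1,2)] obtain v2 where "v2 \<in> S" "dist v2 v1 < e / 2" "good v2"
      by blast
    moreover from this v1(3) have "dist v2 v < e" using dist_triangle[of v2 v v1] by linarith
    ultimately show ?thesis using that(2) by (intro exI[of _ u] exI[of _ v2]) simp
  qed
qed (auto intro: good_trj)

end

section \<open>Real-analytic functions\<close>

definition power_series_at :: "('a::euclidean_space \<Rightarrow> 'b::real_normed_vector) \<Rightarrow> 'a \<Rightarrow> bool" where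
  "power_series_at f x \<longleftrightarrow> (\<exists>r>0. \<exists>c :: ('a \<Rightarrow> nat) \<Rightarrow> 'b. \<forall>h. (\<forall>b\<in>Basis. \<bar>h \<bullet> b\<bar> < r) \<longrightarrow>
     ((\<lambda>\<alpha>. (\<Prod>b\<in>Basis. (h \<bullet> b) ^ \<alpha> b) *\<^sub>R c \<alpha>) has_sum f (x + h)) {\<alpha>. \<forall>b. b \<notin> Basis \<longrightarrow> \<alpha> b = 0})"

lemma real_analytic_on_iff: "real_analytic_on f S \<longleftrightarrow> open S \<and> (\<forall>x\<in>S. power_series_at f x)"
  unfolding real_analytic_on_def power_series_at_def by simp

lemma power_series_at_add:
  fixes x :: "'a::euclidean_space"
  assumes "power_series_at f x" "power_series_at g x"
  shows "power_series_at (\<lambda>y. f y + g y) x"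
proof -
  obtain r c where r: "r > 0" and f: "\<And>h. (\<forall>b\<in>Basis. \<bar>h \<bullet> b\<bar> < r) \<Longrightarrow>
     ((\<lambda>\<alpha>. (\<Prod>b\<in>Basis. (h \<bullet> b) ^ \<alpha> b) *\<^sub>R c \<alpha>) has_sum f (x + h)) {\<alpha>. \<forall>b. b \<notin> Basis \<longrightarrow> \<alpha> b = 0}"
    using assms(1) unfolding power_series_at_def by blast
  obtain s d where s: "s > 0" and g: "\<And>h. (\<forall>b\<in>Basis. \<bar>h \<bullet> b\<bar> < s) \<Longrightarrow>
     ((\<lambda>\<alpha>. (\<Prod>b\<in>Basis. (h \<bullet> b) ^ \<alpha> b) *\<^sub>R d \<alpha>) has_sum g (x + h)) {\<alpha>. \<forall>b. b \<notin> Basis \<longrightarrow> \<alpha> b = 0}"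
    using assms(2) unfolding power_series_at_def by blast
  show ?thesis unfolding power_series_at_def
  proof (intro exI[of _ "min r s"] exI[of _ "\<lambda>\<alpha>. c \<alpha> + d \<alpha>"] conjI allI impI)
    fix h :: 'a assume "\<forall>b\<in>Basis. \<bar>h \<bullet> b\<bar> < min r s"
    then have "\<forall>b\<in>Basis. \<bar>h \<bullet> b\<bar> < r" "\<forall>b\<in>Basis. \<bar>h \<bullet> b\<bar> < s" by auto
    from has_sum_add[OF f[OF this(1)] g[OF this(2)]]
    show "((\<lambda>\<alpha>. (\<Prod>b\<in>Basis. (h \<bullet> b) ^ \<alpha> b) *\<^sub>R (c \<alpha> + d \<alpha>)) has_sum f (x + h) + g (x + h))
      {\<alpha>. \<forall>b. b \<notin> Basis \<longrightarrow> \<alpha> b = 0}" by (simp add: scaleR_add_right)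
  qed (use r s in auto)
qed

lemma power_series_at_linear:
  fixes x :: "'a::euclidean_space"
  assumes A: "bounded_linear A" and f: "power_series_at f x"
  shows "power_series_at (\<lambda>y. A (f y)) x"
proof -
  obtain r c where r: "r > 0" and f: "\<And>h. (\<forall>b\<in>Basis. \<bar>h \<bullet> b\<bar> < r) \<Longrightarrow>
     ((\<lambda>\<alpha>. (\<Prod>b\<in>Basis. (h \<bullet> b) ^ \<alpha> b) *\<^sub>R c \<alpha>) has_sum f (x + h)) {\<alpha>. \<forall>b. b \<notin> Basis \<longrightarrow> \<alpha> b = 0}"
    using f unfolding power_series_at_def by blast
  have sc: "A (t *\<^sub>R y) = t *\<^sub>R A y" for t y using A by (simp add: linear_simps(5))
  show ?thesis unfolding power_series_at_def
  proof (intro exI[of _ r] exI[of _ "\<lambda>\<alpha>. A (c \<alpha>)"] conjI allI impI r)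
    fix h :: 'a assume "\<forall>b\<in>Basis. \<bar>h \<bullet> b\<bar> < r"
    from has_sum_bounded_linear[OF A f[OF this]]
    show "((\<lambda>\<alpha>. (\<Prod>b\<in>Basis. (h \<bullet> b) ^ \<alpha> b) *\<^sub>R A (c \<alpha>)) has_sum A (f (x + h)))
      {\<alpha>. \<forall>b. b \<notin> Basis \<longrightarrow> \<alpha> b = 0}" by (simp add: o_def sc)
  qed
qed

lemma power_series_at_eventually_eq:
  fixes x :: "'a::euclidean_space"
  assumes f: "power_series_at f x" and eq: "eventually (\<lambda>y. g y = f y) (nhds x)"
  shows "power_series_at g x"
proof -
  obtain r c where r: "r > 0" and f: "\<And>h. (\<forall>b\<in>Basis. \<bar>h \<bullet> b\<bar> < r) \<Longrightarrow>
     ((\<lambda>\<alpha>. (\<Prod>b\<in>Basis. (h \<bullet> b) ^ \<alpha> b) *\<^sub>R c \<alpha>) has_sum f (x + h)) {\<alpha>. \<forall>b. b \<notin> Basis \<longrightarrow> \<alpha> b = 0}"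
    using f unfolding power_series_at_def by blast
  obtain d where d: "d > 0" "\<And>y. dist y x < d \<Longrightarrow> g y = f y"
    using eq unfolding eventually_nhds_metric by blast
  define s where "s = d / real DIM('a)"
  have s: "s > 0" using d by (simp add: s_def)
  show ?thesis unfolding power_series_at_def
  proof (intro exI[of _ "min r s"] exI[of _ c] conjI allI impI)
    fix h :: 'a assume h: "\<forall>b\<in>Basis. \<bar>h \<bullet> b\<bar> < min r s"
    have "norm h \<le> (\<Sum>b\<in>Basis. \<bar>h \<bullet> b\<bar>)" by (rule norm_le_l1)
    also have "\<dots> < (\<Sum>b\<in>(Basis::'a set). s)" using h by (intro sum_strict_mono) auto
    also have "\<dots> = d" by (simp add: s_def)
    finally have "g (x + h) = f (x + h)" by (intro d(2)) (simp add: dist_norm)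
    then show "((\<lambda>\<alpha>. (\<Prod>b\<in>Basis. (h \<bullet> b) ^ \<alpha> b) *\<^sub>R c \<alpha>) has_sum g (x + h)) {\<alpha>. \<forall>b. b \<notin> Basis \<longrightarrow> \<alpha> b = 0}"
      using f[of h] h by simp
  qed (use r s in auto)
qed

text \<open>Every series below is a series in one coordinate times a fixed power of a second one.
  Sending k to its multi-index is injective, so the sum over all multi-indices is a reindexed sum
  over k. For j = 0 the second coordinate is a dummy, but distinct basis vectors must be
  supplied.\<close>

lemma power_series_at_monomials:
  fixes x :: "'a::euclidean_space"
  assumes p: "p \<in> Basis" "p' \<in> Basis" "p \<noteq> p'"
    and sum: "\<And>h. ((\<lambda>k. ((h \<bullet> p) ^ k * (h \<bullet> p') ^ j) *\<^sub>R d k) has_sum f (x + h)) UNIV"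
  shows "power_series_at f x"
proof -
  define m :: "nat \<Rightarrow> 'a \<Rightarrow> nat" where "m k = (\<lambda>b. if b = p then k else if b = p' then j else 0)" for k
  define c where "c \<alpha> = (if \<alpha> \<in> range m then d (\<alpha> p) else 0)" for \<alpha>
  have inj: "inj m" by (rule injI) (metis m_def)
  have cm: "c (m k) = d k" for k by (simp add: c_def m_def)
  have sub: "range m \<subseteq> {\<alpha>. \<forall>b. b \<notin> Basis \<longrightarrow> \<alpha> b = 0}" using p by (auto simp: m_def)
  have mono: "(\<Prod>b\<in>Basis. (h \<bullet> b) ^ m k b) = (h \<bullet> p) ^ k * (h \<bullet> p') ^ j" for h k
  proof -
    have "(\<Prod>b\<in>Basis. (h \<bullet> b) ^ m k b) = (\<Prod>b\<in>Basis. (if b = p then (h \<bullet> b) ^ k else 1) * (if b = p' then (h \<bullet> b) ^ j else 1))"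
      using p by (intro prod.cong) (auto simp: m_def)
    also have "\<dots> = (h \<bullet> p) ^ k * (h \<bullet> p') ^ j" using p by (simp add: prod.distrib prod.delta)
    finally show ?thesis .
  qed
  show ?thesis unfolding power_series_at_def
  proof (intro exI[of _ 1] exI[of _ c] conjI allI impI)
    fix h :: 'a
    have "((\<lambda>\<alpha>. (\<Prod>b\<in>Basis. (h \<bullet> b) ^ \<alpha> b) *\<^sub>R c \<alpha>) \<circ> m has_sum f (x + h)) UNIV"
      using sum[of h] by (simp add: o_def mono cm)
    then have "((\<lambda>\<alpha>. (\<Prod>b\<in>Basis. (h \<bullet> b) ^ \<alpha> b) *\<^sub>R c \<alpha>) has_sum f (x + h)) (range m)"
      by (simp add: has_sum_reindex[OF inj])
    then show "((\<lambda>\<alpha>. (\<Prod>b\<in>Basis. (h \<bullet> b) ^ \<alpha> b) *\<^sub>R c \<alpha>) has_sum f (x + h)) {\<alpha>. \<forall>b. b \<notin> Basis \<longrightarrow> \<alpha> b = 0}"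
      by (rule has_sum_cong_neutral[THEN iffD1, rotated -1]) (use sub in \<open>auto simp: c_def\<close>)
  qed simp
qed

lemma power_series_at_const:
  assumes p: "p \<in> (Basis :: 'a::euclidean_space set)" "p' \<in> Basis" "p \<noteq> p'"
  shows "power_series_at (\<lambda>_. c) (x :: 'a)"
proof (rule power_series_at_monomials[OF p, of 0 "\<lambda>k. if k = 0 then c else 0"])
  fix h :: 'a
  have "((\<lambda>k. ((h \<bullet> p) ^ k * (h \<bullet> p') ^ 0) *\<^sub>R (if k = 0 then c else 0)) has_sum c) {0}"
    by (rule has_sum_finiteI) auto
  then show "((\<lambda>k. ((h \<bullet> p) ^ k * (h \<bullet> p') ^ 0) *\<^sub>R (if k = 0 then c else 0)) has_sum c) UNIV"
    by (rule has_sum_cong_neutral[THEN iffD1, rotated -1]) auto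
qed

lemma power_series_at_sum:
  assumes p: "p \<in> (Basis :: 'a::euclidean_space set)" "p' \<in> Basis" "p \<noteq> p'"
    and f: "\<And>i. i \<in> I \<Longrightarrow> power_series_at (f i) (x :: 'a)"
  shows "power_series_at (\<lambda>y. \<Sum>i\<in>I. f i y) x"
  using f by (induction I rule: infinite_finite_induct)
    (auto intro: power_series_at_const[OF p] power_series_at_add)

lemma power_series_at_coord_square:
  assumes p: "p \<in> (Basis :: 'a::euclidean_space set)" "p' \<in> Basis" "p \<noteq> p'"
  shows "power_series_at (\<lambda>y. (y \<bullet> p)\<^sup>2) (x :: 'a)"
proof -
  define d :: "nat \<Rightarrow> real" where
    "d k = (if k = 0 then (x \<bullet> p)\<^sup>2 else if k = 1 then 2 * (x \<bullet> p) else if k = 2 then 1 else 0)" for k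
  show ?thesis
  proof (rule power_series_at_monomials[OF p, of 0 d])
    fix h :: 'a
    have "((\<lambda>k. ((h \<bullet> p) ^ k * (h \<bullet> p') ^ 0) *\<^sub>R d k) has_sum ((x + h) \<bullet> p)\<^sup>2) {0, 1, 2}"
      by (rule has_sum_finiteI) (auto simp: d_def inner_add_left power2_eq_square algebra_simps)
    then show "((\<lambda>k. ((h \<bullet> p) ^ k * (h \<bullet> p') ^ 0) *\<^sub>R d k) has_sum ((x + h) \<bullet> p)\<^sup>2) UNIV"
      by (rule has_sum_cong_neutral[THEN iffD1, rotated -1]) (auto simp: d_def)
  qed
qed

text \<open>As functions of s both sides solve y' = L y with the same initial value.\<close>

lemma lin_exp_add:
  fixes L :: "'a::euclidean_space \<Rightarrow> 'a"
  assumes L: "linear L"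
  shows "lin_exp (\<lambda>v. (s + u) *\<^sub>R L v) x = lin_exp (\<lambda>v. s *\<^sub>R L v) (lin_exp (\<lambda>v. u *\<^sub>R L v) x)"
proof -
  let ?E = "\<lambda>u. lin_exp (\<lambda>v. u *\<^sub>R L v)"
  have 1: "((\<lambda>s. ?E (1 * s + u) x) has_vector_derivative 1 *\<^sub>R L (?E (1 * s + u) x)) (at s)" for s
    unfolding lin_exp_commute[OF L]
    by (rule vector_derivative_comp_affine) (rule has_vector_derivative_lin_exp[OF L])
  have 2: "((\<lambda>s. ?E s (?E u x)) has_vector_derivative L (?E s (?E u x))) (at s)" for s
    using has_vector_derivative_lin_exp[OF L, of "?E u x" s] by (simp only: lin_exp_commute[OF L])
  have "norm (1 *\<^sub>R L y - L z) \<le> onorm L * norm (y - z)" for y z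
    using onorm[of L "y - z"] L by (simp add: linear_conv_bounded_linear[symmetric] linear_diff)
  from ode_dist_le[OF 1 2 this, of s] show ?thesis by (simp add: lin_exp_0[OF L, simplified])
qed

text \<open>The group law moves the centre of expansion to the time \<open>u\<close> of x. Linearity
  in the vector leaves a constant vector plus one term per coordinate increment, each an exponential
  series in the time increment times at most one further coordinate.\<close>

lemma power_series_at_lin_exp:
  fixes L :: "'a::euclidean_space \<Rightarrow> 'a" and x :: "('b::euclidean_space \<times> real) \<times> ('a \<times> real)"
  assumes L: "linear L"
  shows "power_series_at (\<lambda>p. lin_exp (\<lambda>v. snd (fst p) *\<^sub>R L v) (fst (snd p))) x"
proof -
  \<comment> \<open>Unit vectors of the u-, \<eta>- and \<xi>-directions; the \<eta>-direction
    enters with exponent 0 only.\<close>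
  define bu where "bu = ((0::'b, 1::real), (0::'a, 0::real))"
  define be where "be = ((0::'b, 0::real), (0::'a, 1::real))"
  define bx where "bx b = ((0::'b, 0::real), (b::'a, 0::real))" for b
  have B: "bu \<in> Basis" "be \<in> Basis" "bu \<noteq> be" "\<And>b. b \<in> Basis \<Longrightarrow> bx b \<in> Basis" "\<And>b. bu \<noteq> bx b"
    by (auto simp: bu_def be_def bx_def Basis_prod_def image_iff zero_prod_def)
  have ip: "h \<bullet> bu = snd (fst h)" "h \<bullet> bx b = fst (snd h) \<bullet> b"
    for h :: "('b \<times> real) \<times> ('a \<times> real)" and b
    by (auto simp: bu_def bx_def inner_prod_def)
  define u where "u = snd (fst x)"
  let ?E = "\<lambda>u. lin_exp (\<lambda>v. u *\<^sub>R L v)"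
  have hs: "((\<lambda>k. s ^ k *\<^sub>R ((L ^^ k) y /\<^sub>R fact k)) has_sum ?E s y) UNIV" for s y
    by (rule norm_summable_imp_has_sum[OF summable_norm_lin_exp[OF L] lin_exp_sums[OF L]])
  have 1: "power_series_at (\<lambda>p. ?E (snd (fst p) - u) (?E u (fst (snd x)))) x"
  proof (rule power_series_at_monomials[OF B(1,2,3), of 0 "\<lambda>k. (L ^^ k) (?E u (fst (snd x))) /\<^sub>R fact k"])
    show "((\<lambda>k. ((h \<bullet> bu) ^ k * (h \<bullet> be) ^ 0) *\<^sub>R ((L ^^ k) (?E u (fst (snd x))) /\<^sub>R fact k)) has_sum
      ?E (snd (fst (x + h)) - u) (?E u (fst (snd x)))) UNIV" for h
      using hs[of "snd (fst h)"] by (simp add: ip u_def)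
  qed
  have 2: "power_series_at (\<lambda>p. ((fst (snd p) - fst (snd x)) \<bullet> b) *\<^sub>R ?E (snd (fst p) - u) (?E u b)) x"
    if b: "b \<in> Basis" for b
  proof (rule power_series_at_monomials[OF B(1) B(4)[OF b] B(5), of 1 "\<lambda>k. (L ^^ k) (?E u b) /\<^sub>R fact k"])
    fix h :: "('b \<times> real) \<times> ('a \<times> real)"
    have "((\<lambda>k. (fst (snd h) \<bullet> b) *\<^sub>R (snd (fst h) ^ k *\<^sub>R ((L ^^ k) (?E u b) /\<^sub>R fact k))) has_sum
      (fst (snd h) \<bullet> b) *\<^sub>R ?E (snd (fst h)) (?E u b)) UNIV"
      using has_sum_bounded_linear[OF bounded_linear_scaleR_right hs[of "snd (fst h)" "?E u b"], of "fst (snd h) \<bullet> b"]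
      by (simp add: o_def)
    then show "((\<lambda>k. ((h \<bullet> bu) ^ k * (h \<bullet> bx b) ^ 1) *\<^sub>R ((L ^^ k) (?E u b) /\<^sub>R fact k)) has_sum
      ((fst (snd (x + h)) - fst (snd x)) \<bullet> b) *\<^sub>R ?E (snd (fst (x + h)) - u) (?E u b)) UNIV"
      by (simp add: ip u_def mult_ac)
  qed
  have eq: "?E (snd (fst p)) (fst (snd p)) = ?E (snd (fst p) - u) (?E u (fst (snd x)))
      + (\<Sum>b\<in>Basis. ((fst (snd p) - fst (snd x)) \<bullet> b) *\<^sub>R ?E (snd (fst p) - u) (?E u b))"
    for p :: "('b \<times> real) \<times> ('a \<times> real)"
  proof -
    let ?s = "snd (fst p) - u"
    have "?E (snd (fst p)) (fst (snd p)) = ?E (?s + u) (fst (snd p))" by simp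
    also have "\<dots> = ?E ?s (?E u (fst (snd x) + (fst (snd p) - fst (snd x))))" unfolding lin_exp_add[OF L] by simp
    also have "\<dots> = ?E ?s (?E u (fst (snd x))) + ?E ?s (?E u (fst (snd p) - fst (snd x)))"
      by (simp only: linear_add[OF linear_lin_exp[OF L]])
    also have "?E u (fst (snd p) - fst (snd x)) = (\<Sum>b\<in>Basis. ((fst (snd p) - fst (snd x)) \<bullet> b) *\<^sub>R ?E u b)"
      by (rule lin_exp_expand[OF L])
    finally show ?thesis by (simp only: linear_sum[OF linear_lin_exp[OF L]] linear_scale[OF linear_lin_exp[OF L]])
  qed
  have "power_series_at (\<lambda>p. ?E (snd (fst p) - u) (?E u (fst (snd x)))
      + (\<Sum>b\<in>Basis. ((fst (snd p) - fst (snd x)) \<bullet> b) *\<^sub>R ?E (snd (fst p) - u) (?E u b))) x"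
    by (intro power_series_at_add 1 power_series_at_sum[OF B(1,2,3)] 2)
  then show ?thesis by (rule power_series_at_eventually_eq[OF _ always_eventually]) (intro allI eq)
qed

lemma power_series_at_norm_square_snd:
  fixes x :: "('b::euclidean_space \<times> real) \<times> ('a::euclidean_space \<times> real)"
  shows "power_series_at (\<lambda>p. (norm (snd p))\<^sup>2) x"
proof -
  define bu where "bu = ((0::'b, 1::real), (0::'a, 0::real))"
  define b2 where "b2 b = ((0::'b, 0::real), (b::'a \<times> real))" for b
  have B: "bu \<in> Basis" "\<And>b. b \<in> Basis \<Longrightarrow> b2 b \<in> Basis" "\<And>b. b \<in> Basis \<Longrightarrow> b2 b \<noteq> bu"
    by (auto simp: bu_def b2_def Basis_prod_def image_iff zero_prod_def)
  have "power_series_at (\<lambda>p. \<Sum>b\<in>Basis. (p \<bullet> b2 b)\<^sup>2) x"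
  proof (rule power_series_at_sum)
    have "(0, 1) \<in> (Basis :: ('a \<times> real) set)" by (simp add: Basis_prod_def)
    from B(2)[OF this] B(3)[OF this] show "b2 (0, 1) \<in> Basis" "b2 (0, 1) \<noteq> bu" .
    show "power_series_at (\<lambda>p. (p \<bullet> b2 b)\<^sup>2) x" if "b \<in> Basis" for b
      by (rule power_series_at_coord_square[OF B(2)[OF that] B(1) B(3)[OF that]])
  qed (rule B(1))
  moreover have "(\<Sum>b\<in>Basis. (p \<bullet> b2 b)\<^sup>2) = (norm (snd p))\<^sup>2" for p :: "('b \<times> real) \<times> ('a \<times> real)"
  proof -
    have "p \<bullet> b2 b = snd p \<bullet> b" for b by (simp add: b2_def inner_prod_def)
    then have "(\<Sum>b\<in>Basis. (p \<bullet> b2 b)\<^sup>2) = (\<Sum>b\<in>Basis. (snd p \<bullet> b) * (snd p \<bullet> b))"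
      by (simp add: power2_eq_square)
    also have "\<dots> = snd p \<bullet> snd p" by (rule euclidean_inner[symmetric])
    also have "\<dots> = (norm (snd p))\<^sup>2" by (rule power2_norm_eq_inner[symmetric])
    finally show ?thesis .
  qed
  ultimately show ?thesis by simp
qed

section \<open>The quadratic system\<close>

lemma connected_component_if_clopen:
  assumes T: "connectedin X T" "openin X T" "openin X (topspace X - T)" "x \<in> T"
  shows "T \<in> connected_components_of X"
proof -
  let ?C = "connected_component_of_set X x"
  have x: "x \<in> topspace X" using T openin_subset by blast
  have TC: "T \<subseteq> ?C" by (rule connected_component_of_maximal[OF T(1,4)])
  have "?C \<subseteq> T"
  proof (rule ccontr)
    assume "\<not> ?C \<subseteq> T"
    moreover have C: "connectedin X ?C" by (rule connectedin_connected_component_of)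
    then have "?C \<subseteq> topspace X" by (rule connectedin_subset_topspace)
    ultimately have "?C \<subseteq> T \<union> (topspace X - T)" "T \<inter> (topspace X - T) \<inter> ?C = {}" "T \<inter> ?C \<noteq> {}"
      "(topspace X - T) \<inter> ?C \<noteq> {}" using T(4) TC by auto
    with C T(2,3) show False unfolding connectedin by blast
  qed
  then have "T = ?C" using TC by blast
  then show ?thesis using x by (simp add: connected_component_in_connected_components_of)
qed

lemma continuous_map_TM_proj: "continuous_map euclidean (TM_space L \<Gamma>) (TM_proj L \<Gamma>)"
  by (auto simp: continuous_map_def topspace_TM_space openin_TM_space)

text \<open>An enumeration of the rationals, so that an interval can be named by the index of a
  rational in it.\<close>

definition rat_seq :: "nat \<Rightarrow> real" where "rat_seq i = of_rat (from_nat i)"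

lemma rat_seq_dense:
  assumes "x < y" obtains i where "x < rat_seq i" "rat_seq i < y"
proof -
  obtain p where "x < of_rat p" "of_rat p < y" using of_rat_dense[OF assms] by blast
  moreover obtain i where "p = from_nat i" using surj_from_nat[where 'a=rat] by (metis surjD)
  ultimately show thesis using that by (simp add: rat_seq_def)
qed

lemma const_if_derivative_0:
  fixes f :: "real \<Rightarrow> 'z::real_normed_vector"
  assumes "\<And>t. (f has_vector_derivative 0) (at t)" shows "f t = f 0"
  using same_vector_derivative_diff_eq[of f "\<lambda>_. 0" "\<lambda>_. 0" t 0] assms by simp

locale LF_linear = LF_lattice "(*v) F" UNIV UNIV K L \<Gamma>
  for F :: "real^'n^'n" and K L \<Gamma>
begin

lemma linear_F: "linear ((*v) F)" and linear_mF: "linear (\<lambda>v. - (F *v v))"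
  by (simp_all add: matrix_vector_mul_linear linear_compose_neg)

text \<open>The momentum at \<open>u = 0\<close> of the orbit of the flow of \<open>F\<close> through \<open>\<xi>\<close> at time \<open>u\<close>.\<close>
definition mom :: "real \<Rightarrow> real^'n \<Rightarrow> real^'n" where
  "mom u = lin_exp (\<lambda>v. u *\<^sub>R (- (F *v v)))"

definition flow :: "real \<Rightarrow> real^'n \<Rightarrow> real^'n" where
  "flow u = lin_exp (\<lambda>v. u *\<^sub>R (F *v v))"

lemma flow_mom: "flow u (mom u x) = x"
proof -
  have "((\<lambda>u. flow u (mom u x)) has_vector_derivative 1 *\<^sub>R flow u (F *v mom u x) + flow u (mom u (- (F *v x)))) (at u)" for u
    unfolding flow_def mom_def
    by (rule has_vector_derivative_lin_exp_comp[OF linear_F _ has_vector_derivative_lin_exp[OF linear_mF]])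
      (auto intro!: derivative_eq_intros simp: has_real_derivative_iff_has_vector_derivative[symmetric])
  moreover have "mom u (- (F *v x)) = - (F *v mom u x)" for u
    unfolding mom_def using lin_exp_commute[OF linear_mF, of u x] by simp
  moreover have "flow u (- y) = - flow u y" for u y
    unfolding flow_def by (rule linear_neg[OF linear_lin_exp[OF linear_F]])
  ultimately have "((\<lambda>u. flow u (mom u x)) has_vector_derivative 0) (at u)" for u by simp
  from const_if_derivative_0[OF this, of u] show ?thesis
    unfolding flow_def mom_def using lin_exp_0[OF linear_F] lin_exp_0[OF linear_mF] by simp
qed

lemma linear_mom: "linear (mom u)"
  unfolding mom_def by (rule linear_lin_exp[OF linear_mF])

lemma mom_inj: "mom u x = mom u y \<Longrightarrow> x = y"
  using flow_mom by metis

text \<open>Since u' = \<eta> and \<xi>' = \<eta> F \<xi>, the two terms of the product rule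
  cancel.\<close>

lemma mom_trj: "mom (u + hgt v t) (fst (trj v t)) = mom u (fst v)"
proof -
  have "((\<lambda>t. mom (u + hgt v t) (fst (trj v t))) has_vector_derivative
     snd (trj v t) *\<^sub>R mom (u + hgt v t) (- (F *v fst (trj v t)))
     + mom (u + hgt v t) (snd (trj v t) *\<^sub>R (F *v fst (trj v t)))) (at t)" for t
    unfolding mom_def
  proof (rule has_vector_derivative_lin_exp_comp[OF linear_mF])
    show "((\<lambda>t. u + hgt v t) has_vector_derivative snd (trj v t)) (at t)"
      using has_vector_derivative_add[OF has_vector_derivative_const[of u] hgt_vder[of v t]] by simp
    show "((\<lambda>t. fst (trj v t)) has_vector_derivative snd (trj v t) *\<^sub>R (F *v fst (trj v t))) (at t)"
      using bounded_linear.has_vector_derivative[OF bounded_linear_fst trj_der[of v t]] by (simp add: LF_red_def)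
  qed
  moreover have "s *\<^sub>R mom w (- y) + mom w (s *\<^sub>R y) = 0" for s w y
    by (simp add: linear_neg[OF linear_mom] linear_scale[OF linear_mom])
  ultimately have "((\<lambda>t. mom (u + hgt v t) (fst (trj v t))) has_vector_derivative 0) (at t)" for t by simp
  from const_if_derivative_0[OF this, of t] show ?thesis by (simp add: hgt_0 trj_0)
qed

lemma fst_trj: "fst (trj v t) = flow (u + hgt v t) (mom u (fst v))"
  using mom_trj[of u v t] flow_mom[of "u + hgt v t" "fst (trj v t)"] by simp

text \<open>The values of u along the trajectory: for good v, the potential well between the turning
  points.\<close>

definition J :: "real \<Rightarrow> 'n alg \<Rightarrow> real set" where
  "J u v = range (\<lambda>t. u + hgt v t)"

lemma J_orb: "J (u + hgt v t) (trj v t) = J u v"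
proof -
  have *: "u + hgt v t + hgt (trj v t) s = u + hgt v (s + t)" for s by (simp add: hgt_add)
  have "u + hgt v s \<in> range (\<lambda>s. u + hgt v (s + t))" for s
    by (rule range_eqI[of _ _ "s - t"]) simp
  then show ?thesis unfolding J_def * by auto
qed

lemma norm_sq: "(norm (v :: 'n alg))\<^sup>2 = (norm (fst v))\<^sup>2 + (snd v)\<^sup>2"
  using norm_Pair[of "fst v" "snd v"] by simp

text \<open>Momentum and u determine \<xi>, and the norm then determines \<eta> up to sign. The
  opposite sign is met on the same trajectory, at the time mirrored at the turning point a.\<close>

lemma level_orbit:
  assumes m: "mom u' (fst v') = mom u (fst v)" and n: "norm v' = norm v"
    and J: "u' \<in> J u v" and a: "snd (trj v a) = 0"
  obtains t where "u' = u + hgt v t" "v' = trj v t"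
proof -
  obtain t where t: "u' = u + hgt v t" using J by (auto simp: J_def)
  have f: "fst v' = fst (trj v t)" by (rule mom_inj[of u']) (use m mom_trj[of u v t] t in simp)
  have "(norm v')\<^sup>2 = (norm (trj v t))\<^sup>2" using n trj_norm[of v t] by simp
  then have "(snd v')\<^sup>2 = (snd (trj v t))\<^sup>2" unfolding norm_sq f by simp
  then consider "snd v' = snd (trj v t)" | "snd v' = - snd (trj v t)" by (auto simp: power2_eq_iff)
  then show thesis
  proof cases
    case 1 then show ?thesis using that[of t] t f by (simp add: prod_eq_iff)
  next
    case 2
    have e: "a - (t - a) = 2 * a - t" "a + (t - a) = t" by simp_all
    show ?thesis using that[of "2 * a - t"] trj_reflect[OF UNIV_I a, of "t - a"] t f 2 unfolding e by (simp add: prod_eq_iff)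
  qed
qed

text \<open>A continuous periodic height attains its extrema, and there its derivative \<eta>
  vanishes. They differ because the height is injective between consecutive turning points.\<close>

lemma hgt_extrema:
  assumes "good v"
  obtains tA tB where "hgt v tA < hgt v tB" "\<And>t. hgt v tA \<le> hgt v t" "\<And>t. hgt v t \<le> hgt v tB"
    "snd (trj v tA) = 0" "snd (trj v tB) = 0"
proof -
  obtain a b where ab: "a < b" "snd (trj v a) = 0" "snd (trj v b) = 0"
    and nz: "\<And>t. a < t \<Longrightarrow> t < b \<Longrightarrow> snd (trj v t) \<noteq> 0" using good_turning_points[OF assms] by blast
  define P where "P = 2 * (b - a)"
  have P: "P > 0" using ab by (simp add: P_def)
  have cpt: "compact {a..a + P}" "{a..a + P} \<noteq> {}" "continuous_on {a..a + P} (hgt v)" using P hgt_cont[of v] by auto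
  obtain tA where tA: "\<And>t. t \<in> {a..a + P} \<Longrightarrow> hgt v tA \<le> hgt v t" using continuous_attains_inf[OF cpt] by blast
  obtain tB where tB: "\<And>t. t \<in> {a..a + P} \<Longrightarrow> hgt v t \<le> hgt v tB" using continuous_attains_sup[OF cpt] by blast
  have red: "\<exists>s\<in>{a..a + P}. hgt v s = hgt v t" for t
  proof -
    define k where "k = - \<lfloor>(t - a) / P\<rfloor>"
    define s where "s = t + of_int k * P"
    have "of_int (- k) \<le> (t - a) / P" "(t - a) / P < of_int (- k) + 1" unfolding k_def by simp_all
    then have "a \<le> s" "s < a + P" using P by (auto simp: s_def field_simps)
    moreover have "hgt v s = hgt v t" using trj_period_int[OF UNIV_I ab(2,3), of t k] by (simp add: s_def P_def)
    ultimately show ?thesis by (intro bexI[of _ s]) auto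
  qed
  have le: "hgt v tA \<le> hgt v t" "hgt v t \<le> hgt v tB" for t using red[of t] tA tB by metis+
  have "hgt v a \<noteq> hgt v b"
  proof
    assume "hgt v a = hgt v b"
    then have "a = b" by (rule hgt_inj_on_monotone[OF UNIV_I nz, rotated -1]) (use ab in auto)
    then show False using ab by simp
  qed
  then have "hgt v tA < hgt v tB" using le[of a] le[of b] by linarith
  moreover have "snd (trj v tA) = 0"
    by (rule DERIV_local_min[OF hgt_der[OF UNIV_I, of v tA], of 1]) (use le in auto)
  moreover have "snd (trj v tB) = 0"
    by (rule DERIV_local_max[OF hgt_der[OF UNIV_I, of v tB], of 1]) (use le in auto)
  ultimately show thesis using that le by blast
qed

lemma J_connected:
  assumes "x \<in> J u v" "y \<in> J u v" shows "{x..y} \<subseteq> J u v"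
proof (rule connected_contains_Icc[OF _ assms])
  show "connected (J u v)" unfolding J_def
    by (rule connected_continuous_image[OF continuous_on_add[OF continuous_on_const hgt_cont[OF UNIV_I]] connected_UNIV])
qed

text \<open>All elements of a coset in M have the same u, so the choice of a representative does not
  matter.\<close>

definition uc :: "'n grp set \<Rightarrow> real" where "uc m = snd (SOME g. g \<in> m)"

lemma uc_q: "uc (fst (q p)) = snd (fst p)" "snd (q p) = snd p"
proof -
  obtain w u v where p: "p = ((w, u), v)" by (metis prod.collapse)
  have "(0 + w, u) \<in> M_proj L \<Gamma> (w, u)" unfolding M_proj_eq using lattice_0 by blast
  then have "(SOME g. g \<in> M_proj L \<Gamma> (w, u)) \<in> M_proj L \<Gamma> (w, u)" by (rule someI)
  then have "snd (SOME g. g \<in> M_proj L \<Gamma> (w, u)) = u" by (auto simp: M_proj_eq)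
  then show "uc (fst (q p)) = snd (fst p)" "snd (q p) = snd p" by (simp_all add: p TM_proj_def uc_def)
qed

definition f_glob :: "'n grp set \<times> 'n alg \<Rightarrow> (real^'n) \<times> real" where
  "f_glob y = (mom (uc (fst y)) (fst (snd y)), (norm (snd y))\<^sup>2)"

lemma f_glob_q: "f_glob (q p) = (mom (snd (fst p)) (fst (snd p)), (norm (snd p))\<^sup>2)"
  by (simp add: f_glob_def uc_q)

lemma f_glob_orb: "p \<in> orb u v \<Longrightarrow> f_glob (q p) = (mom u (fst v), (norm v)\<^sup>2)"
  unfolding f_glob_q orb_def by (auto simp: mom_trj trj_norm)

lemma power_series_f_glob: "power_series_at (f_glob \<circ> q) x"
proof -
  have "power_series_at (\<lambda>p::'n grp \<times> 'n alg. mom (snd (fst p)) (fst (snd p))) x"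
    unfolding mom_def by (rule power_series_at_lin_exp[OF linear_mF])
  then have 1: "power_series_at (\<lambda>p::'n grp \<times> 'n alg. (mom (snd (fst p)) (fst (snd p)), 0::real)) x"
    by (rule power_series_at_linear[rotated]) (intro bounded_linear_Pair bounded_linear_ident bounded_linear_zero)
  have 2: "power_series_at (\<lambda>p::'n grp \<times> 'n alg. (0::real^'n, (norm (snd p))\<^sup>2)) x"
    by (rule power_series_at_linear[OF _ power_series_at_norm_square_snd])
      (intro bounded_linear_Pair bounded_linear_ident bounded_linear_zero)
  have "(f_glob \<circ> q) = (\<lambda>p. (mom (snd (fst p)) (fst (snd p)), 0) + (0, (norm (snd p))\<^sup>2))"
    by (simp add: fun_eq_iff f_glob_q)
  with power_series_at_add[OF 1 2] show ?thesis by simp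
qed

lemma traj_orbit:
  assumes "\<gamma> \<in> traj"
  obtains u v where "\<And>t. \<exists>w. \<gamma> t = q ((w, u + hgt v t), trj v t)"
proof -
  obtain c where c: "\<gamma> = q \<circ> c" using assms unfolding traj_def LF_TM_def by blast
  obtain w u v where "c 0 = ((w, u), v)" by (metis prod.collapse)
  then have "\<gamma> 0 = q ((w, u), v)" by (simp add: c)
  from traj_in_orbit[OF assms this UNIV_I]
  have "\<exists>w. \<gamma> t = q ((w, u + hgt v t), trj v t)" for t by (simp add: image_iff)
  then show thesis by (rule that)
qed

lemma f_glob_first_integral: "analytic_first_integral_on (topspace (TM_space L \<Gamma>)) q traj f_glob"
  unfolding analytic_first_integral_on_def real_analytic_on_iff
proof (intro conjI ballI impI allI)
  show "open {x. q x \<in> topspace (TM_space L \<Gamma>)}" by (simp add: topspace_TM_space)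
  show "power_series_at (f_glob \<circ> q) x" for x by (rule power_series_f_glob)
  fix \<gamma> t assume "\<gamma> \<in> traj"
  then obtain u v where g: "\<And>t. \<exists>w. \<gamma> t = q ((w, u + hgt v t), trj v t)" using traj_orbit by blast
  have "f_glob (\<gamma> t) = (mom u (fst v), (norm v)\<^sup>2)" for t
  proof -
    obtain w where "\<gamma> t = q ((w, u + hgt v t), trj v t)" using g by blast
    then show ?thesis using f_glob_orb[of "((w, u + hgt v t), trj v t)" u v] by (auto simp: orb_def)
  qed
  then show "f_glob (\<gamma> t) = f_glob (\<gamma> 0)" by simp
qed

text \<open>For fixed momentum, |\<xi>|^2 is a function V of u, and the level set requires V(u)
  \<le> |v|^2. V crosses the level with nonzero derivative at both ends of the well, so the level
  set has a gap beyond each end. The torus is thus relatively clopen in it, and it is connected as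
  an image of \<open>orb u v\<close>.\<close>

lemma torus_is_component:
  assumes "good v"
  shows "q ` orb u v \<in> connected_components_of
    (subtopology (TM_space L \<Gamma>) {p \<in> topspace (TM_space L \<Gamma>). f_glob p = (mom u (fst v), (norm v)\<^sup>2)})"
proof -
  define Lv where "Lv = {p \<in> topspace (TM_space L \<Gamma>). f_glob p = (mom u (fst v), (norm v)\<^sup>2)}"
  have "X v \<noteq> 0" using assms by (simp add: good_def)
  obtain tA tB where t: "hgt v tA < hgt v tB" "\<And>t. hgt v tA \<le> hgt v t" "\<And>t. hgt v t \<le> hgt v tB"
    "snd (trj v tA) = 0" "snd (trj v tB) = 0" using hgt_extrema[OF assms] by blast
  define A where "A = u + hgt v tA"
  define B where "B = u + hgt v tB"
  have AB: "A < B" using t(1) by (simp add: A_def B_def)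
  have JAB: "J u v = {A..B}"
  proof
    show "J u v \<subseteq> {A..B}" using t by (auto simp: J_def A_def B_def)
    have "A \<in> J u v" "B \<in> J u v" by (auto simp: J_def A_def B_def)
    then show "{A..B} \<subseteq> J u v" by (rule J_connected)
  qed
  define V where "V s = (norm (flow s (mom u (fst v))))\<^sup>2" for s
  have Vd: "(V has_real_derivative 2 * ((F *v flow s (mom u (fst v))) \<bullet> flow s (mom u (fst v)))) (at s)" for s
  proof -
    have d: "((\<lambda>s. flow s (mom u (fst v))) has_vector_derivative F *v flow s (mom u (fst v))) (at s)" for s
      unfolding flow_def lin_exp_commute[OF linear_F] by (rule has_vector_derivative_lin_exp[OF linear_F])
    from bounded_bilinear.has_vector_derivative[OF bounded_bilinear_inner d d, of s] show ?thesis
      unfolding V_def power2_norm_eq_inner by (simp add: has_real_derivative_iff_has_vector_derivative inner_commute)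
  qed
  have lev: "(norm v)\<^sup>2 = V (snd (fst p)) + (snd (snd p))\<^sup>2" if "q p \<in> Lv" for p
  proof -
    have m: "mom (snd (fst p)) (fst (snd p)) = mom u (fst v)" "(norm (snd p))\<^sup>2 = (norm v)\<^sup>2"
      using that by (auto simp: Lv_def f_glob_q)
    have "fst (snd p) = flow (snd (fst p)) (mom u (fst v))" using flow_mom[of "snd (fst p)"] m(1) by metis
    then show ?thesis using m(2) norm_sq[of "snd p"] by (simp add: V_def)
  qed
  have Vt: "(norm v)\<^sup>2 = V (u + hgt v s) + (snd (trj v s))\<^sup>2" for s
    using norm_sq[of "trj v s"] trj_norm[of v s] fst_trj[of v s u] by (simp add: V_def)
  have Vle: "V s \<le> (norm v)\<^sup>2" if s: "s \<in> {A..B}" for s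
  proof -
    obtain t where t: "s = u + hgt v t" using s unfolding JAB[symmetric] J_def by blast
    show ?thesis unfolding t using Vt[of t] zero_le_power2[of "snd (trj v t)"] by linarith
  qed
  have VA: "V A = (norm v)\<^sup>2" "V B = (norm v)\<^sup>2" using Vt[of tA] Vt[of tB] t by (auto simp: A_def B_def)
  \<comment> \<open>This is the derivative of V, and it is nonzero by the nondegeneracy of turning
    points.\<close>
  have nd: "2 * ((F *v flow (u + hgt v s) (mom u (fst v))) \<bullet> flow (u + hgt v s) (mom u (fst v))) \<noteq> 0"
    if "snd (trj v s) = 0" for s
    using turning_point_nondegenerate[OF UNIV_I \<open>X v \<noteq> 0\<close> that] fst_trj[of v s u] by simp
  define DA where "DA = 2 * ((F *v flow A (mom u (fst v))) \<bullet> flow A (mom u (fst v)))"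
  define DB where "DB = 2 * ((F *v flow B (mom u (fst v))) \<bullet> flow B (mom u (fst v)))"
  have D0: "DA \<noteq> 0" "DB \<noteq> 0" using nd[OF t(4)] nd[OF t(5)] by (auto simp: DA_def DB_def A_def B_def)
  have VdA: "(V has_real_derivative DA) (at A)" and VdB: "(V has_real_derivative DB) (at B)"
    unfolding DA_def DB_def by (rule Vd)+
  \<comment> \<open>Inside the well V does not exceed its value at B, so it cannot decrease into B.
    Being nonzero, \<open>DB\<close> is positive, and V rises above the level beyond B;
    symmetrically at A.\<close>
  have "\<not> DB < 0"
  proof
    assume "DB < 0"
    from DERIV_neg_dec_left[OF VdB this] obtain d where d: "d > 0" "\<And>h. 0 < h \<Longrightarrow> h < d \<Longrightarrow> V B < V (B - h)" by blast
    define h where "h = min (d / 2) (B - A)"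
    have "V B < V (B - h)" by (rule d(2)) (use d(1) AB in \<open>auto simp: h_def\<close>)
    moreover have "V (B - h) \<le> V B" unfolding VA by (rule Vle) (use d(1) AB in \<open>auto simp: h_def\<close>)
    ultimately show False by simp
  qed
  then have "DB > 0" using D0 by simp
  from DERIV_pos_inc_right[OF VdB this] obtain dB where dB: "dB > 0" "\<And>h. 0 < h \<Longrightarrow> h < dB \<Longrightarrow> V B < V (B + h)" by blast
  have "\<not> DA > 0"
  proof
    assume "DA > 0"
    from DERIV_pos_inc_right[OF VdA this] obtain d where d: "d > 0" "\<And>h. 0 < h \<Longrightarrow> h < d \<Longrightarrow> V A < V (A + h)" by blast
    define h where "h = min (d / 2) (B - A)"
    have "V A < V (A + h)" by (rule d(2)) (use d(1) AB in \<open>auto simp: h_def\<close>)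
    moreover have "V (A + h) \<le> V A" unfolding VA by (rule Vle) (use d(1) AB in \<open>auto simp: h_def\<close>)
    ultimately show False by simp
  qed
  then have "DA < 0" using D0 by simp
  from DERIV_neg_dec_left[OF VdA this] obtain dA where dA: "dA > 0" "\<And>h. 0 < h \<Longrightarrow> h < dA \<Longrightarrow> V A < V (A - h)" by blast
  have gap: "snd (fst p) \<in> {A..B}" if p: "q p \<in> Lv" "A - dA < snd (fst p)" "snd (fst p) < B + dB" for p
  proof (rule ccontr)
    assume "snd (fst p) \<notin> {A..B}"
    then consider "snd (fst p) < A" | "snd (fst p) > B" by force
    then have "V (snd (fst p)) > (norm v)\<^sup>2"
    proof cases
      case 1 then show ?thesis using dA(2)[of "A - snd (fst p)"] p VA by simp
    next
      case 2 then show ?thesis using dB(2)[of "snd (fst p) - B"] p VA by simp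
    qed
    then show False using lev[OF p(1)] by (smt (verit) zero_le_power2)
  qed
  have inT: "q p \<in> q ` orb u v \<longleftrightarrow> q p \<in> Lv \<and> snd (fst p) \<in> {A..B}" for p
  proof
    assume "q p \<in> q ` orb u v"
    then have p: "p \<in> orb u v" by (simp add: orb_saturated)
    then have "snd (fst p) \<in> J u v" by (auto simp: orb_def J_def)
    moreover have "q p \<in> Lv" using f_glob_orb[OF p] by (auto simp: Lv_def topspace_TM_space)
    ultimately show "q p \<in> Lv \<and> snd (fst p) \<in> {A..B}" using JAB by simp
  next
    assume p: "q p \<in> Lv \<and> snd (fst p) \<in> {A..B}"
    then have "mom (snd (fst p)) (fst (snd p)) = mom u (fst v)" "norm (snd p) = norm v"
      by (auto simp: Lv_def f_glob_q)
    from level_orbit[OF this _ t(4)] p obtain s where "snd (fst p) = u + hgt v s" "snd p = trj v s"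
      unfolding JAB by blast
    then have "p = ((fst (fst p), u + hgt v s), trj v s)" by (simp add: prod_eq_iff)
    then show "q p \<in> q ` orb u v" unfolding orb_def by blast
  qed
  have mem: "q p \<in> q ` {p. snd (fst p) \<in> U} \<longleftrightarrow> snd (fst p) \<in> U" for p U
  proof
    assume "q p \<in> q ` {p. snd (fst p) \<in> U}"
    then obtain p' where "q p = q p'" "snd (fst p') \<in> U" by blast
    then show "snd (fst p) \<in> U" using uc_q(1)[of p] uc_q(1)[of p'] by simp
  qed blast
  have opn: "openin (TM_space L \<Gamma>) (q ` {p. snd (fst p) \<in> U})" if U: "open U" for U :: "real set"
  proof -
    have "{p. q p \<in> q ` {p. snd (fst p) \<in> U}} = {p. snd (fst p) \<in> U}"
      using mem by (intro set_eqI) simp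
    moreover have "open ((\<lambda>p :: 'n grp \<times> 'n alg. snd (fst p)) -` U)"
      by (intro open_vimage U continuous_intros)
    ultimately show ?thesis unfolding openin_TM_space by (auto simp: vimage_def)
  qed
  have Lvq: "Lv \<subseteq> range q" by (auto simp: Lv_def topspace_TM_space)
  let ?Z = "subtopology (TM_space L \<Gamma>) Lv"
  have top: "topspace ?Z = Lv" by (auto simp: Lv_def)
  have T1: "q ` orb u v = q ` {p. snd (fst p) \<in> {A - dA<..<B + dB}} \<inter> Lv"
  proof (intro set_eqI)
    fix y
    show "y \<in> q ` orb u v \<longleftrightarrow> y \<in> q ` {p. snd (fst p) \<in> {A - dA<..<B + dB}} \<inter> Lv"
    proof (cases "y \<in> range q")
      case True
      then obtain p where y: "y = q p" by blast
      show ?thesis unfolding y Int_iff mem inT using gap[of p] dA(1) dB(1) by auto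
    qed (use Lvq in auto)
  qed
  have T2: "Lv - q ` orb u v = q ` {p. snd (fst p) \<in> - {A..B}} \<inter> Lv"
  proof (intro set_eqI)
    fix y
    show "y \<in> Lv - q ` orb u v \<longleftrightarrow> y \<in> q ` {p. snd (fst p) \<in> - {A..B}} \<inter> Lv"
    proof (cases "y \<in> range q")
      case True
      then obtain p where y: "y = q p" by blast
      show ?thesis unfolding y Int_iff mem Diff_iff inT by auto
    qed (use Lvq in auto)
  qed
  have "q ` orb u v \<in> connected_components_of ?Z"
  proof (rule connected_component_if_clopen)
    show "openin ?Z (q ` orb u v)" unfolding openin_subtopology T1 by (blast intro: opn open_greaterThanLessThan)
    show "openin ?Z (topspace ?Z - q ` orb u v)"
      unfolding top openin_subtopology T2 by (blast intro: opn open_Compl[OF closed_atLeastAtMost])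
    have "orb u v = (\<lambda>(w, t). ((w, u + hgt v t), trj v t)) ` UNIV" by (auto simp: orb_def image_iff)
    moreover have "connected ((\<lambda>(w :: real^'n, t). ((w, u + hgt v t), trj v t)) ` UNIV)"
      unfolding split_beta
      by (intro connected_continuous_image connected_UNIV continuous_intros
          continuous_on_compose2[OF hgt_cont[OF UNIV_I, of UNIV v]]
          continuous_on_compose2[OF trj_cont[OF UNIV_I, of UNIV v]]) auto
    ultimately have "connectedin euclidean (orb u v)" by simp
    from connectedin_continuous_map_image[OF continuous_map_TM_proj this]
    have "connectedin (TM_space L \<Gamma>) (q ` orb u v)" .
    moreover have "q ` orb u v \<subseteq> Lv" using T1 by blast
    ultimately show "connectedin ?Z (q ` orb u v)" by (simp add: connectedin_subtopology)
    show "q ((0, u), v) \<in> q ` orb u v" using orb_base by blast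
  qed
  then show ?thesis by (simp add: Lv_def)
qed

end

section \<open>Separating the tori\<close>

context LF_linear
begin

lemma J_interval:
  assumes "good v"
  obtains A B where "A < B" "\<And>u. J u v = {u + A..u + B}"
proof -
  obtain tA tB where t: "hgt v tA < hgt v tB" "\<And>t. hgt v tA \<le> hgt v t" "\<And>t. hgt v t \<le> hgt v tB"
    using hgt_extrema[OF assms] by metis
  have "J u v = {u + hgt v tA..u + hgt v tB}" for u
  proof
    show "J u v \<subseteq> {u + hgt v tA..u + hgt v tB}" using t by (auto simp: J_def)
    show "{u + hgt v tA..u + hgt v tB} \<subseteq> J u v" by (rule J_connected) (auto simp: J_def)
  qed
  with t(1) show thesis by (rule that)
qed

text \<open>Two tori in the same level set of \<open>f_glob\<close> have disjoint intervals \<open>J\<close>. They are told apart by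
  the first number of the sequence \<open>rat_seq\<close> in the interval; to make its index locally constant,
  the tori are discarded for which an earlier number is an endpoint.\<close>
definition Qi :: "nat \<Rightarrow> real \<Rightarrow> 'n alg \<Rightarrow> bool" where
  "Qi i u v \<longleftrightarrow> good v \<and> (norm v)\<^sup>2 \<notin> \<int> \<and> (\<exists>x\<in>J u v. \<exists>y\<in>J u v. x < rat_seq i \<and> rat_seq i < y)
     \<and> (\<forall>j<i. rat_seq j \<notin> J u v)"

definition Q :: "real \<Rightarrow> 'n alg \<Rightarrow> bool" where "Q u v \<longleftrightarrow> (\<exists>i. Qi i u v)"

definition idx :: "real \<Rightarrow> 'n alg \<Rightarrow> nat" where "idx u v = (LEAST i. rat_seq i \<in> J u v)"

lemma Qi_mem: "Qi i u v \<Longrightarrow> rat_seq i \<in> J u v"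
proof -
  assume "Qi i u v"
  then obtain x y where "x \<in> J u v" "y \<in> J u v" "x < rat_seq i" "rat_seq i < y" by (auto simp: Qi_def)
  moreover from J_connected[OF this(1,2)] this(3,4) show ?thesis by auto
qed

lemma Qi_idx: "Qi i u v \<Longrightarrow> idx u v = i"
  unfolding idx_def
proof (rule Least_equality)
  assume i: "Qi i u v"
  show "rat_seq i \<in> J u v" by (rule Qi_mem[OF i])
  show "i \<le> j" if "rat_seq j \<in> J u v" for j using i that unfolding Qi_def by (meson not_less)
qed

lemma Qi_orb: "Qi i u v \<Longrightarrow> Qi i (u + hgt v t) (trj v t)"
  unfolding Qi_def J_orb using good_trj[of v t] trj_norm[of v t] by simp

lemma idx_orb: "idx (u + hgt v t) (trj v t) = idx u v"
  unfolding idx_def J_orb ..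

section \<open>Openness and density of the selected tori\<close>

lemma norm_sq_not_Ints_nearby:
  assumes "(norm (v :: 'n alg))\<^sup>2 \<notin> \<int>"
  obtains d where "d > 0" "\<And>v' :: 'n alg. dist v' v < d \<Longrightarrow> \<lfloor>(norm v')\<^sup>2\<rfloor> = \<lfloor>(norm v)\<^sup>2\<rfloor> \<and> (norm v')\<^sup>2 \<notin> \<int>"
proof -
  define k where "k = \<lfloor>(norm v)\<^sup>2\<rfloor>"
  have "of_int k \<noteq> (norm v)\<^sup>2" using assms by (metis Ints_of_int)
  then have v: "of_int k < (norm v)\<^sup>2" "(norm v)\<^sup>2 < of_int k + 1"
    using of_int_floor_le[of "(norm v)\<^sup>2"] floor_correct[of "(norm v)\<^sup>2"] unfolding k_def by linarith+
  have "open {v' :: 'n alg. of_int k < (norm v')\<^sup>2 \<and> (norm v')\<^sup>2 < of_int k + 1}"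
    by (intro open_Collect_conj open_Collect_less continuous_intros)
  moreover have "v \<in> {v' :: 'n alg. of_int k < (norm v')\<^sup>2 \<and> (norm v')\<^sup>2 < of_int k + 1}" using v by simp
  ultimately obtain d where d: "d > 0" and sub: "ball v d \<subseteq> {v'. of_int k < (norm v')\<^sup>2 \<and> (norm v')\<^sup>2 < of_int k + 1}"
    by (rule openE)
  have near: "of_int k < (norm v')\<^sup>2 \<and> (norm v')\<^sup>2 < of_int k + 1" if "dist v' v < d" for v'
  proof -
    have "v' \<in> ball v d" using that by (simp add: dist_commute)
    then show ?thesis using sub by blast
  qed
  have "\<lfloor>(norm v')\<^sup>2\<rfloor> = k \<and> (norm v')\<^sup>2 \<notin> \<int>" if "dist v' v < d" for v' :: "'n alg"
  proof
    show f: "\<lfloor>(norm v')\<^sup>2\<rfloor> = k" using near[OF that] by (intro floor_unique) auto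
    show "(norm v')\<^sup>2 \<notin> \<int>"
    proof
      assume "(norm v')\<^sup>2 \<in> \<int>"
      then have "of_int \<lfloor>(norm v')\<^sup>2\<rfloor> = (norm v')\<^sup>2" by (auto elim: Ints_cases)
      then show False using near[OF that] f by simp
    qed
  qed
  then show thesis using that[OF d] by (simp add: k_def)
qed

text \<open>The two strict inequalities persist because the heights at two fixed times depend
  continuously on v. For the finitely many j < i, the closed interval \<open>J u v\<close> has
  positive distance from \<open>rat_seq j\<close>, and \<open>good_nearby\<close> keeps the whole
  perturbed interval within a small distance of it.\<close>

lemma Qi_open:
  assumes "Qi i u v"
  obtains d where "d > 0" "\<And>u' v'. dist u' u < d \<Longrightarrow> dist v' v < d \<Longrightarrow> Qi i u' v'"
proof -
  have g: "good v" and N: "(norm v)\<^sup>2 \<notin> \<int>" and nj: "\<And>j. j < i \<Longrightarrow> rat_seq j \<notin> J u v"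
    using assms by (auto simp: Qi_def)
  obtain t1 t2 where t: "u + hgt v t1 < rat_seq i" "rat_seq i < u + hgt v t2"
    using assms by (auto simp: Qi_def J_def)
  define m where "m = min (rat_seq i - (u + hgt v t1)) (u + hgt v t2 - rat_seq i)"
  have m: "m > 0" "u + hgt v t1 + m \<le> rat_seq i" "rat_seq i + m \<le> u + hgt v t2" using t by (auto simp: m_def)
  obtain A B where "J u v = {u + A..u + B}" using J_interval[OF g] by metis
  then have "closed (J u v)" by simp
  then have "\<forall>j\<in>{..<i}. \<exists>e>0. \<forall>z\<in>J u v. e \<le> \<bar>rat_seq j - z\<bar>"
  proof (intro ballI)
    fix j assume "closed (J u v)" "j \<in> {..<i}"
    then have "open (- J u v)" "rat_seq j \<in> - J u v" using nj by auto
    then obtain e where "e > 0" "ball (rat_seq j) e \<subseteq> - J u v" by (meson openE)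
    then show "\<exists>e>0. \<forall>z\<in>J u v. e \<le> \<bar>rat_seq j - z\<bar>"
      by (intro exI[of _ e]) (force simp: dist_real_def subset_iff not_less[symmetric])
  qed
  from bchoice[OF this] obtain e where e: "\<And>j. j < i \<Longrightarrow> e j > 0" "\<And>j z. j < i \<Longrightarrow> z \<in> J u v \<Longrightarrow> e j \<le> \<bar>rat_seq j - z\<bar>"
    by auto
  \<comment> \<open>The element 1 makes the minimum meaningful for i = 0. Half of \<open>e0\<close>
    is spent on the shift of u, half on the change of the heights.\<close>
  define e0 where "e0 = Min (insert 1 (e ` {..<i}))"
  have e0: "e0 > 0" "\<And>j. j < i \<Longrightarrow> e0 \<le> e j" using e(1) by (auto simp: e0_def)
  obtain d1 where d1: "d1 > 0" "\<And>v'. dist v' v < d1 \<Longrightarrow> good v' \<and> (\<forall>t. \<exists>s. \<bar>hgt v' t - hgt v s\<bar> < e0 / 2)"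
    using good_nearby[OF g, of "e0 / 2"] e0(1) by (metis UNIV_I half_gt_zero)
  obtain d2 where d2: "d2 > 0" "\<And>v' t. dist v' v < d2 \<Longrightarrow> \<bar>t\<bar> \<le> max \<bar>t1\<bar> \<bar>t2\<bar> \<Longrightarrow> \<bar>hgt v' t - hgt v t\<bar> < m / 2"
    using trajectories_close[OF UNIV_I, of "m / 2" v "max \<bar>t1\<bar> \<bar>t2\<bar>"] m(1) by (metis UNIV_I half_gt_zero)
  obtain d3 where d3: "d3 > 0" "\<And>v'. dist v' v < d3 \<Longrightarrow> (norm v')\<^sup>2 \<notin> \<int>"
    using norm_sq_not_Ints_nearby[OF N] by metis
  define d where "d = min (min d1 d2) (min d3 (min (m / 2) (e0 / 2)))"
  show thesis
  proof (rule that)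
    show "d > 0" using d1 d2 d3 m e0 by (simp add: d_def)
    fix u' v' assume u': "dist u' u < d" and v': "dist v' v < d"
    have du: "\<bar>u' - u\<bar> < m / 2" "\<bar>u' - u\<bar> < e0 / 2" using u' by (auto simp: d_def dist_real_def)
    have gd: "good v'" "\<And>t. \<exists>s. \<bar>hgt v' t - hgt v s\<bar> < e0 / 2" using d1(2)[of v'] v' by (auto simp: d_def)
    have "\<bar>hgt v' t1 - hgt v t1\<bar> < m / 2" "\<bar>hgt v' t2 - hgt v t2\<bar> < m / 2" using d2(2)[of v'] v' by (auto simp: d_def)
    then have "u' + hgt v' t1 < rat_seq i" "rat_seq i < u' + hgt v' t2" using du(1) m by linarith+
    moreover have "rat_seq j \<notin> J u' v'" if j: "j < i" for j
    proof
      assume "rat_seq j \<in> J u' v'"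
      then obtain t where t: "rat_seq j = u' + hgt v' t" by (auto simp: J_def)
      obtain s where s: "\<bar>hgt v' t - hgt v s\<bar> < e0 / 2" using gd(2) by blast
      have "e0 \<le> \<bar>rat_seq j - (u + hgt v s)\<bar>" using e(2)[OF j, of "u + hgt v s"] e0(2)[OF j] by (auto simp: J_def)
      then show False using t s du(2) by linarith
    qed
    ultimately show "Qi i u' v'" unfolding Qi_def J_def using gd(1) d3(2)[of v'] v' by (auto simp: d_def)
  qed
qed

text \<open>Three moves that do not spoil each other: the squared norm is made non-integral,
  \<open>good_dense\<close> then moves v on its sphere, and finally u is shifted until both ends of
  \<open>J\<close> are irrational. Then the first rational in \<open>J\<close>, in the order of
  \<open>rat_seq\<close>, is an interior point.\<close>

lemma Q_dense:
  assumes expd: "expanding ((*v) F) UNIV" "expanding (\<lambda>x. - (F *v x)) UNIV" and "e > 0"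
  obtains u' v' where "dist u' u < e" "dist v' v < e" "Q u' v'"
proof -
  have "\<exists>v1. dist v1 v < e / 2 \<and> v1 \<noteq> 0 \<and> (norm v1)\<^sup>2 \<notin> \<int>"
  proof -
    obtain b :: "'n alg" where b: "norm b = 1" "v = norm v *\<^sub>R b"
    proof (cases "v = 0")
      case True
      show ?thesis by (rule that[of "(0, 1)"]) (use True in \<open>auto simp: norm_Pair zero_prod_def\<close>)
    next
      case False
      show ?thesis by (rule that[of "v /\<^sub>R norm v"]) (use False in auto)
    qed
    define n where "n = norm v"
    have "isCont (\<lambda>x. (n + x)\<^sup>2) 0" by (intro continuous_intros)
    then have "((\<lambda>x. (n + x)\<^sup>2) \<longlongrightarrow> n\<^sup>2) (at_right 0)"
      by (simp add: isCont_def) (rule tendsto_within_subset[of _ _ _ UNIV], auto)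
    moreover have "n\<^sup>2 < of_int \<lfloor>n\<^sup>2\<rfloor> + 1" by linarith
    ultimately have 1: "eventually (\<lambda>x. (n + x)\<^sup>2 < of_int \<lfloor>n\<^sup>2\<rfloor> + 1) (at_right 0)" by (rule order_tendstoD)
    have 2: "eventually (\<lambda>x. x \<in> {0<..<e / 2}) (at_right (0::real))"
      using \<open>e > 0\<close> by (intro eventually_at_right_real) simp
    \<comment> \<open>Increasing the norm slightly puts its square strictly between two consecutive
      integers, even if \<open>n\<^sup>2\<close> is itself an integer.\<close>
    obtain x where x: "(n + x)\<^sup>2 < of_int \<lfloor>n\<^sup>2\<rfloor> + 1" "0 < x" "x < e / 2"
      using eventually_happens[OF eventually_conj[OF 1 2]] by auto
    have n0: "n \<ge> 0" by (simp add: n_def)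
    define v1 where "v1 = (n + x) *\<^sub>R b"
    have nv1: "norm v1 = n + x" using n0 x b by (simp add: v1_def)
    have "v1 - v = x *\<^sub>R b" unfolding v1_def by (subst b(2)) (simp add: n_def scaleR_add_left)
    then have "dist v1 v < e / 2" using x b by (simp add: dist_norm)
    moreover have "v1 \<noteq> 0" using nv1 x n0 by auto
    moreover have "(norm v1)\<^sup>2 \<notin> \<int>"
    proof
      assume "(norm v1)\<^sup>2 \<in> \<int>"
      then obtain k where k: "(n + x)\<^sup>2 = of_int k" unfolding nv1 by (auto elim: Ints_cases)
      have "n\<^sup>2 < (n + x)\<^sup>2" using n0 x by (intro power_strict_mono) auto
      then have "real_of_int \<lfloor>n\<^sup>2\<rfloor> < of_int k" using of_int_floor_le[of "n\<^sup>2"] unfolding k by linarith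
      moreover have "real_of_int k < of_int (\<lfloor>n\<^sup>2\<rfloor> + 1)" using x(1) unfolding k by simp
      ultimately show False unfolding of_int_less_iff by linarith
    qed
    ultimately show ?thesis by blast
  qed
  then obtain v1 where v1: "dist v1 v < e / 2" "v1 \<noteq> 0" "(norm v1)\<^sup>2 \<notin> \<int>" by blast
  have e2: "e / 2 > 0" using \<open>e > 0\<close> by simp
  from good_dense[OF UNIV_I v1(2) e2 expd] obtain v2 where v2: "norm v2 = norm v1" "dist v2 v1 < e / 2" "good v2"
    by blast
  have dv: "dist v2 v < e" using v1(1) v2(2) dist_triangle[of v2 v v1] by linarith
  obtain A B where AB: "A < B" "\<And>u. J u v2 = {u + A..u + B}" using J_interval[OF v2(3)] by metis
  \<comment> \<open>The shifts of u with a rational endpoint form a countable set, whereas the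
    interval to choose from is uncountable.\<close>
  have "countable ((\<lambda>r. r - A) ` \<rat> \<union> (\<lambda>r. r - B) ` (\<rat> :: real set))" using countable_rat by auto
  then have "\<not> {u<..<u + e} \<subseteq> (\<lambda>r. r - A) ` \<rat> \<union> (\<lambda>r. r - B) ` \<rat>"
    using uncountable_open_interval[of u "u + e"] \<open>e > 0\<close> countable_subset by (metis less_add_same_cancel1)
  then obtain u' where u': "u < u'" "u' < u + e" "u' + A \<notin> \<rat>" "u' + B \<notin> \<rat>"
    by (force simp: image_iff)
  have rat: "rat_seq i \<in> \<rat>" for i by (simp add: rat_seq_def)
  obtain i0 where "u' + A < rat_seq i0" "rat_seq i0 < u' + B" using rat_seq_dense[of "u' + A" "u' + B"] AB(1) by auto
  then have "rat_seq i0 \<in> J u' v2" by (simp add: AB)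
  then have L: "rat_seq (idx u' v2) \<in> J u' v2" unfolding idx_def by (rule LeastI)
  have "\<forall>j<idx u' v2. rat_seq j \<notin> J u' v2" unfolding idx_def using not_less_Least by blast
  moreover have "u' + A < rat_seq (idx u' v2)" "rat_seq (idx u' v2) < u' + B"
    using L u'(3,4) rat[of "idx u' v2"] unfolding AB by (auto simp: less_le)
  moreover have "u' + A \<in> J u' v2" "u' + B \<in> J u' v2" using AB by auto
  ultimately have "Qi (idx u' v2) u' v2" unfolding Qi_def using v2(3) v1(3) v2(1) by auto
  then have "Q u' v2" unfolding Q_def by blast
  moreover have "dist u' u < e" using u' by (simp add: dist_real_def)
  ultimately show thesis using that dv by blast
qed

text \<open>One natural number for both the integer part of the energy and the index of the
  well.\<close>

definition label :: "real \<Rightarrow> 'n alg \<Rightarrow> nat" where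
  "label u v = prod_encode (nat \<lfloor>(norm v)\<^sup>2\<rfloor>, idx u v)"

text \<open>The integer part of the energy is replaced by \<open>label\<close>, and the fractional
  part is kept. A single real component thus carries energy and well, and the number of integrals
  stays n + 1, the codimension of the tori.\<close>

definition f_loc :: "'n grp set \<times> 'n alg \<Rightarrow> (real^'n) \<times> real" where
  "f_loc y = f_glob y + (0, real (label (uc (fst y)) (snd y)) - of_int \<lfloor>(norm (snd y))\<^sup>2\<rfloor>)"

lemma f_loc_orb: "p \<in> orb u v \<Longrightarrow> f_loc (q p) = (mom u (fst v), frac ((norm v)\<^sup>2) + real (label u v))"
  using f_glob_orb[of p u v] unfolding f_loc_def uc_q
  by (auto simp: orb_def label_def idx_orb trj_norm frac_def)

context
  assumes expd: "expanding ((*v) F) UNIV" "expanding (\<lambda>x. - (F *v x)) UNIV"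
begin

lemma Q_good: "Q u v \<Longrightarrow> good v"
  and Q_orb: "Q u v \<Longrightarrow> Q (u + hgt v t) (trj v t)"
  and Q_open: "Q u v \<Longrightarrow> \<exists>d>0. \<forall>u' v'. v' \<in> UNIV \<longrightarrow> dist u' u < d \<longrightarrow> dist v' v < d \<longrightarrow> Q u' v'"
proof -
  assume "Q u v"
  then obtain i where i: "Qi i u v" unfolding Q_def by blast
  then show "good v" by (simp add: Qi_def)
  show "Q (u + hgt v t) (trj v t)" unfolding Q_def using Qi_orb[OF i] by blast
  obtain d where "d > 0" "\<And>u' v'. dist u' u < d \<Longrightarrow> dist v' v < d \<Longrightarrow> Qi i u' v'" using Qi_open[OF i] by blast
  then show "\<exists>d>0. \<forall>u' v'. v' \<in> UNIV \<longrightarrow> dist u' u < d \<longrightarrow> dist v' v < d \<longrightarrow> Q u' v'" unfolding Q_def by blast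
qed

lemma Q_dense': "v \<in> UNIV \<Longrightarrow> e > 0 \<Longrightarrow> \<exists>u' v'. v' \<in> UNIV \<and> dist u' u < e \<and> dist v' v < e \<and> Q u' v'"
  using Q_dense[OF expd] by (metis UNIV_I)

lemmas Q_facts = Q_good Q_orb Q_open Q_dense'

lemma Q_integrable: "integrable_with_tori TYPE((real^'n) \<times> real) (TM_space L \<Gamma>) q traj (tori Q)"
proof -
  have "subtopology (TM_space L \<Gamma>) {(m, v). v \<in> UNIV} = TM_space L \<Gamma>" by simp
  then show ?thesis using tori_integrable[of Q, OF Q_facts] by simp
qed

lemma q_in_Q_tori: "q ((w, u), v) \<in> \<Union>(tori Q) \<longleftrightarrow> Q u v"
  by (rule q_in_tori[of Q, OF Q_facts])

text \<open>Near a selected point the index i and the integer part of the energy are constant, so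
  \<open>f_loc\<close> differs from \<open>f_glob\<close> by a constant.\<close>

lemma f_loc_power_series:
  assumes "Qi i u v"
  shows "power_series_at (f_loc \<circ> q) ((w, u), v)"
proof -
  define c where "c = ((0 :: real^'n), real (prod_encode (nat \<lfloor>(norm v)\<^sup>2\<rfloor>, i)) - of_int \<lfloor>(norm v)\<^sup>2\<rfloor>)"
  have B: "((0, 1), (0, 0)) \<in> (Basis :: ('n grp \<times> 'n alg) set)" "((0, 0), (0, 1)) \<in> (Basis :: ('n grp \<times> 'n alg) set)"
    by (auto simp: Basis_prod_def image_iff zero_prod_def)
  have "power_series_at (\<lambda>p. (f_glob \<circ> q) p + c) ((w, u), v)"
    by (intro power_series_at_add power_series_f_glob power_series_at_const[OF B]) simp
  moreover have "eventually (\<lambda>p. (f_loc \<circ> q) p = (f_glob \<circ> q) p + c) (nhds ((w, u), v))"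
  proof -
    obtain d1 where d1: "d1 > 0" "\<And>u' v'. dist u' u < d1 \<Longrightarrow> dist v' v < d1 \<Longrightarrow> Qi i u' v'" using Qi_open[OF assms] by blast
    have "(norm v)\<^sup>2 \<notin> \<int>" using assms by (simp add: Qi_def)
    then obtain d2 where d2: "d2 > 0" "\<And>v'. dist v' v < d2 \<Longrightarrow> \<lfloor>(norm v')\<^sup>2\<rfloor> = \<lfloor>(norm v)\<^sup>2\<rfloor>"
      using norm_sq_not_Ints_nearby by metis
    show ?thesis unfolding eventually_nhds_metric
    proof (intro exI[of _ "min d1 d2"] conjI allI impI)
      fix p assume p: "dist p ((w, u), v) < min d1 d2"
      have "dist (snd p) v \<le> dist p ((w, u), v)" "dist (snd (fst p)) u \<le> dist p ((w, u), v)"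
        using dist_snd_le[of p "((w, u), v)"] dist_fst_le[of p "((w, u), v)"] dist_snd_le[of "fst p" "(w, u)"] by auto
      then have "Qi i (snd (fst p)) (snd p)" "\<lfloor>(norm (snd p))\<^sup>2\<rfloor> = \<lfloor>(norm v)\<^sup>2\<rfloor>" using p d1(2) d2(2) by auto
      then show "(f_loc \<circ> q) p = (f_glob \<circ> q) p + c"
        by (simp add: f_loc_def uc_q label_def Qi_idx c_def)
    qed (use d1 d2 in auto)
  qed
  ultimately show ?thesis by (rule power_series_at_eventually_eq)
qed

lemma f_loc_first_integral: "analytic_first_integral_on (\<Union>(tori Q)) q traj f_loc"
  unfolding analytic_first_integral_on_def real_analytic_on_iff
proof (intro conjI ballI impI allI)
  have "openin (TM_space L \<Gamma>) (\<Union>(tori Q))" using Q_integrable by (simp add: integrable_with_tori_def)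
  then show "open {x. q x \<in> \<Union>(tori Q)}" by (simp add: openin_TM_space)
  fix x assume x: "x \<in> {x. q x \<in> \<Union>(tori Q)}"
  obtain w u v where xe: "x = ((w, u), v)" by (metis prod.collapse)
  then have "Q u v" using x q_in_Q_tori by blast
  then show "power_series_at (f_loc \<circ> q) x" unfolding xe Q_def using f_loc_power_series by blast
next
  fix \<gamma> t assume "\<gamma> \<in> traj"
  then obtain u v where g: "\<And>t. \<exists>w. \<gamma> t = q ((w, u + hgt v t), trj v t)" using traj_orbit by blast
  have "f_loc (\<gamma> t) = (mom u (fst v), frac ((norm v)\<^sup>2) + real (label u v))" for t
  proof -
    obtain w where "\<gamma> t = q ((w, u + hgt v t), trj v t)" using g by blast
    then show ?thesis using f_loc_orb[of "((w, u + hgt v t), trj v t)" u v] by (auto simp: orb_def)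
  qed
  then show "f_loc (\<gamma> t) = f_loc (\<gamma> 0)" by simp
qed

text \<open>The value returns the momentum, the label and the fractional part, hence also the energy
  and the index of the well. Two wells with the same index share the number
  \<open>rat_seq i\<close>, and at a common u \<open>level_orbit\<close> identifies the
  orbits.\<close>

lemma f_loc_separates:
  assumes T: "T \<in> tori Q"
  shows "\<exists>c. T = {p \<in> \<Union>(tori Q). f_loc p = c}"
proof -
  obtain u v where uv: "T = q ` orb u v" "Q u v" using T unfolding tori_def by blast
  define c where "c = (mom u (fst v), frac ((norm v)\<^sup>2) + real (label u v))"
  have "T = {p \<in> \<Union>(tori Q). f_loc p = c}"
  proof
    show "T \<subseteq> {p \<in> \<Union>(tori Q). f_loc p = c}" using T f_loc_orb[of _ u v] unfolding uv(1) c_def by blast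
    show "{p \<in> \<Union>(tori Q). f_loc p = c} \<subseteq> T"
    proof
      fix y assume "y \<in> {p \<in> \<Union>(tori Q). f_loc p = c}"
      then obtain u' v' p where uv': "Q u' v'" "p \<in> orb u' v'" "y = q p" "f_loc (q p) = c"
        unfolding tori_def by blast
      then have eq: "mom u' (fst v') = mom u (fst v)"
        "frac ((norm v')\<^sup>2) + real (label u' v') = frac ((norm v)\<^sup>2) + real (label u v)"
        using f_loc_orb[OF uv'(2)] by (auto simp: c_def)
      \<comment> \<open>Fractional parts lie in [0, 1), so the labels differ by less than 1 and
        agree as integers.\<close>
      have "real (label u' v') < real (label u v) + 1" "real (label u v) < real (label u' v') + 1"
        using eq(2) frac_lt_1[of "(norm v)\<^sup>2"] frac_lt_1[of "(norm v')\<^sup>2"] frac_ge_0[of "(norm v)\<^sup>2"] frac_ge_0[of "(norm v')\<^sup>2"]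
        by linarith+
      then have lab: "label u' v' = label u v" by linarith
      then have "nat \<lfloor>(norm v')\<^sup>2\<rfloor> = nat \<lfloor>(norm v)\<^sup>2\<rfloor>" and idx: "idx u' v' = idx u v" by (simp_all add: label_def)
      then have "\<lfloor>(norm v')\<^sup>2\<rfloor> = \<lfloor>(norm v)\<^sup>2\<rfloor>" by (simp add: eq_nat_nat_iff)
      then have "(norm v')\<^sup>2 = (norm v)\<^sup>2" using eq(2) lab by (simp add: frac_def)
      then have nrm: "norm v' = norm v" by simp
      obtain i where i: "Qi i u v" using uv(2) unfolding Q_def by blast
      obtain i' where i': "Qi i' u' v'" using uv'(1) unfolding Q_def by blast
      have "i' = i" using Qi_idx[OF i] Qi_idx[OF i'] idx by simp
      then have r: "rat_seq i \<in> J u v" "rat_seq i \<in> J u' v'" using Qi_mem i i' by auto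
      obtain t' where t': "rat_seq i = u' + hgt v' t'" using r(2) by (auto simp: J_def)
      obtain a where a: "snd (trj v a) = 0" using Q_good[OF uv(2)] by (auto simp: good_def)
      have "mom (rat_seq i) (fst (trj v' t')) = mom u (fst v)" using mom_trj[of u' v' t'] eq(1) t' by simp
      from level_orbit[OF this _ r(1) a] nrm obtain t where "rat_seq i = u + hgt v t" "trj v' t' = trj v t"
        by (auto simp: trj_norm)
      then have "orb u' v' = orb u v" using orb_shift[OF UNIV_I, of u' v' t'] orb_shift[OF UNIV_I, of u v t] t' by simp
      then show "y \<in> T" using uv' uv by simp
    qed
  qed
  then show ?thesis by blast
qed

lemma integrable_with_first_integrals:
  "\<exists>\<T>. integrable_with_tori TYPE((real^'n) \<times> real) (TM_space L \<Gamma>) (TM_proj L \<Gamma>) (LF_TM L ((*v) F) \<Gamma>) \<T> \<and>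
     (\<exists>f :: 'n grp set \<times> 'n alg \<Rightarrow> (real^'n) \<times> real.
        analytic_first_integral_on (\<Union>\<T>) (TM_proj L \<Gamma>) (LF_TM L ((*v) F) \<Gamma>) f \<and>
        (\<forall>T\<in>\<T>. \<exists>c. T = {p \<in> \<Union>\<T>. f p = c})) \<and>
     (\<exists>f :: 'n grp set \<times> 'n alg \<Rightarrow> (real^'n) \<times> real.
        analytic_first_integral_on (topspace (TM_space L \<Gamma>)) (TM_proj L \<Gamma>) (LF_TM L ((*v) F) \<Gamma>) f \<and>
        (\<forall>T\<in>\<T>. \<exists>c. T \<in> connected_components_of
           (subtopology (TM_space L \<Gamma>) {p \<in> topspace (TM_space L \<Gamma>). f p = c})))"
proof -
  have tr: "traj = LF_TM L ((*v) F) \<Gamma>" by (simp add: traj_def)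
  have "\<exists>c. T \<in> connected_components_of (subtopology (TM_space L \<Gamma>) {p \<in> topspace (TM_space L \<Gamma>). f_glob p = c})"
    if T: "T \<in> tori Q" for T
  proof -
    obtain u v where "T = q ` orb u v" "Q u v" using T unfolding tori_def by blast
    then show ?thesis using torus_is_component[OF Q_good, of u v u] by blast
  qed
  then show ?thesis
    using Q_integrable f_loc_first_integral f_loc_separates f_glob_first_integral unfolding tr
    by (intro exI[of _ "tori Q"] conjI exI[of _ f_loc] exI[of _ f_glob] ballI) simp_all
qed

end

end

section \<open>Perturbed systems and the final theorem\<close>

lemma matrix_uminus_mult_vector: "(- F) *v x = - (F *v x)" for F :: "real^'n^'m"
  by (simp add: matrix_vector_mult_def vec_eq_iff sum_negf)

lemma C1_close_Lipschitz:
  fixes G F :: "'a::euclidean_space \<Rightarrow> 'a"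
  assumes "C1_close_on \<epsilon> S F G" "convex S" "x \<in> S" "y \<in> S"
  shows "norm ((G x - F x) - (G y - F y)) \<le> \<epsilon> * norm (x - y)"
proof -
  have "\<forall>x\<in>S. \<exists>D. ((\<lambda>y. G y - F y) has_derivative D) (at x within S) \<and> onorm D < \<epsilon>"
    using assms(1) unfolding C1_close_on_def by blast
  from bchoice[OF this] obtain D where
    "\<And>x. x \<in> S \<Longrightarrow> ((\<lambda>y. G y - F y) has_derivative D x) (at x within S)" "\<And>x. x \<in> S \<Longrightarrow> onorm (D x) < \<epsilon>" by blast
  from differentiable_bound[OF assms(2) this(1) less_imp_le[OF this(2)] assms(3,4)] show ?thesis by simp
qed

text \<open>Covers TM with \<open>S = UNIV\<close> and SM with the unit sphere,
  \<open>\<Omega>\<close> being the matching domain for \<xi>. By the mean value inequality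
  C1-closeness on a convex set bounds the Lipschitz constant of G - F, which is what both expansion
  hypotheses consume. The second one, about -F, handles reversed time: there an eigenvalue with
  negative real part becomes unstable.\<close>

lemma LF_close_integrable:
  fixes F :: "real^'n^'n" and G :: "real^'n \<Rightarrow> real^'n"
  assumes L: "linear L" "full_lattice \<Gamma>" and \<epsilon>: "\<epsilon> > 0"
    and exp1: "\<forall>G \<Omega>. (\<forall>x\<in>\<Omega>. \<forall>y\<in>\<Omega>. norm ((G x - F *v x) - (G y - F *v y)) \<le> \<epsilon> * norm (x - y))
      \<longrightarrow> expanding G \<Omega>"
    and exp2: "\<forall>G \<Omega>. (\<forall>x\<in>\<Omega>. \<forall>y\<in>\<Omega>. norm ((G x - (- F) *v x) - (G y - (- F) *v y)) \<le> \<epsilon> * norm (x - y))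
      \<longrightarrow> expanding G \<Omega>"
    and G: "smooth_on G \<Omega>" "C1_close_on \<epsilon> \<Omega> ((*v) F) G" "convex \<Omega>"
    and S: "\<And>v v'. v \<in> S \<Longrightarrow> norm v' = norm v \<Longrightarrow> v' \<in> S" "\<And>v. v \<in> S \<Longrightarrow> cball 0 (norm v) \<subseteq> \<Omega>"
      "S \<subseteq> closure (S - {0})"
  shows "integrable_system TYPE((real^'n) \<times> real) (subtopology (TM_space L \<Gamma>) {(m, v). v \<in> S}) (TM_proj L \<Gamma>)
    {\<gamma> \<in> LF_TM L G \<Gamma>. \<forall>t. snd (\<gamma> t) \<in> S}"
proof -
  define K where "K = onorm ((*v) F) + \<epsilon>"
  have K: "K \<ge> 0" using \<epsilon> onorm_pos_le[of "(*v) F"] by (simp add: K_def matrix_vector_mul_bounded_linear)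
  have close: "norm ((G x - F *v x) - (G y - F *v y)) \<le> \<epsilon> * norm (x - y)" if "x \<in> \<Omega>" "y \<in> \<Omega>" for x y
    by (rule C1_close_Lipschitz[OF G(2,3) that])
  have lip: "norm (G x - G y) \<le> K * norm (x - y)" if "x \<in> \<Omega>" "y \<in> \<Omega>" for x y
  proof -
    have "G x - G y = ((G x - F *v x) - (G y - F *v y)) + F *v (x - y)"
      by (simp add: matrix_vector_mult_diff_distrib)
    also have "norm \<dots> \<le> \<epsilon> * norm (x - y) + onorm ((*v) F) * norm (x - y)"
      by (intro norm_triangle_mono close that onorm) (simp add: matrix_vector_mul_bounded_linear)
    finally show ?thesis by (simp add: K_def algebra_simps)
  qed
  interpret LF_lattice G \<Omega> S K L \<Gamma>
    by (intro LF_lattice.intro LF_reduced.intro LF_lattice_axioms.intro) (fact K lip S L G)+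
  have "expanding G \<Omega>" by (rule exp1[rule_format]) (rule close)
  moreover have "expanding (\<lambda>x. - G x) \<Omega>"
  proof (rule exp2[rule_format])
    fix x y assume "x \<in> \<Omega>" "y \<in> \<Omega>"
    moreover have "- ((- G x - (- F) *v x) - (- G y - (- F) *v y)) = (G x - F *v x) - (G y - F *v y)"
      by (simp add: matrix_uminus_mult_vector)
    ultimately show "norm ((- G x - (- F) *v x) - (- G y - (- F) *v y)) \<le> \<epsilon> * norm (x - y)"
      using close by (metis norm_minus_cancel)
  qed
  ultimately show ?thesis
    using all_good_integrable[OF _ _ S(3)] unfolding integrable_system_def traj_def by blast
qed

theorem theorem6p2:
  fixes L :: "real^'n \<Rightarrow> real^'n" and F :: "real^'n^'n" and \<Gamma>\<^sub>0 :: "(real^'n) set"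
  assumes "linear L"
    and "full_lattice \<Gamma>\<^sub>0"
    and "\<exists>z. complex_eigenvalue F z \<and> Re z > 0"
    and "\<exists>z. complex_eigenvalue F z \<and> Re z < 0"
  shows "(\<exists>\<T>. integrable_with_tori TYPE((real^'n) \<times> real) (TM_space L \<Gamma>\<^sub>0) (TM_proj L \<Gamma>\<^sub>0)
              (LF_TM L ((*v) F) \<Gamma>\<^sub>0) \<T> \<and>
           (\<exists>f :: 'n grp set \<times> 'n alg \<Rightarrow> (real^'n) \<times> real.
              analytic_first_integral_on (\<Union>\<T>) (TM_proj L \<Gamma>\<^sub>0) (LF_TM L ((*v) F) \<Gamma>\<^sub>0) f \<and>
              (\<forall>T\<in>\<T>. \<exists>c. T = {p \<in> \<Union>\<T>. f p = c})) \<and>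
           (\<exists>f :: 'n grp set \<times> 'n alg \<Rightarrow> (real^'n) \<times> real.
              analytic_first_integral_on (topspace (TM_space L \<Gamma>\<^sub>0)) (TM_proj L \<Gamma>\<^sub>0)
                (LF_TM L ((*v) F) \<Gamma>\<^sub>0) f \<and>
              (\<forall>T\<in>\<T>. \<exists>c. T \<in> connected_components_of
                 (subtopology (TM_space L \<Gamma>\<^sub>0) {p \<in> topspace (TM_space L \<Gamma>\<^sub>0). f p = c}))))
       \<and> (\<exists>\<epsilon>>0. \<forall>L' F'. linear L' \<and> onorm (\<lambda>v. L' v - L v) < \<epsilon> \<longrightarrow>
            (smooth_on F' UNIV \<and> C1_close_on \<epsilon> UNIV ((*v) F) F' \<longrightarrow>
               integrable_system TYPE((real^'n) \<times> real) (TM_space L' \<Gamma>\<^sub>0) (TM_proj L' \<Gamma>\<^sub>0)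
                 (LF_TM L' F' \<Gamma>\<^sub>0)) \<and>
            (smooth_on F' (cball 0 1) \<and> C1_close_on \<epsilon> (cball 0 1) ((*v) F) F' \<longrightarrow>
               integrable_system TYPE((real^'n) \<times> real) (SM_space L' \<Gamma>\<^sub>0) (TM_proj L' \<Gamma>\<^sub>0)
                 (LF_SM L' F' \<Gamma>\<^sub>0)))"
proof -
  obtain z1 where z1: "complex_eigenvalue F z1" "Re z1 > 0" using assms(3) by blast
  obtain z2 where z2: "complex_eigenvalue F z2" "Re z2 < 0" using assms(4) by blast
  obtain e1 where e1: "e1 > 0" "\<forall>G \<Omega>. (\<forall>x\<in>\<Omega>. \<forall>y\<in>\<Omega>.
      norm ((G x - F *v x) - (G y - F *v y)) \<le> e1 * norm (x - y)) \<longrightarrow> expanding G \<Omega>"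
    using unstable_eigenvalue_expanding[OF z1] by blast
  have z2': "complex_eigenvalue (- F) (- z2)" "Re (- z2) > 0" using z2 complex_eigenvalue_uminus by auto
  obtain e2 where e2: "e2 > 0" "\<forall>G \<Omega>. (\<forall>x\<in>\<Omega>. \<forall>y\<in>\<Omega>.
      norm ((G x - (- F) *v x) - (G y - (- F) *v y)) \<le> e2 * norm (x - y)) \<longrightarrow> expanding G \<Omega>"
    using unstable_eigenvalue_expanding[OF z2'] by blast
  define \<epsilon> where "\<epsilon> = min e1 e2"
  have \<epsilon>: "\<epsilon> > 0" using e1 e2 by (simp add: \<epsilon>_def)
  have le1: "\<epsilon> * norm x \<le> e1 * norm x" and le2: "\<epsilon> * norm x \<le> e2 * norm x" for x :: "real^'n"
    by (intro mult_right_mono; simp add: \<epsilon>_def)+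
  have exp1: "\<forall>G \<Omega>. (\<forall>x\<in>\<Omega>. \<forall>y\<in>\<Omega>. norm ((G x - F *v x) - (G y - F *v y)) \<le> \<epsilon> * norm (x - y))
      \<longrightarrow> expanding G \<Omega>"
    using e1(2) order_trans[OF _ le1] by (intro allI impI) blast
  have exp2: "\<forall>G \<Omega>. (\<forall>x\<in>\<Omega>. \<forall>y\<in>\<Omega>. norm ((G x - (- F) *v x) - (G y - (- F) *v y)) \<le> \<epsilon> * norm (x - y))
      \<longrightarrow> expanding G \<Omega>"
    using e2(2) order_trans[OF _ le2] by (intro allI impI) blast
  have "C_diff_on k ((*v) F) UNIV" for k
    by (intro C_diff_on_bounded_linear matrix_vector_mul_bounded_linear)
  then have F_smooth: "smooth_on ((*v) F) UNIV" by (simp add: smooth_on_def)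
  have lip: "norm (F *v x - F *v y) \<le> onorm ((*v) F) * norm (x - y)" for x y
    using onorm[of "(*v) F" "x - y"] by (simp add: matrix_vector_mul_bounded_linear matrix_vector_mult_diff_distrib)
  interpret LF_linear F "onorm ((*v) F)" L \<Gamma>\<^sub>0
    by (intro LF_linear.intro LF_lattice.intro LF_reduced.intro LF_lattice_axioms.intro assms F_smooth lip)
      (simp_all add: onorm_pos_le matrix_vector_mul_bounded_linear)
  have "expanding ((*v) F) UNIV" by (rule exp1[rule_format]) (simp add: \<epsilon> less_imp_le)
  moreover have "expanding (\<lambda>x. - (F *v x)) UNIV"
    by (rule exp2[rule_format]) (simp add: \<epsilon> less_imp_le matrix_uminus_mult_vector)
  ultimately have part1: "\<exists>\<T>. integrable_with_tori TYPE((real^'n) \<times> real) (TM_space L \<Gamma>\<^sub>0) (TM_proj L \<Gamma>\<^sub>0) (LF_TM L ((*v) F) \<Gamma>\<^sub>0) \<T> \<and>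
     (\<exists>f :: 'n grp set \<times> 'n alg \<Rightarrow> (real^'n) \<times> real.
        analytic_first_integral_on (\<Union>\<T>) (TM_proj L \<Gamma>\<^sub>0) (LF_TM L ((*v) F) \<Gamma>\<^sub>0) f \<and>
        (\<forall>T\<in>\<T>. \<exists>c. T = {p \<in> \<Union>\<T>. f p = c})) \<and>
     (\<exists>f :: 'n grp set \<times> 'n alg \<Rightarrow> (real^'n) \<times> real.
        analytic_first_integral_on (topspace (TM_space L \<Gamma>\<^sub>0)) (TM_proj L \<Gamma>\<^sub>0) (LF_TM L ((*v) F) \<Gamma>\<^sub>0) f \<and>
        (\<forall>T\<in>\<T>. \<exists>c. T \<in> connected_components_of
           (subtopology (TM_space L \<Gamma>\<^sub>0) {p \<in> topspace (TM_space L \<Gamma>\<^sub>0). f p = c})))"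
    by (rule integrable_with_first_integrals)
  have tm: "integrable_system TYPE((real^'n) \<times> real) (TM_space L' \<Gamma>\<^sub>0) (TM_proj L' \<Gamma>\<^sub>0) (LF_TM L' F' \<Gamma>\<^sub>0)"
    if "linear L'" "smooth_on F' UNIV" "C1_close_on \<epsilon> UNIV ((*v) F) F'" for L' F'
  proof -
    \<comment> \<open>On TM the zero vector is a limit of nonzero vectors; on SM the unit sphere
      does not contain it.\<close>
    have cl: "UNIV \<subseteq> closure (UNIV - {0 :: 'n alg})"
      using closure_complement[of "{0 :: 'n alg}"] by (simp add: Compl_eq_Diff_UNIV)
    from LF_close_integrable[OF that(1) assms(2) \<epsilon> exp1 exp2 that(2,3) convex_UNIV _ _ cl]
    show ?thesis by simp
  qed
  have sm: "integrable_system TYPE((real^'n) \<times> real) (SM_space L' \<Gamma>\<^sub>0) (TM_proj L' \<Gamma>\<^sub>0) (LF_SM L' F' \<Gamma>\<^sub>0)"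
    if "linear L'" "smooth_on F' (cball 0 1)" "C1_close_on \<epsilon> (cball 0 1) ((*v) F) F'" for L' F'
  proof -
    have "{v :: 'n alg. norm v = 1} - {0} = {v. norm v = 1}" by auto
    then have cl: "{v :: 'n alg. norm v = 1} \<subseteq> closure ({v. norm v = 1} - {0})" using closure_subset by metis
    from LF_close_integrable[OF that(1) assms(2) \<epsilon> exp1 exp2 that(2,3) convex_cball _ _ cl]
    show ?thesis by (simp add: SM_space_def LF_SM_def)
  qed
  show ?thesis
    by (rule conjI[OF part1], rule exI[of _ \<epsilon>], intro conjI allI impI \<epsilon>) (simp_all add: tm sm)
qed

end
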